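(* Let $P^*=(Q_Y^*,\pi_t^*,H_t^{\bar a,*},Q_{M_t}^{\bar a,*},R_{M_t}^{\bar a,*}:t=0,\dots,T)$ be fixed candidate nuisance functions (the large sample limits of the nuisance estimators). Then $$\mathbb E\{D^*(P^* )(O)\}=\Psi^{\bar a_T}(P)-\Psi^{\bar a_T}(P^* )$$ if any one of the following conditions holds: (i) $H_t^{\bar a,*}=H_t^{\bar a}$ and $\pi_t^*=\pi_t$ for $t=0,\dots,T$; (ii) $Q_Y^*=Q_Y$ and $\pi_t^*=\pi_t$ for $t=0,\dots,T$; (iii) $Q_{M_t}^{\bar a,*}=\tilde Q_{M_t}^{\bar a,*}$, $R_{M_t}^{\bar a,*}=\tilde R_{M_t}^{\bar a,*}$ and $H_t^{\bar a,*}=H_t^{\bar a}$ for $t=0,\dots,T$.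
   Context: Setting. $T\ge 0$ is an integer and $O=(W,A_0,M_0,\dots,A_T,M_T,Y)\sim P$, where $W\in\mathbb R^d$, $A_t\in\{0,1\}$, $M_t\in\mathcal M_t\subseteq\mathbb R^p$, $Y\in\mathbb R$ integrable. $\mathbb E$ is expectation under $P$. Write $\bar X_t=(X_0,\dots,X_t)$; variables with negative index are empty. $W$ has density $p(w)$ with respect to a measure $\mu_W$; $\pi_t(a_t\mid w,\bar m_{t-1},\bar a_{t-1})$ is the conditional probability that $A_t=a_t$ given $(W,\bar M_{t-1},\bar A_{t-1})$; $g_t(m_t\mid w,\bar a_t,\bar m_{t-1})$ is the conditional density of $M_t$ given $(W,\bar A_t,\bar M_{t-1})$ with respect to a measure $\mu_{M_t}$; $Q_Y(w,\bar a_T,\bar m_T)=\mathbb E(Y\mid W=w,\bar A_T=\bar a_T,\bar M_T=\bar m_T)$. Fix $\bar a_T\in\{0,1\}^{T+1}$. Longitudinal front-door functional: $$\Psi^{\bar a_T}(P)=\int\!\!\int \prod_{t=0}^T g_t(m_t\mid w,\bar a_t,\bar m_{t-1})\sum_{\bar a_T'\in\{0,1\}^{T+1}}Q_Y(w,\bar a_T',\bar m_T)\prod_{t=0}^T\pi_t(a_t'\mid w,\bar m_{t-1},\bar a'_{t-1})\,p(w)\prod_{t=0}^T d\mu_{M_t}(m_t)\,d\mu_W(w).$$ Positivity (standing assumption). (P1) There is $\delta>0$ with $\prod_{t=0}^T\pi_t(a_t\mid w,\bar m_{t-1},\bar a_{t-1})\ge\delta$ for almost every $(w,\bar m_T)$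 under the law with density $p(w)\prod_{t=0}^T g_t(m_t\mid w,\bar a_t,\bar m_{t-1})$. (P2) There is $C<\infty$ such that for every $\bar a_T'\in\{0,1\}^{T+1}$ and almost every $(w,\bar m_T)$ (with respect to $p(w)d\mu_W\prod_t d\mu_{M_t}$) with $\prod_{t=0}^T\pi_t(a_t'\mid w,\bar m_{t-1},\bar a'_{t-1})>0$, one has $\prod_{t=0}^T g_t(m_t\mid w,\bar a_t,\bar m_{t-1})\le C\prod_{t=0}^T g_t(m_t\mid w,\bar a'_t,\bar m_{t-1})$. True weights: $H_t^{\bar a}(W,\bar A_t,\bar M_t)=\prod_{k=0}^t\frac{g_k(M_k\mid W,\bar a_k,\bar M_{k-1})}{g_k(M_k\mid W,\bar A_k,\bar M_{k-1})}$. Candidate nuisance functions. $Q_Y^*(w,\bar a_T',\bar m_T)$, $H_t^{\bar a,*}(w,\bar a'_t,\bar m_t)$, $Q_{M_t}^{\bar a,*}(w,\bar m_{t-1})$, $R_{M_t}^{\bar a,*}(w,\bar a_t',\bar m_{t-1})$ are real measurable functions, $\pi_t^*(\cdot\mid w,\bar m_{t-1},\bar a'_{t-1})$ is a probability mass function on $\{0,1\}$, for $t=0,\dots,T$, with $H_{-1}^{\bar a,*}=1$. From these define $$W_t^{\bar a,*}=\prod_{k=0}^t\frac{\mathbf 1(A_k=a_k)}{\pi^*_k(a_k\mid W,\bar M_{k-1},\bar A_{k-1})},\qquad Q^{\bar a,*}_{M_{T+1}}(W,\bar M_T)=\sum_{\bar a_T'\in\{0,1\}^{T+1}}Q^*_Y(W,\bar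 a_T',\bar M_T)\prod_{t=0}^T\pi^*_t(a_t'\mid W,\bar M_{t-1},\bar a'_{t-1}),$$ $R^{\bar a,*}_{A_{T+1}}=Q_Y^*$, and $R^{\bar a,*}_{A_t}(w,\bar a_{t-1}',\bar m_{t-1})=\sum_{a_t'\in\{0,1\}}R^{\bar a,*}_{M_t}(w,\bar a_t',\bar m_{t-1})\pi_t^*(a_t'\mid w,\bar m_{t-1},\bar a_{t-1}')$. Further, with conditional expectations under the true $P$, $$\tilde Q^{\bar a,*}_{M_t}(W,\bar M_{t-1})=\mathbb E\{Q^{\bar a,*}_{M_{t+1}}(W,\bar M_t)\mid W,\bar A_t=\bar a_t,\bar M_{t-1}\},$$ $$\tilde R^{\bar a,*}_{M_t}(W,\bar a_t',\bar M_{t-1})=\mathbb E\{R^{\bar a,*}_{A_{t+1}}(W,\bar a_t',\bar M_t)\mid W,\bar A_t=\bar a_t,\bar M_{t-1}\},\quad \bar a'_t\in\{0,1\}^{t+1}.$$ Then $$D^*(P^* )(O)=H_T^{\bar a,*}\{Y-Q_Y^*(W,\bar A_T,\bar M_T)\}+\sum_{t=0}^TW_t^{\bar a,*}\{Q^{\bar a,*}_{M_{t+1}}(W,\bar M_t)-Q^{\bar a,*}_{M_t}(W,\bar M_{t-1})\}$$ $$\quad+\sum_{t=0}^TH_{t-1}^{\bar a,*}\{R^{\bar a,*}_{M_t}(W,\bar A_t,\bar M_{t-1})-R^{\bar a,*}_{A_t}(W,\bar A_{t-1},\bar M_{t-1})\}+Q^{\bar a,*}_{M_0}(W)-\Psi^{\bar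 a_T}(P^* ),$$ where $H_t^{\bar a,*}$ is evaluated at $(W,\bar A_t,\bar M_t)$ and $\Psi^{\bar a_T}(P^* )$ is the (finite) plug-in value of the target parameter assigned to $P^*$, e.g. $\mathbb E\{Q^{\bar a,*}_{M_0}(W)\}$; the same number appears in $D^*(P^* )$ and in the claim. $\pi_t^*(a_t\mid\cdot)$ is positive wherever it is divided by, and all products of weights and regression functions (true, candidate, or with a tilde) arising in these expressions after expanding are assumed $P$-integrable. *)

theory Defs
  imports "HOL-Probability.Probability"
begin

text \<open>
  Treatments in \<open>{0,1}\<close> are booleans.  A finite sequence \<open>(x\<^sub>0, \<dots>, x\<^sub>n\<^sub>-\<^sub>1)\<close> is an extensional
  function on \<open>{..<n}\<close>, so that its measurable space is a finite product \<open>PiM {..<n}\<close>.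
  Hence \<open>past t x\<close> is the sequence with last index \<open>t - 1\<close> (empty for \<open>t = 0\<close>) and
  \<open>past (Suc t) x\<close> the one with last index \<open>t\<close>.  Functions of a history take the tuple
  (baseline, treatments, mediators), always in this order.
\<close>

definition past :: "nat \<Rightarrow> (nat \<Rightarrow> 'x) \<Rightarrow> nat \<Rightarrow> 'x" where
  "past n x = restrict x {..<n}"

definition bin_seqs :: "nat \<Rightarrow> (nat \<Rightarrow> bool) set" where
  "bin_seqs n = PiE {..<n} (\<lambda>_. UNIV)"

type_synonym ('w, 'm) hist = "'w \<times> (nat \<Rightarrow> bool) \<times> (nat \<Rightarrow> 'm)"

definition hist_space ::
  "'w measure \<Rightarrow> (nat \<Rightarrow> 'm measure) \<Rightarrow> nat \<Rightarrow> nat \<Rightarrow> ('w, 'm) hist measure" where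
  "hist_space \<mu>W \<mu>M n k =
     \<mu>W \<Otimes>\<^sub>M (PiM {..<n} (\<lambda>_. count_space UNIV) \<Otimes>\<^sub>M PiM {..<k} \<mu>M)"

definition obs_hist ::
  "('o \<Rightarrow> 'w) \<Rightarrow> (nat \<Rightarrow> 'o \<Rightarrow> bool) \<Rightarrow> (nat \<Rightarrow> 'o \<Rightarrow> 'm) \<Rightarrow> nat \<Rightarrow> nat \<Rightarrow> 'o \<Rightarrow> ('w, 'm) hist" where
  "obs_hist W A M n k \<omega> = (W \<omega>, past n (\<lambda>j. A j \<omega>), past k (\<lambda>j. M j \<omega>))"

definition hist_sigma ::
  "'o measure \<Rightarrow> ('o \<Rightarrow> 'w) \<Rightarrow> (nat \<Rightarrow> 'o \<Rightarrow> bool) \<Rightarrow> (nat \<Rightarrow> 'o \<Rightarrow> 'm) \<Rightarrow>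
   'w measure \<Rightarrow> (nat \<Rightarrow> 'm measure) \<Rightarrow> nat \<Rightarrow> nat \<Rightarrow> 'o measure" where
  "hist_sigma P W A M \<mu>W \<mu>M n k =
     vimage_algebra (space P) (obs_hist W A M n k) (hist_space \<mu>W \<mu>M n k)"

locale longitudinal_data = prob_space P for P :: "'o measure" +
  fixes T :: nat
    and W :: "'o \<Rightarrow> real^'d"
    and A :: "nat \<Rightarrow> 'o \<Rightarrow> bool"
    and M :: "nat \<Rightarrow> 'o \<Rightarrow> real^'p"
    and Y :: "'o \<Rightarrow> real"
    and MM :: "nat \<Rightarrow> (real^'p) set"
    and \<mu>W :: "(real^'d) measure"
    and \<mu>M :: "nat \<Rightarrow> (real^'p) measure"
  assumes sets_\<mu>W: "sets \<mu>W = sets borel"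
    and sigma_finite_\<mu>W: "sigma_finite_measure \<mu>W"
    and sets_\<mu>M: "\<And>t. t \<le> T \<Longrightarrow> sets (\<mu>M t) = sets (restrict_space borel (MM t))"
    and sigma_finite_\<mu>M: "\<And>t. t \<le> T \<Longrightarrow> sigma_finite_measure (\<mu>M t)"
    and W_measurable: "W \<in> measurable P borel"
    and A_measurable: "\<And>t. t \<le> T \<Longrightarrow> A t \<in> measurable P (count_space UNIV)"
    and M_measurable: "\<And>t. t \<le> T \<Longrightarrow> M t \<in> measurable P (restrict_space borel (MM t))"
    and Y_integrable: "integrable P Y"

text \<open>
  \<open>p\<close>, \<open>\<pi>\<close>, \<open>g\<close> and \<open>QY\<close> are arbitrary versions of the density, the conditional probabilities,
  the conditional densities and the regression function; \<open>\<pi> t h b\<close> is the probability of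
  \<open>A t = b\<close> given the history \<open>h\<close>.  As usual for regular versions, \<open>\<pi>\<close> and \<open>g\<close> are normalised at
  every history, so that \<open>p\<close> times a product of the \<open>g\<close> at a fixed treatment sequence is again
  a probability density.
\<close>

locale true_nuisance = longitudinal_data P T W A M Y MM \<mu>W \<mu>M
  for P :: "'o measure" and T :: nat and W :: "'o \<Rightarrow> real^'d"
    and A :: "nat \<Rightarrow> 'o \<Rightarrow> bool" and M :: "nat \<Rightarrow> 'o \<Rightarrow> real^'p" and Y :: "'o \<Rightarrow> real"
    and MM :: "nat \<Rightarrow> (real^'p) set"
    and \<mu>W :: "(real^'d) measure" and \<mu>M :: "nat \<Rightarrow> (real^'p) measure" +
  fixes p :: "real^'d \<Rightarrow> real"
    and \<pi> :: "nat \<Rightarrow> (real^'d, real^'p) hist \<Rightarrow> bool \<Rightarrow> real"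
    and g :: "nat \<Rightarrow> (real^'d, real^'p) hist \<Rightarrow> real^'p \<Rightarrow> real"
    and QY :: "(real^'d, real^'p) hist \<Rightarrow> real"
  assumes p_measurable: "p \<in> borel_measurable \<mu>W"
    and p_nonneg: "\<And>w. 0 \<le> p w"
    and p_density: "distributed P \<mu>W W (\<lambda>w. ennreal (p w))"
    and \<pi>_measurable: "\<And>t b. t \<le> T \<Longrightarrow>
          (\<lambda>h. \<pi> t h b) \<in> borel_measurable (hist_space \<mu>W \<mu>M t t)"
    and \<pi>_nonneg: "\<And>t h b. t \<le> T \<Longrightarrow> h \<in> space (hist_space \<mu>W \<mu>M t t) \<Longrightarrow> 0 \<le> \<pi> t h b"
    and \<pi>_sum: "\<And>t h. t \<le> T \<Longrightarrow> h \<in> space (hist_space \<mu>W \<mu>M t t) \<Longrightarrow>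
          (\<Sum>b\<in>UNIV. \<pi> t h b) = 1"
    and \<pi>_cond_prob: "\<And>t b. t \<le> T \<Longrightarrow>
          AE \<omega> in P. \<pi> t (obs_hist W A M t t \<omega>) b =
            real_cond_exp P (hist_sigma P W A M \<mu>W \<mu>M t t) (indicator {\<omega>. A t \<omega> = b}) \<omega>"
    and g_measurable: "\<And>t. t \<le> T \<Longrightarrow>
          (\<lambda>(h, x). g t h x) \<in> borel_measurable (hist_space \<mu>W \<mu>M (Suc t) t \<Otimes>\<^sub>M \<mu>M t)"
    and g_nonneg: "\<And>t h x. t \<le> T \<Longrightarrow> h \<in> space (hist_space \<mu>W \<mu>M (Suc t) t) \<Longrightarrow>
          x \<in> MM t \<Longrightarrow> 0 \<le> g t h x"
    and g_normalised: "\<And>t h. t \<le> T \<Longrightarrow> h \<in> space (hist_space \<mu>W \<mu>M (Suc t) t) \<Longrightarrow>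
          (\<integral>\<^sup>+x. ennreal (g t h x) \<partial>\<mu>M t) = 1"
    and g_cond_density: "\<And>t B. t \<le> T \<Longrightarrow> B \<in> sets (\<mu>M t) \<Longrightarrow>
          AE \<omega> in P. (\<integral>x\<in>B. g t (obs_hist W A M (Suc t) t \<omega>) x \<partial>\<mu>M t) =
            real_cond_exp P (hist_sigma P W A M \<mu>W \<mu>M (Suc t) t) (indicator {\<omega>. M t \<omega> \<in> B}) \<omega>"
    and QY_measurable: "QY \<in> borel_measurable (hist_space \<mu>W \<mu>M (Suc T) (Suc T))"
    and QY_cond_exp:
          "AE \<omega> in P. QY (obs_hist W A M (Suc T) (Suc T) \<omega>) =
             real_cond_exp P (hist_sigma P W A M \<mu>W \<mu>M (Suc T) (Suc T)) Y \<omega>"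

definition prod_g ::
  "(nat \<Rightarrow> ('w, 'm) hist \<Rightarrow> 'm \<Rightarrow> real) \<Rightarrow> nat \<Rightarrow> 'w \<Rightarrow> (nat \<Rightarrow> bool) \<Rightarrow> (nat \<Rightarrow> 'm) \<Rightarrow> real" where
  "prod_g g n w a m = (\<Prod>t<n. g t (w, past (Suc t) a, past t m) (m t))"

definition prod_\<pi> ::
  "(nat \<Rightarrow> ('w, 'm) hist \<Rightarrow> bool \<Rightarrow> real) \<Rightarrow> nat \<Rightarrow> 'w \<Rightarrow> (nat \<Rightarrow> bool) \<Rightarrow> (nat \<Rightarrow> 'm) \<Rightarrow> real" where
  "prod_\<pi> \<pi> n w a m = (\<Prod>t<n. \<pi> t (w, past t a, past t m) (a t))"

definition front_door ::
  "nat \<Rightarrow> 'w measure \<Rightarrow> (nat \<Rightarrow> 'm measure) \<Rightarrow> ('w \<Rightarrow> real) \<Rightarrow>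
   (nat \<Rightarrow> ('w, 'm) hist \<Rightarrow> bool \<Rightarrow> real) \<Rightarrow> (nat \<Rightarrow> ('w, 'm) hist \<Rightarrow> 'm \<Rightarrow> real) \<Rightarrow>
   (('w, 'm) hist \<Rightarrow> real) \<Rightarrow> (nat \<Rightarrow> bool) \<Rightarrow> real" where
  "front_door T \<mu>W \<mu>M p \<pi> g QY a =
     (\<integral>w. (\<integral>m. prod_g g (Suc T) w a m *
              (\<Sum>a'\<in>bin_seqs (Suc T). QY (w, a', m) * prod_\<pi> \<pi> (Suc T) w a' m) * p w
            \<partial>PiM {..<Suc T} \<mu>M) \<partial>\<mu>W)"

definition positivity_treatment ::
  "nat \<Rightarrow> 'w measure \<Rightarrow> (nat \<Rightarrow> 'm measure) \<Rightarrow> ('w \<Rightarrow> real) \<Rightarrow>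
   (nat \<Rightarrow> ('w, 'm) hist \<Rightarrow> bool \<Rightarrow> real) \<Rightarrow> (nat \<Rightarrow> ('w, 'm) hist \<Rightarrow> 'm \<Rightarrow> real) \<Rightarrow>
   (nat \<Rightarrow> bool) \<Rightarrow> bool" where
  "positivity_treatment T \<mu>W \<mu>M p \<pi> g a \<longleftrightarrow>
     (\<exists>\<delta>>0. AE (w, m) in density (\<mu>W \<Otimes>\<^sub>M PiM {..<Suc T} \<mu>M)
                            (\<lambda>(w, m). ennreal (p w * prod_g g (Suc T) w a m)).
        \<delta> \<le> prod_\<pi> \<pi> (Suc T) w a m)"

definition positivity_mediator ::
  "nat \<Rightarrow> 'w measure \<Rightarrow> (nat \<Rightarrow> 'm measure) \<Rightarrow> ('w \<Rightarrow> real) \<Rightarrow>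
   (nat \<Rightarrow> ('w, 'm) hist \<Rightarrow> bool \<Rightarrow> real) \<Rightarrow> (nat \<Rightarrow> ('w, 'm) hist \<Rightarrow> 'm \<Rightarrow> real) \<Rightarrow>
   (nat \<Rightarrow> bool) \<Rightarrow> bool" where
  "positivity_mediator T \<mu>W \<mu>M p \<pi> g a \<longleftrightarrow>
     (\<exists>C::real. \<forall>a'\<in>bin_seqs (Suc T).
        AE (w, m) in density (\<mu>W \<Otimes>\<^sub>M PiM {..<Suc T} \<mu>M) (\<lambda>(w, m). ennreal (p w)).
          0 < prod_\<pi> \<pi> (Suc T) w a' m \<longrightarrow>
          prod_g g (Suc T) w a m \<le> C * prod_g g (Suc T) w a' m)"

text \<open>The true weight \<open>H\<^sub>t\<close>.  Its denominator is positive almost surely at the observed history.\<close>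

definition H_true ::
  "(nat \<Rightarrow> ('w, 'm) hist \<Rightarrow> 'm \<Rightarrow> real) \<Rightarrow> (nat \<Rightarrow> bool) \<Rightarrow> nat \<Rightarrow> ('w, 'm) hist \<Rightarrow> real" where
  "H_true g a t = (\<lambda>(w, a', m).
     \<Prod>k<Suc t. g k (w, past (Suc k) a, past k m) (m k) / g k (w, past (Suc k) a', past k m) (m k))"

record ('w, 'm) nuisance =
  QY_star :: "('w, 'm) hist \<Rightarrow> real"
  \<pi>_star :: "nat \<Rightarrow> ('w, 'm) hist \<Rightarrow> bool \<Rightarrow> real"
  H_star :: "nat \<Rightarrow> ('w, 'm) hist \<Rightarrow> real"
  QM_star :: "nat \<Rightarrow> 'w \<times> (nat \<Rightarrow> 'm) \<Rightarrow> real"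
  RM_star :: "nat \<Rightarrow> ('w, 'm) hist \<Rightarrow> real"

definition candidate_nuisance ::
  "nat \<Rightarrow> 'w measure \<Rightarrow> (nat \<Rightarrow> 'm measure) \<Rightarrow> ('w, 'm) nuisance \<Rightarrow> bool" where
  "candidate_nuisance T \<mu>W \<mu>M N \<longleftrightarrow>
     QY_star N \<in> borel_measurable (hist_space \<mu>W \<mu>M (Suc T) (Suc T)) \<and>
     (\<forall>t\<le>T.
        (\<forall>b. (\<lambda>h. \<pi>_star N t h b) \<in> borel_measurable (hist_space \<mu>W \<mu>M t t)) \<and>
        (\<forall>h\<in>space (hist_space \<mu>W \<mu>M t t).
            (\<forall>b. 0 \<le> \<pi>_star N t h b) \<and> (\<Sum>b\<in>UNIV. \<pi>_star N t h b) = 1) \<and>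
        H_star N t \<in> borel_measurable (hist_space \<mu>W \<mu>M (Suc t) (Suc t)) \<and>
        QM_star N t \<in> borel_measurable (\<mu>W \<Otimes>\<^sub>M PiM {..<t} \<mu>M) \<and>
        RM_star N t \<in> borel_measurable (hist_space \<mu>W \<mu>M (Suc t) t))"

text \<open>
  In the following functions the sequence arguments may be longer than the histories they are
  evaluated at; truncation happens inside.  \<open>H_prev N t\<close> is the weight with index \<open>t - 1\<close>.
\<close>

definition W_star ::
  "('w, 'm) nuisance \<Rightarrow> (nat \<Rightarrow> bool) \<Rightarrow> nat \<Rightarrow> 'w \<Rightarrow> (nat \<Rightarrow> bool) \<Rightarrow> (nat \<Rightarrow> 'm) \<Rightarrow> real" where
  "W_star N a t w a' m =
     (\<Prod>k<Suc t. of_bool (a' k = a k) / \<pi>_star N k (w, past k a', past k m) (a k))"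

definition H_prev ::
  "('w, 'm) nuisance \<Rightarrow> nat \<Rightarrow> 'w \<Rightarrow> (nat \<Rightarrow> bool) \<Rightarrow> (nat \<Rightarrow> 'm) \<Rightarrow> real" where
  "H_prev N t w a' m = (if t = 0 then 1 else H_star N (t - 1) (w, past t a', past t m))"

definition QM ::
  "nat \<Rightarrow> ('w, 'm) nuisance \<Rightarrow> nat \<Rightarrow> 'w \<Rightarrow> (nat \<Rightarrow> 'm) \<Rightarrow> real" where
  "QM T N t w m =
     (if t = Suc T
      then \<Sum>a'\<in>bin_seqs (Suc T).
             QY_star N (w, a', past (Suc T) m) * prod_\<pi> (\<pi>_star N) (Suc T) w a' m
      else QM_star N t (w, past t m))"

definition RM ::
  "('w, 'm) nuisance \<Rightarrow> nat \<Rightarrow> 'w \<Rightarrow> (nat \<Rightarrow> bool) \<Rightarrow> (nat \<Rightarrow> 'm) \<Rightarrow> real" where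
  "RM N t w a' m = RM_star N t (w, past (Suc t) a', past t m)"

definition RA ::
  "nat \<Rightarrow> ('w, 'm) nuisance \<Rightarrow> nat \<Rightarrow> 'w \<Rightarrow> (nat \<Rightarrow> bool) \<Rightarrow> (nat \<Rightarrow> 'm) \<Rightarrow> real" where
  "RA T N t w a' m =
     (if t = Suc T then QY_star N (w, past (Suc T) a', past (Suc T) m)
      else \<Sum>b\<in>UNIV. RM N t w (a'(t := b)) m * \<pi>_star N t (w, past t a', past t m) b)"

definition D_star ::
  "nat \<Rightarrow> ('w, 'm) nuisance \<Rightarrow> (nat \<Rightarrow> bool) \<Rightarrow> real \<Rightarrow>
   'w \<Rightarrow> (nat \<Rightarrow> bool) \<Rightarrow> (nat \<Rightarrow> 'm) \<Rightarrow> real \<Rightarrow> real" where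
  "D_star T N a \<psi> w a' m y =
     H_star N T (w, past (Suc T) a', past (Suc T) m)
       * (y - QY_star N (w, past (Suc T) a', past (Suc T) m))
     + (\<Sum>t\<le>T. W_star N a t w a' m * (QM T N (Suc t) w m - QM T N t w m))
     + (\<Sum>t\<le>T. H_prev N t w a' m * (RM N t w a' m - RA T N t w a' m))
     + QM T N 0 w m - \<psi>"

text \<open>
  \<open>q\<close> is a version of \<open>E(f | F)\<close> on the event \<open>E\<close> (in \<open>F\<close>).  A function of
  \<open>(W, M\<^sub>0, \<dots>, M\<^sub>t\<^sub>-\<^sub>1)\<close> that is a conditional expectation given these variables and
  \<open>(A\<^sub>0, \<dots>, A\<^sub>t) = (a\<^sub>0, \<dots>, a\<^sub>t)\<close> is determined only on that event.  The indicator inside the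
  conditional expectation is harmless since \<open>E\<close> belongs to \<open>F\<close>; it makes integrability of
  \<open>f\<close> off \<open>E\<close> irrelevant.
\<close>

definition cond_exp_on ::
  "'o measure \<Rightarrow> 'o measure \<Rightarrow> 'o set \<Rightarrow> ('o \<Rightarrow> real) \<Rightarrow> ('o \<Rightarrow> real) \<Rightarrow> bool" where
  "cond_exp_on P F E f q \<longleftrightarrow>
     (AE \<omega> in P. \<omega> \<in> E \<longrightarrow> q \<omega> = real_cond_exp P F (\<lambda>\<omega>. indicator E \<omega> * f \<omega>) \<omega>)"

definition treated_event ::
  "'o measure \<Rightarrow> (nat \<Rightarrow> 'o \<Rightarrow> bool) \<Rightarrow> (nat \<Rightarrow> bool) \<Rightarrow> nat \<Rightarrow> 'o set" where
  "treated_event P A a t = {\<omega>\<in>space P. \<forall>k\<le>t. A k \<omega> = a k}"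

definition QM_is_tilde ::
  "'o measure \<Rightarrow> nat \<Rightarrow> ('o \<Rightarrow> 'w) \<Rightarrow> (nat \<Rightarrow> 'o \<Rightarrow> bool) \<Rightarrow> (nat \<Rightarrow> 'o \<Rightarrow> 'm) \<Rightarrow>
   'w measure \<Rightarrow> (nat \<Rightarrow> 'm measure) \<Rightarrow> ('w, 'm) nuisance \<Rightarrow> (nat \<Rightarrow> bool) \<Rightarrow> nat \<Rightarrow> bool" where
  "QM_is_tilde P T W A M \<mu>W \<mu>M N a t \<longleftrightarrow>
     cond_exp_on P (hist_sigma P W A M \<mu>W \<mu>M (Suc t) t) (treated_event P A a t)
       (\<lambda>\<omega>. QM T N (Suc t) (W \<omega>) (\<lambda>j. M j \<omega>))
       (\<lambda>\<omega>. QM_star N t (W \<omega>, past t (\<lambda>j. M j \<omega>)))"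

definition RM_is_tilde ::
  "'o measure \<Rightarrow> nat \<Rightarrow> ('o \<Rightarrow> 'w) \<Rightarrow> (nat \<Rightarrow> 'o \<Rightarrow> bool) \<Rightarrow> (nat \<Rightarrow> 'o \<Rightarrow> 'm) \<Rightarrow>
   'w measure \<Rightarrow> (nat \<Rightarrow> 'm measure) \<Rightarrow> ('w, 'm) nuisance \<Rightarrow> (nat \<Rightarrow> bool) \<Rightarrow> nat \<Rightarrow> bool" where
  "RM_is_tilde P T W A M \<mu>W \<mu>M N a t \<longleftrightarrow>
     (\<forall>a'\<in>bin_seqs (Suc t).
        cond_exp_on P (hist_sigma P W A M \<mu>W \<mu>M (Suc t) t) (treated_event P A a t)
          (\<lambda>\<omega>. RA T N (Suc t) (W \<omega>) a' (\<lambda>j. M j \<omega>))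
          (\<lambda>\<omega>. RM_star N t (W \<omega>, a', past t (\<lambda>j. M j \<omega>))))"

text \<open>
  Integrability of the products in \<open>D_star\<close> after all sums (also those inside \<open>QM\<close> at
  \<open>Suc T\<close> and inside \<open>RA\<close>) are expanded.
\<close>

definition products_integrable ::
  "'o measure \<Rightarrow> nat \<Rightarrow> ('o \<Rightarrow> 'w) \<Rightarrow> (nat \<Rightarrow> 'o \<Rightarrow> bool) \<Rightarrow> (nat \<Rightarrow> 'o \<Rightarrow> 'm) \<Rightarrow> ('o \<Rightarrow> real) \<Rightarrow>
   ('w, 'm) nuisance \<Rightarrow> (nat \<Rightarrow> bool) \<Rightarrow> bool" where
  "products_integrable P T W A M Y N a \<longleftrightarrow>
     integrable P (\<lambda>\<omega>. H_star N T (obs_hist W A M (Suc T) (Suc T) \<omega>) * Y \<omega>) \<and>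
     integrable P (\<lambda>\<omega>. H_star N T (obs_hist W A M (Suc T) (Suc T) \<omega>)
                        * QY_star N (obs_hist W A M (Suc T) (Suc T) \<omega>)) \<and>
     (\<forall>a'\<in>bin_seqs (Suc T).
        integrable P (\<lambda>\<omega>. W_star N a T (W \<omega>) (\<lambda>j. A j \<omega>) (\<lambda>j. M j \<omega>)
                          * (QY_star N (W \<omega>, a', past (Suc T) (\<lambda>j. M j \<omega>))
                             * prod_\<pi> (\<pi>_star N) (Suc T) (W \<omega>) a' (\<lambda>j. M j \<omega>)))) \<and>
     (\<forall>t<T. integrable P (\<lambda>\<omega>. W_star N a t (W \<omega>) (\<lambda>j. A j \<omega>) (\<lambda>j. M j \<omega>)
                                * QM T N (Suc t) (W \<omega>) (\<lambda>j. M j \<omega>))) \<and>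
     (\<forall>t\<le>T. integrable P (\<lambda>\<omega>. W_star N a t (W \<omega>) (\<lambda>j. A j \<omega>) (\<lambda>j. M j \<omega>)
                                * QM T N t (W \<omega>) (\<lambda>j. M j \<omega>))) \<and>
     (\<forall>t\<le>T. integrable P (\<lambda>\<omega>. H_prev N t (W \<omega>) (\<lambda>j. A j \<omega>) (\<lambda>j. M j \<omega>)
                                * RM N t (W \<omega>) (\<lambda>j. A j \<omega>) (\<lambda>j. M j \<omega>))) \<and>
     (\<forall>t\<le>T. \<forall>b. integrable P (\<lambda>\<omega>. H_prev N t (W \<omega>) (\<lambda>j. A j \<omega>) (\<lambda>j. M j \<omega>)
                                * (RM N t (W \<omega>) ((\<lambda>j. A j \<omega>)(t := b)) (\<lambda>j. M j \<omega>)
                                   * \<pi>_star N t (obs_hist W A M t t \<omega>) b))) \<and>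
     integrable P (\<lambda>\<omega>. QM T N 0 (W \<omega>) (\<lambda>j. M j \<omega>))"

end

theory Submission
  imports Defs
begin

text \<open>
  All terms are compared under the law \<open>Q\<close> of \<open>(W, M\<^sub>0, \<dots>, M\<^sub>T)\<close> with density
  \<open>p \<Prod> g\<^sub>t(m\<^sub>t | w, a\<^sub>t, m\<^sub>t\<^sub>-\<^sub>1)\<close>.  By positivity, weighting by the true inverse probability weight
  on the event that the treatments follow \<open>a\<close> turns \<open>P\<close> into \<open>Q\<close>, and weighting by the true
  density ratio \<open>H\<^sub>t\<close> on the event that they follow \<open>a'\<close> turns \<open>P\<close> into \<open>\<Prod> \<pi>\<^sub>k(a'\<^sub>k | \<dots>) \<cdot> Q\<close>.
  Hence \<open>E(H\<^sub>T Y)\<close> is the front-door functional when the density ratios are correct.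

  If the treatment probabilities are correct, the sum of the \<open>W\<^sub>t\<close> terms telescopes to
  \<open>E\<^sub>Q(Q\<^sub>M\<^sub>,\<^sub>T\<^sub>+\<^sub>1) - E(Q\<^sub>M\<^sub>,\<^sub>0)\<close> and the \<open>R\<close> terms vanish; what remains is
  \<open>E(H\<^sub>T (Y - Q\<^sub>Y)) + E\<^sub>Q(Q\<^sub>M\<^sub>,\<^sub>T\<^sub>+\<^sub>1)\<close>.  If instead the sequential regressions and the density ratios
  are correct, the \<open>W\<^sub>t\<close> terms vanish, the \<open>R\<close> terms telescope to \<open>E(H\<^sub>T Q\<^sub>Y) - E(R\<^sub>A\<^sub>,\<^sub>0)\<close>, and both
  \<open>E(R\<^sub>A\<^sub>,\<^sub>0)\<close> and \<open>E(Q\<^sub>M\<^sub>,\<^sub>0)\<close> equal \<open>E\<^sub>Q(Q\<^sub>M\<^sub>,\<^sub>T\<^sub>+\<^sub>1)\<close>, by iterating the regressions under \<open>Q\<close>.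
\<close>

section \<open>Histories and products over time\<close>

text \<open>The obstacle is that probabilities, ratios and regressions are pinned down only along
  observed histories, while expectations under the target law combine mediators drawn under
  \<open>a\<close> with every treatment sequence \<open>b\<close>. When an equality along observed
  histories is needed at \<open>b\<close>, the integrand carries the product of the true
  probabilities of \<open>b\<close>: where this product and the target density are positive,
  mediator positivity makes the observed density positive as well, and elsewhere the integrand
  vanishes. Positivity is assumed at full length only, so a prefix is first extended to a full
  sequence of positive probability.

  Integrability is assumed under \<open>P\<close> only. Under the target law it comes from
  domination, with the constant \<open>C\<close> for the true outcome regression and 1 / \<delta>
  for the candidate one.

  When the treatment probabilities may be wrong, regressions are iterated under the target law
  against three multipliers: 1 for \<open>QM\<close>, candidate products for \<open>obsRA 0\<close>,
  and true products for the telescoping sum. One identity with a free multiplier,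
  \<open>cond_exp_on_target\<close>, covers all three.\<close>

lemma past_apply: "j < n \<Longrightarrow> past n x j = x j"
  by (simp add: past_def)

lemma past_past: "past k (past n x) = past (min k n) x"
  by (auto simp: past_def fun_eq_iff)

lemma past_past_le [simp]: "k \<le> n \<Longrightarrow> past k (past n x) = past k x"
  by (simp add: past_past min_def)

lemma past_cong: "(\<And>j. j < n \<Longrightarrow> x j = y j) \<Longrightarrow> past n x = past n y"
  by (auto simp: past_def fun_eq_iff)

lemma past_upd_other [simp]: "n \<le> k \<Longrightarrow> past n (x(k := b)) = past n x"
  by (rule past_cong) auto

lemma past_Suc_upd: "past (Suc n) (x(n := b)) = (past n x)(n := b)"
  by (auto simp: past_def fun_eq_iff)

lemma past_in_PiE: "past n x \<in> PiE {..<n} (\<lambda>_. UNIV)"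
  by (simp add: past_def)

lemma past_in_bin_seqs [simp]: "past n a \<in> bin_seqs n"
  by (simp add: bin_seqs_def past_in_PiE)

lemma past_bin_seqs: "a \<in> bin_seqs n \<Longrightarrow> past n a = a"
  unfolding bin_seqs_def past_def by (auto simp: fun_eq_iff PiE_def extensional_def)

lemma finite_bin_seqs [simp]: "finite (bin_seqs n)"
  unfolding bin_seqs_def by (intro finite_PiE) auto

text \<open>The factor with index \<open>t\<close> reads mediators only up to \<open>t - 1\<close>,
  so the last mediator never enters. For this reason a product of \<open>k\<close> treatment
  probabilities is a function of \<open>n\<close> mediators as soon as \<open>k \<le> Suc n\<close>,
  a bound that recurs throughout.\<close>

lemma prod_\<pi>_cong:
  assumes "\<And>j. j < n \<Longrightarrow> a j = a' j" "\<And>j. Suc j < n \<Longrightarrow> m j = m' j"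
  shows "prod_\<pi> q n w a m = prod_\<pi> q n w a' m'"
proof -
  have "past t a = past t a'" "past t m = past t m'" "a t = a' t" if "t < n" for t
    using that assms by (auto intro!: past_cong)
  then show ?thesis unfolding prod_\<pi>_def by (intro prod.cong) auto
qed

lemma prod_g_cong:
  assumes "\<And>j. j < n \<Longrightarrow> a j = a' j" "\<And>j. j < n \<Longrightarrow> m j = m' j"
  shows "prod_g q n w a m = prod_g q n w a' m'"
proof -
  have "past (Suc t) a = past (Suc t) a'" "past t m = past t m'" "m t = m' t" if "t < n" for t
    using that assms by (auto intro!: past_cong)
  then show ?thesis unfolding prod_g_def by (intro prod.cong) auto
qed

lemma prod_\<pi>_past_treatment [simp]: "k \<le> n \<Longrightarrow> prod_\<pi> q k w (past n a) m = prod_\<pi> q k w a m"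
  by (rule prod_\<pi>_cong) (auto simp: past_apply)

lemma prod_\<pi>_past_mediator [simp]: "k \<le> Suc n \<Longrightarrow> prod_\<pi> q k w a (past n m) = prod_\<pi> q k w a m"
  by (rule prod_\<pi>_cong) (auto simp: past_apply)

lemma prod_g_past_treatment [simp]: "k \<le> n \<Longrightarrow> prod_g q k w (past n a) m = prod_g q k w a m"
  by (rule prod_g_cong) (auto simp: past_apply)

lemma prod_g_past_mediator [simp]: "k \<le> n \<Longrightarrow> prod_g q k w a (past n m) = prod_g q k w a m"
  by (rule prod_g_cong) (auto simp: past_apply)

lemma prod_\<pi>_Suc: "prod_\<pi> q (Suc n) w a m = prod_\<pi> q n w a m * q n (w, past n a, past n m) (a n)"
  by (simp add: prod_\<pi>_def)

lemma prod_g_Suc: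
  "prod_g q (Suc n) w a m = prod_g q n w a m * q n (w, past (Suc n) a, past n m) (m n)"
  by (simp add: prod_g_def)

lemma prod_\<pi>_0 [simp]: "prod_\<pi> q 0 w a m = 1" and prod_g_0 [simp]: "prod_g r 0 w a m = 1"
  by (simp_all add: prod_\<pi>_def prod_g_def)

lemma H_true_eq: "H_true g a t (w, a', m) = prod_g g (Suc t) w a m / prod_g g (Suc t) w a' m"
  unfolding H_true_def prod_g_def split_conv by (rule prod_dividef)

text \<open>\<open>real_cond_exp\<close> is a difference of real parts of two extended nonnegative
  conditional expectations. For an indicator the negative part is zero and the positive part at most
  one, so nothing is lost in the conversion, and \<open>f\<close> can be any nonnegative function,
  integrable or not.\<close>

lemma (in prob_space) nn_integral_real_cond_exp_indicator:
  assumes sub: "subalgebra M F" and B [measurable]: "B \<in> sets M"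
    and f [measurable]: "f \<in> borel_measurable F"
  shows "(\<integral>\<^sup>+x. f x * ennreal (real_cond_exp M F (indicator B) x) \<partial>M)
         = (\<integral>\<^sup>+x. f x * indicator B x \<partial>M)"
proof -
  interpret finite_measure_subalgebra M F
    by unfold_locales (use sub in auto)
  have fM [measurable]: "f \<in> borel_measurable M"
    by (rule measurable_from_subalg[OF sub f])
  have 1: "AE x in M. nn_cond_exp M F (\<lambda>x. ennreal (indicator B x)) x \<le> nn_cond_exp M F (\<lambda>_. 1) x"
    by (rule nn_cond_exp_mono) (auto simp: indicator_def)
  have 2: "AE x in M. 1 = nn_cond_exp M F (\<lambda>_. 1::ennreal) x"
    by (rule nn_cond_exp_F_meas) auto
  have 3: "AE x in M. 0 = nn_cond_exp M F (\<lambda>x. ennreal (- indicator B x)) x"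
  proof -
    have "(\<lambda>x. ennreal (- indicator B x)) = (\<lambda>_. 0)"
      by (auto simp: indicator_def ennreal_neg fun_eq_iff)
    then show ?thesis
      using nn_cond_exp_F_meas[of "\<lambda>_. 0"] by simp
  qed
  have "AE x in M. ennreal (real_cond_exp M F (indicator B) x)
          = nn_cond_exp M F (\<lambda>x. ennreal (indicator B x)) x"
    using 1 2 3
  proof eventually_elim
    case (elim x)
    then have "nn_cond_exp M F (\<lambda>x. ennreal (indicator B x)) x < top"
      by (metis ennreal_one_less_top le_less_trans)
    with elim show ?case
      unfolding real_cond_exp_def by (simp add: ennreal_enn2real_if)
  qed
  then have "(\<integral>\<^sup>+x. f x * ennreal (real_cond_exp M F (indicator B) x) \<partial>M)
      = (\<integral>\<^sup>+x. f x * nn_cond_exp M F (\<lambda>x. ennreal (indicator B x)) x \<partial>M)"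
    by (intro nn_integral_cong_AE) auto
  also have "\<dots> = (\<integral>\<^sup>+x. f x * ennreal (indicator B x) \<partial>M)"
    by (rule nn_cond_exp_intg) auto
  finally show ?thesis by (simp add: ennreal_indicator)
qed

section \<open>Reference measures and events for observed trajectories\<close>

context longitudinal_data
begin

definition traj :: "nat \<Rightarrow> ((real^'d) \<times> (nat \<Rightarrow> real^'p)) measure" where
  "traj n = \<mu>W \<Otimes>\<^sub>M PiM {..<n} \<mu>M"

definition obs_traj :: "nat \<Rightarrow> 'o \<Rightarrow> (real^'d) \<times> (nat \<Rightarrow> real^'p)" where
  "obs_traj n \<omega> = (W \<omega>, past n (\<lambda>j. M j \<omega>))"

text \<open>The index counts treatments: \<open>agree a 0\<close> is the whole space, and fixing
  A_0, ..., A_t is \<open>agree a (Suc t)\<close>.\<close>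

definition agree :: "(nat \<Rightarrow> bool) \<Rightarrow> nat \<Rightarrow> 'o set" where
  "agree a k = {\<omega> \<in> space P. \<forall>j<k. A j \<omega> = a j}"

text \<open>
  Nothing is known about \<open>\<mu>M t\<close> for \<open>t > T\<close>, whereas \<open>product_sigma_finite\<close> wants the
  whole family to be \<open>\<sigma>\<close>-finite.
\<close>

lemma product_sigma_finite_mediators:
  "product_sigma_finite (\<lambda>t. if t \<le> T then \<mu>M t else count_space {})"
proof (rule product_sigma_finite.intro)
  fix t
  show "sigma_finite_measure (if t \<le> T then \<mu>M t else count_space {})"
    by (simp add: sigma_finite_\<mu>M sigma_finite_measure_count_space_finite)
qed

lemma PiM_mediators:
  "n \<le> Suc T \<Longrightarrow>
     PiM {..<n} \<mu>M = PiM {..<n} (\<lambda>t. if t \<le> T then \<mu>M t else count_space {})"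
  by (rule PiM_cong) auto

lemma sigma_finite_PiM_mediators: "n \<le> Suc T \<Longrightarrow> sigma_finite_measure (PiM {..<n} \<mu>M)"
  unfolding PiM_mediators
  by (rule product_sigma_finite.sigma_finite[OF product_sigma_finite_mediators]) simp

lemma space_\<mu>W [simp]: "space \<mu>W = UNIV"
  using sets_eq_imp_space_eq[OF sets_\<mu>W] by simp

lemma W_measurable' [measurable]: "W \<in> measurable P \<mu>W"
  using W_measurable measurable_cong_sets[OF refl sets_\<mu>W] by auto

lemma M_measurable' [measurable]: "t \<le> T \<Longrightarrow> M t \<in> measurable P (\<mu>M t)"
  using M_measurable measurable_cong_sets[OF refl sets_\<mu>M] by auto

declare A_measurable [measurable]

lemma space_\<mu>M: "t \<le> T \<Longrightarrow> space (\<mu>M t) = MM t"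
  using sets_eq_imp_space_eq[OF sets_\<mu>M[of t]] by (simp add: space_restrict_space)

lemma past_measurable [measurable]:
  "k \<le> n \<Longrightarrow> past k \<in> measurable (PiM {..<n} N) (PiM {..<k} N)"
  unfolding past_def by (rule measurable_restrict_subset) auto

lemma past_space_PiM_bool [simp]: "past n a \<in> space (PiM {..<n} (\<lambda>_. count_space UNIV))"
  by (simp add: space_PiM past_in_PiE)

lemma obs_hist_measurable [measurable]:
  assumes "n \<le> Suc T" "k \<le> Suc T"
  shows "obs_hist W A M n k \<in> measurable P (hist_space \<mu>W \<mu>M n k)"
proof -
  have "(\<lambda>\<omega>. past n (\<lambda>j. A j \<omega>)) \<in> measurable P (PiM {..<n} (\<lambda>_. count_space UNIV))"
    unfolding past_def using assms by (intro measurable_restrict) auto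
  moreover have "(\<lambda>\<omega>. past k (\<lambda>j. M j \<omega>)) \<in> measurable P (PiM {..<k} \<mu>M)"
    unfolding past_def using assms by (intro measurable_restrict) auto
  ultimately show ?thesis
    unfolding obs_hist_def[abs_def] hist_space_def by measurable
qed

lemma obs_traj_measurable [measurable]:
  assumes "n \<le> Suc T"
  shows "obs_traj n \<in> measurable P (traj n)"
proof -
  have "(\<lambda>\<omega>. past n (\<lambda>j. M j \<omega>)) \<in> measurable P (PiM {..<n} \<mu>M)"
    unfolding past_def using assms by (intro measurable_restrict) auto
  then show ?thesis
    unfolding obs_traj_def[abs_def] traj_def by measurable
qed

lemma agree_measurable [measurable]:
  assumes "k \<le> Suc T"
  shows "agree a k \<in> sets P"
proof -
  have [measurable]: "A j \<in> measurable P (count_space UNIV)" if "j < k" for j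
    using that assms by (intro A_measurable) auto
  have "agree a k = {\<omega> \<in> space P. \<forall>j\<in>{..<k}. A j \<omega> = a j}" by (auto simp: agree_def)
  also have "\<dots> \<in> sets P"
    by (rule sets.sets_Collect_finite_All) auto
  finally show ?thesis .
qed

lemma subalgebra_hist_sigma:
  assumes "n \<le> Suc T" "k \<le> Suc T"
  shows "subalgebra P (hist_sigma P W A M \<mu>W \<mu>M n k)"
  using assms obs_hist_measurable[OF assms]
  unfolding subalgebra_def hist_sigma_def
  by (auto simp: sets_vimage_algebra2 measurable_space[OF obs_hist_measurable[OF assms]])

lemma hist_sigma_measurable:
  assumes "n \<le> Suc T" "k \<le> Suc T" "f \<in> measurable (hist_space \<mu>W \<mu>M n k) N"
  shows "(\<lambda>\<omega>. f (obs_hist W A M n k \<omega>)) \<in> measurable (hist_sigma P W A M \<mu>W \<mu>M n k) N"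
proof -
  have "obs_hist W A M n k \<in> measurable (hist_sigma P W A M \<mu>W \<mu>M n k) (hist_space \<mu>W \<mu>M n k)"
    unfolding hist_sigma_def
    by (rule measurable_vimage_algebra1) (use obs_hist_measurable[OF assms(1,2)] in \<open>auto dest: measurable_space\<close>)
  from measurable_compose[OF this assms(3)] show ?thesis .
qed

text \<open>Tonelli with the last mediator innermost, the form in which a conditional density of
  that mediator can be integrated out or inserted.\<close>

lemma nn_integral_traj_Suc:
  assumes n: "n \<le> T" and f: "f \<in> borel_measurable (traj (Suc n))"
  shows "(\<integral>\<^sup>+z. f z \<partial>traj (Suc n)) = (\<integral>\<^sup>+z. \<integral>\<^sup>+x. f (fst z, (snd z)(n := x)) \<partial>\<mu>M n \<partial>traj n)"
proof -
  let ?N = "\<lambda>t. if t \<le> T then \<mu>M t else count_space {}"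
  interpret product_sigma_finite ?N by (rule product_sigma_finite_mediators)
  interpret S: sigma_finite_measure "PiM {..<Suc n} \<mu>M"
    by (rule sigma_finite_PiM_mediators) (use n in auto)
  interpret S': sigma_finite_measure "PiM {..<n} \<mu>M"
    by (rule sigma_finite_PiM_mediators) (use n in auto)
  interpret Sn: sigma_finite_measure "\<mu>M n" using n by (rule sigma_finite_\<mu>M)
  have f' [measurable]: "f \<in> borel_measurable (\<mu>W \<Otimes>\<^sub>M PiM {..<Suc n} \<mu>M)"
    using f by (simp add: traj_def)
  have [measurable]: "(\<lambda>z. (snd (fst z))(n := snd z)) \<in>
      measurable ((\<mu>W \<Otimes>\<^sub>M PiM {..<n} \<mu>M) \<Otimes>\<^sub>M \<mu>M n) (PiM {..<Suc n} \<mu>M)"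
    by (rule measurable_fun_upd[where J="{..<n}"]) auto
  have m2 [measurable]: "(\<lambda>(z, x). f (fst z, (snd z)(n := x))) \<in>
      borel_measurable ((\<mu>W \<Otimes>\<^sub>M PiM {..<n} \<mu>M) \<Otimes>\<^sub>M \<mu>M n)"
    by (simp add: split_beta')
  have "(\<integral>\<^sup>+z. f z \<partial>traj (Suc n)) = (\<integral>\<^sup>+w. \<integral>\<^sup>+m. f (w, m) \<partial>PiM {..<Suc n} \<mu>M \<partial>\<mu>W)"
    unfolding traj_def by (rule S.nn_integral_fst[symmetric]) simp
  also have "\<dots> = (\<integral>\<^sup>+w. \<integral>\<^sup>+m. \<integral>\<^sup>+x. f (w, m(n := x)) \<partial>\<mu>M n \<partial>PiM {..<n} \<mu>M \<partial>\<mu>W)"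
  proof (rule nn_integral_cong)
    fix w
    have mw: "(\<lambda>m. f (w, m)) \<in> borel_measurable (PiM {..<Suc n} ?N)"
      using n by (subst PiM_mediators[symmetric]) auto
    have "(\<integral>\<^sup>+m. f (w, m) \<partial>PiM (insert n {..<n}) ?N)
        = (\<integral>\<^sup>+m. \<integral>\<^sup>+x. f (w, m(n := x)) \<partial>?N n \<partial>PiM {..<n} ?N)"
      by (rule product_nn_integral_insert) (use mw in \<open>auto simp: lessThan_Suc\<close>)
    then show "(\<integral>\<^sup>+m. f (w, m) \<partial>PiM {..<Suc n} \<mu>M)
        = (\<integral>\<^sup>+m. \<integral>\<^sup>+x. f (w, m(n := x)) \<partial>\<mu>M n \<partial>PiM {..<n} \<mu>M)"
      using n PiM_mediators[of n] PiM_mediators[of "Suc n"] by (simp add: lessThan_Suc)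
  qed
  also have "\<dots> = (\<integral>\<^sup>+z. \<integral>\<^sup>+x. f (fst z, (snd z)(n := x)) \<partial>\<mu>M n \<partial>traj n)"
    unfolding traj_def
    by (subst S'.nn_integral_fst[symmetric]) auto
  finally show ?thesis .
qed

end

section \<open>Conditional kernels\<close>

context true_nuisance
begin

lemma traj_hist_measurable [measurable]:
  assumes "l \<le> n"
  shows "(\<lambda>z. (fst z, past k a, past l (snd z))) \<in> measurable (traj n) (hist_space \<mu>W \<mu>M k l)"
  using assms unfolding traj_def hist_space_def by measurable

text \<open>Stated for a general \<open>q\<close> so that it serves both the true and the candidate
  treatment probabilities.\<close>

lemma prod_\<pi>_measurable:
  assumes q: "\<And>t b. t \<le> T \<Longrightarrow> (\<lambda>h. q t h b) \<in> borel_measurable (hist_space \<mu>W \<mu>M t t)"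
    and "k \<le> Suc n" "k \<le> Suc T"
  shows "(\<lambda>z. prod_\<pi> q k (fst z) a (snd z)) \<in> borel_measurable (traj n)"
  unfolding prod_\<pi>_def
proof (rule borel_measurable_prod)
  fix t assume "t \<in> {..<k}"
  then have t: "t \<le> T" "t \<le> n" using assms by auto
  show "(\<lambda>z. q t (fst z, past t a, past t (snd z)) (a t)) \<in> borel_measurable (traj n)"
    by (rule measurable_compose[OF traj_hist_measurable[OF t(2)] q[OF t(1)]])
qed

lemma component_traj_measurable [measurable]:
  "t < n \<Longrightarrow> (\<lambda>z. snd z t) \<in> measurable (traj n) (\<mu>M t)"
  unfolding traj_def by measurable

lemma prod_g_measurable [measurable]:
  assumes "n \<le> l" "n \<le> Suc T"
  shows "(\<lambda>z. prod_g g n (fst z) a (snd z)) \<in> borel_measurable (traj l)"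
  unfolding prod_g_def
proof (rule borel_measurable_prod)
  fix t assume "t \<in> {..<n}"
  then have t: "t \<le> T" "t \<le> l" "t < l" using assms by auto
  have "(\<lambda>z. ((fst z, past (Suc t) a, past t (snd z)), snd z t))
      \<in> measurable (traj l) (hist_space \<mu>W \<mu>M (Suc t) t \<Otimes>\<^sub>M \<mu>M t)"
    using t by measurable
  from measurable_compose[OF this g_measurable[OF t(1)]]
  show "(\<lambda>z. g t (fst z, past (Suc t) a, past t (snd z)) (snd z t)) \<in> borel_measurable (traj l)"
    by simp
qed

lemma prod_\<pi>_nonneg:
  assumes q: "\<And>t h b. t \<le> T \<Longrightarrow> h \<in> space (hist_space \<mu>W \<mu>M t t) \<Longrightarrow> 0 \<le> q t h b"
    and "k \<le> Suc n" "k \<le> Suc T" "z \<in> space (traj n)"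
  shows "0 \<le> prod_\<pi> q k (fst z) a (snd z)"
  unfolding prod_\<pi>_def
proof (rule prod_nonneg, safe)
  fix t assume "t < k"
  then have t: "t \<le> T" "t \<le> n" using assms by auto
  then show "0 \<le> q t (fst z, past t a, past t (snd z)) (a t)"
    by (intro q measurable_space[OF traj_hist_measurable[OF t(2)] assms(4)])
qed

lemma prod_g_nonneg:
  assumes "n \<le> l" "n \<le> Suc T" "z \<in> space (traj l)"
  shows "0 \<le> prod_g g n (fst z) a (snd z)"
  unfolding prod_g_def
proof (rule prod_nonneg, safe)
  fix t assume "t < n"
  then have t: "t \<le> T" "t \<le> l" "t < l" using assms by auto
  then show "0 \<le> g t (fst z, past (Suc t) a, past t (snd z)) (snd z t)"
    using measurable_space[OF component_traj_measurable[OF t(3)] assms(3)]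
    by (intro g_nonneg measurable_space[OF traj_hist_measurable[OF t(2)] assms(3)])
       (auto simp: space_\<mu>M)
qed

lemma nn_integral_treatment_step:
  assumes t: "t \<le> T" and f: "f \<in> borel_measurable (hist_space \<mu>W \<mu>M t t)"
  shows "(\<integral>\<^sup>+\<omega>. f (obs_hist W A M t t \<omega>) * indicator {\<omega> \<in> space P. A t \<omega> = b} \<omega> \<partial>P)
       = (\<integral>\<^sup>+\<omega>. f (obs_hist W A M t t \<omega>) * ennreal (\<pi> t (obs_hist W A M t t \<omega>) b) \<partial>P)"
proof -
  let ?F = "hist_sigma P W A M \<mu>W \<mu>M t t"
  have sub: "subalgebra P ?F" by (rule subalgebra_hist_sigma) (use t in auto)
  have [measurable]: "A t \<in> measurable P (count_space UNIV)" using t by (rule A_measurable)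
  have B: "{\<omega> \<in> space P. A t \<omega> = b} \<in> sets P" by measurable
  \<comment> \<open>The event in the assumption on \<pi> is not intersected with
    \<open>space P\<close>. Both indicators agree on \<open>space P\<close>, so their conditional
    expectations agree almost everywhere.\<close>
  have eq: "AE \<omega> in P. real_cond_exp P ?F (indicator {\<omega> \<in> space P. A t \<omega> = b}) \<omega>
      = real_cond_exp P ?F (indicator {\<omega>. A t \<omega> = b}) \<omega>"
  proof -
    interpret finite_measure_subalgebra P ?F by unfold_locales (use sub in auto)
    have "(indicator {\<omega>. A t \<omega> = b} :: _ \<Rightarrow> real) \<in> borel_measurable P"
      by (simp add: indicator_def[abs_def])
    then show ?thesis
      using B by (intro real_cond_exp_cong) (auto simp: indicator_def)
  qed
  have "(\<integral>\<^sup>+\<omega>. f (obs_hist W A M t t \<omega>) * indicator {\<omega> \<in> space P. A t \<omega> = b} \<omega> \<partial>P)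
      = (\<integral>\<^sup>+\<omega>. f (obs_hist W A M t t \<omega>) *
           ennreal (real_cond_exp P ?F (indicator {\<omega> \<in> space P. A t \<omega> = b}) \<omega>) \<partial>P)"
    by (rule nn_integral_real_cond_exp_indicator[symmetric, OF sub B])
       (rule hist_sigma_measurable, use t f in auto)
  also have "\<dots> = (\<integral>\<^sup>+\<omega>. f (obs_hist W A M t t \<omega>) * ennreal (\<pi> t (obs_hist W A M t t \<omega>) b) \<partial>P)"
    by (rule nn_integral_cong_AE) (use \<pi>_cond_prob[OF t, of b] eq in eventually_elim, simp)
  finally show ?thesis .
qed

text \<open>
  Both sides define finite measures on the product of the history space and the mediator space;
  by assumption they agree on rectangles.
\<close>

lemma nn_integral_mediator_step:
  assumes t: "t \<le> T"
    and f: "f \<in> borel_measurable (hist_space \<mu>W \<mu>M (Suc t) t \<Otimes>\<^sub>M \<mu>M t)"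
  shows "(\<integral>\<^sup>+\<omega>. f (obs_hist W A M (Suc t) t \<omega>, M t \<omega>) \<partial>P)
       = (\<integral>\<^sup>+\<omega>. \<integral>\<^sup>+x. ennreal (g t (obs_hist W A M (Suc t) t \<omega>) x) *
             f (obs_hist W A M (Suc t) t \<omega>, x) \<partial>\<mu>M t \<partial>P)"
proof -
  let ?F = "hist_sigma P W A M \<mu>W \<mu>M (Suc t) t"
  let ?H = "hist_space \<mu>W \<mu>M (Suc t) t"
  let ?o = "obs_hist W A M (Suc t) t"
  have sub: "subalgebra P ?F" by (rule subalgebra_hist_sigma) (use t in auto)
  have o [measurable]: "?o \<in> measurable P ?H" using t by (intro obs_hist_measurable) auto
  have Mt [measurable]: "M t \<in> measurable P (\<mu>M t)" using t by measurable
  interpret S: sigma_finite_measure "\<mu>M t" using t by (rule sigma_finite_\<mu>M)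
  define D where "D = distr P ?H ?o"
  have sD [measurable_cong]: "sets D = sets ?H" by (simp add: D_def)
  have spD: "space D = space ?H" by (simp add: D_def)
  interpret D: prob_space D unfolding D_def by (rule prob_space_distr) measurable
  define \<nu> where "\<nu> = distr P (D \<Otimes>\<^sub>M \<mu>M t) (\<lambda>\<omega>. (?o \<omega>, M t \<omega>))"
  define \<kappa> where "\<kappa> = density (D \<Otimes>\<^sub>M \<mu>M t) (\<lambda>(h, x). ennreal (g t h x))"
  have gm0: "(\<lambda>(h, x). g t h x) \<in> borel_measurable (?H \<Otimes>\<^sub>M \<mu>M t)"
    by (rule g_measurable[OF t])
  have gm [measurable]: "(\<lambda>(h, x). g t h x) \<in> borel_measurable (D \<Otimes>\<^sub>M \<mu>M t)"
    using gm0 by measurable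
  have gm' [measurable]: "g t h \<in> borel_measurable (\<mu>M t)" if "h \<in> space ?H" for h
    using measurable_compose[OF measurable_Pair1'[OF that] gm0] by simp
  have om [measurable]: "(\<lambda>\<omega>. (?o \<omega>, M t \<omega>)) \<in> measurable P (D \<Otimes>\<^sub>M \<mu>M t)"
    by measurable
  have gx [measurable]: "(\<lambda>h. \<integral>\<^sup>+x. ennreal (g t h x) * indicator B x \<partial>\<mu>M t) \<in> borel_measurable D"
    if [measurable]: "B \<in> sets (\<mu>M t)" for B
  proof -
    have "(\<lambda>(h, x). ennreal (g t h x) * indicator B x) \<in> borel_measurable (D \<Otimes>\<^sub>M \<mu>M t)"
      by measurable
    then show ?thesis using S.borel_measurable_nn_integral by simp
  qed
  have eq: "emeasure \<nu> (C \<times> B) = emeasure \<kappa> (C \<times> B)" if C: "C \<in> sets D" and B: "B \<in> sets (\<mu>M t)" for C B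
  proof -
    note [measurable] = C B
    have B': "{\<omega> \<in> space P. M t \<omega> \<in> B} \<in> sets P" by measurable
    have oF: "?o \<in> measurable ?F ?H"
      using hist_sigma_measurable[of "Suc t" t "\<lambda>x. x" ?H] t by simp
    have congB: "AE \<omega> in P. real_cond_exp P ?F (indicator {\<omega> \<in> space P. M t \<omega> \<in> B}) \<omega>
        = real_cond_exp P ?F (indicator {\<omega>. M t \<omega> \<in> B}) \<omega>"
    proof -
      interpret finite_measure_subalgebra P ?F by unfold_locales (use sub in auto)
      have "(\<lambda>\<omega>. indicator B (M t \<omega>) :: real) \<in> borel_measurable P" by measurable
      moreover have "(\<lambda>\<omega>. indicator B (M t \<omega>) :: real) = indicator {\<omega>. M t \<omega> \<in> B}"
        by (auto simp: indicator_def)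
      ultimately show ?thesis
        using B' by (intro real_cond_exp_cong) (auto simp: indicator_def)
    qed
    \<comment> \<open>The assumption on \<open>g\<close> is phrased with a Bochner integral, which
      is zero by default for a non-integrable function. Nonnegativity and normalisation of
      \<open>g\<close> give integrability, so that the nonnegative integral may replace it.\<close>
    have lint: "ennreal (\<integral>x\<in>B. g t h x \<partial>\<mu>M t) = (\<integral>\<^sup>+x. ennreal (g t h x) * indicator B x \<partial>\<mu>M t)"
      if h: "h \<in> space ?H" for h
    proof -
      have "(\<integral>\<^sup>+x. ennreal (norm (indicator B x *\<^sub>R g t h x)) \<partial>\<mu>M t) \<le> (\<integral>\<^sup>+x. ennreal (g t h x) \<partial>\<mu>M t)"
        by (rule nn_integral_mono) (use t h in \<open>auto simp: space_\<mu>M g_nonneg indicator_def\<close>)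
      also have "\<dots> < \<infinity>" using g_normalised[OF t h] by simp
      finally have int: "integrable (\<mu>M t) (\<lambda>x. indicator B x *\<^sub>R g t h x)"
        using gm'[OF h] by (intro integrableI_bounded) auto
      have "ennreal (\<integral>x\<in>B. g t h x \<partial>\<mu>M t) = (\<integral>\<^sup>+x. ennreal (indicator B x *\<^sub>R g t h x) \<partial>\<mu>M t)"
        unfolding set_lebesgue_integral_def
        by (rule nn_integral_eq_integral[symmetric, OF int])
           (use t h in \<open>auto simp: space_\<mu>M g_nonneg indicator_def\<close>)
      also have "\<dots> = (\<integral>\<^sup>+x. ennreal (g t h x) * indicator B x \<partial>\<mu>M t)"
        by (rule nn_integral_cong) (auto simp: indicator_def)
      finally show ?thesis .
    qed
    have "emeasure \<nu> (C \<times> B) = (\<integral>\<^sup>+\<omega>. indicator (C \<times> B) (?o \<omega>, M t \<omega>) \<partial>P)"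
      unfolding \<nu>_def
      by (subst nn_integral_indicator[symmetric], simp, subst nn_integral_distr) auto
    also have "\<dots> = (\<integral>\<^sup>+\<omega>. indicator C (?o \<omega>) * indicator {\<omega> \<in> space P. M t \<omega> \<in> B} \<omega> \<partial>P)"
      by (rule nn_integral_cong) (auto simp: indicator_def)
    also have "\<dots> = (\<integral>\<^sup>+\<omega>. indicator C (?o \<omega>) *
        ennreal (real_cond_exp P ?F (indicator {\<omega> \<in> space P. M t \<omega> \<in> B}) \<omega>) \<partial>P)"
      by (rule nn_integral_real_cond_exp_indicator[symmetric, OF sub B'])
         (use C oF in \<open>auto simp: sD\<close>)
    also have "\<dots> = (\<integral>\<^sup>+\<omega>. indicator C (?o \<omega>) * ennreal (\<integral>x\<in>B. g t (?o \<omega>) x \<partial>\<mu>M t) \<partial>P)"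
      by (rule nn_integral_cong_AE) (use g_cond_density[OF t B] congB in eventually_elim, simp)
    also have "\<dots> = (\<integral>\<^sup>+\<omega>. indicator C (?o \<omega>) *
        (\<integral>\<^sup>+x. ennreal (g t (?o \<omega>) x) * indicator B x \<partial>\<mu>M t) \<partial>P)"
      by (rule nn_integral_cong) (simp add: lint measurable_space[OF o])
    also have "\<dots> = (\<integral>\<^sup>+h. indicator C h * (\<integral>\<^sup>+x. ennreal (g t h x) * indicator B x \<partial>\<mu>M t) \<partial>D)"
      using gx[OF B] by (subst D_def, subst nn_integral_distr) (auto simp: sD)
    also have "\<dots> = (\<integral>\<^sup>+h. \<integral>\<^sup>+x. ennreal (g t h x) * indicator (C \<times> B) (h, x) \<partial>\<mu>M t \<partial>D)"
      by (rule nn_integral_cong) (auto simp: indicator_def)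
    also have "\<dots> = (\<integral>\<^sup>+z. (case z of (h, x) \<Rightarrow> ennreal (g t h x)) * indicator (C \<times> B) z \<partial>(D \<Otimes>\<^sub>M \<mu>M t))"
      by (subst S.nn_integral_fst[symmetric]) auto
    also have "\<dots> = emeasure \<kappa> (C \<times> B)"
      unfolding \<kappa>_def by (subst emeasure_density) auto
    finally show ?thesis .
  qed
  have "\<nu> = \<kappa>"
  proof (rule measure_eqI_generator_eq[OF Int_stable_pair_measure_generator[of D "\<mu>M t"],
        where \<Omega> = "space D \<times> space (\<mu>M t)" and A = "\<lambda>_. space D \<times> space (\<mu>M t)"])
    show "{a \<times> b |a b. a \<in> sets D \<and> b \<in> sets (\<mu>M t)} \<subseteq> Pow (space D \<times> space (\<mu>M t))"
      by (auto dest: sets.sets_into_space)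
    show "emeasure \<nu> X = emeasure \<kappa> X" if "X \<in> {a \<times> b |a b. a \<in> sets D \<and> b \<in> sets (\<mu>M t)}" for X
      using that eq by auto
    show "sets \<nu> = sigma_sets (space D \<times> space (\<mu>M t)) {a \<times> b |a b. a \<in> sets D \<and> b \<in> sets (\<mu>M t)}"
      by (simp add: \<nu>_def sets_pair_measure)
    show "sets \<kappa> = sigma_sets (space D \<times> space (\<mu>M t)) {a \<times> b |a b. a \<in> sets D \<and> b \<in> sets (\<mu>M t)}"
      by (simp add: \<kappa>_def sets_pair_measure)
    have "prob_space \<nu>" unfolding \<nu>_def by (rule prob_space_distr) (rule om)
    then show "emeasure \<nu> (space D \<times> space (\<mu>M t)) \<noteq> \<infinity>" for i :: nat
      by (simp add: finite_measure.emeasure_finite prob_space.finite_measure)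
  qed auto
  have fD [measurable]: "f \<in> borel_measurable (D \<Otimes>\<^sub>M \<mu>M t)" using f by measurable
  have fx: "(\<lambda>h. \<integral>\<^sup>+x. ennreal (g t h x) * f (h, x) \<partial>\<mu>M t) \<in> borel_measurable ?H"
  proof -
    have "(\<lambda>(h, x). ennreal (g t h x) * f (h, x)) \<in> borel_measurable (D \<Otimes>\<^sub>M \<mu>M t)"
      by measurable
    then have "(\<lambda>h. \<integral>\<^sup>+x. ennreal (g t h x) * f (h, x) \<partial>\<mu>M t) \<in> borel_measurable D"
      using S.borel_measurable_nn_integral by simp
    then show ?thesis using measurable_cong_sets[OF sD refl] by blast
  qed
  have "(\<integral>\<^sup>+\<omega>. f (?o \<omega>, M t \<omega>) \<partial>P) = integral\<^sup>N \<nu> f"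
    unfolding \<nu>_def by (rule nn_integral_distr[symmetric]) auto
  also have "\<dots> = integral\<^sup>N \<kappa> f" by (simp only: \<open>\<nu> = \<kappa>\<close>)
  also have "\<dots> = (\<integral>\<^sup>+z. (case z of (h, x) \<Rightarrow> ennreal (g t h x)) * f z \<partial>(D \<Otimes>\<^sub>M \<mu>M t))"
    unfolding \<kappa>_def by (rule nn_integral_density) auto
  also have "\<dots> = (\<integral>\<^sup>+h. \<integral>\<^sup>+x. ennreal (g t h x) * f (h, x) \<partial>\<mu>M t \<partial>D)"
    by (subst S.nn_integral_fst[symmetric]) auto
  also have "\<dots> = (\<integral>\<^sup>+\<omega>. \<integral>\<^sup>+x. ennreal (g t (?o \<omega>) x) * f (?o \<omega>, x) \<partial>\<mu>M t \<partial>P)"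
    unfolding D_def by (rule nn_integral_distr) (use fx in auto)
  finally show ?thesis .
qed

end

section \<open>The law of the observed trajectory\<close>

context true_nuisance
begin

declare p_measurable [measurable]

lemma prod_\<pi>_true_measurable [measurable]:
  "k \<le> Suc n \<Longrightarrow> k \<le> Suc T \<Longrightarrow>
     (\<lambda>z. prod_\<pi> \<pi> k (fst z) a (snd z)) \<in> borel_measurable (traj n)"
  by (rule prod_\<pi>_measurable) (rule \<pi>_measurable)

lemma prod_\<pi>_true_nonneg:
  "k \<le> Suc n \<Longrightarrow> k \<le> Suc T \<Longrightarrow> z \<in> space (traj n) \<Longrightarrow> 0 \<le> prod_\<pi> \<pi> k (fst z) a (snd z)"
  by (rule prod_\<pi>_nonneg) (rule \<pi>_nonneg)

lemma past_snd_traj: "z \<in> space (traj n) \<Longrightarrow> past n (snd z) = snd z"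
  by (cases z) (auto simp: traj_def space_pair_measure space_PiM past_def fun_eq_iff PiE_def
      extensional_def)

lemma p_traj_measurable [measurable]: "(\<lambda>z. p (fst z)) \<in> borel_measurable (traj n)"
  unfolding traj_def by measurable

lemma past_traj_measurable [measurable]:
  "n \<le> l \<Longrightarrow> (\<lambda>z. (fst z, past n (snd z))) \<in> measurable (traj l) (traj n)"
  unfolding traj_def by measurable

text \<open>Density with respect to \<open>traj n\<close> of the law of the trajectory restricted to
  \<open>agree a k\<close>. Treatments and mediators alternate in time, so the two counts are kept
  apart: \<open>k = n\<close> is the stage just before treatment \<open>n\<close>, and
  \<open>k = Suc n\<close> the stage just after it.\<close>

definition joint :: "(nat \<Rightarrow> bool) \<Rightarrow> nat \<Rightarrow> nat \<Rightarrow> (real^'d) \<times> (nat \<Rightarrow> real^'p) \<Rightarrow> real" where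
  "joint a k n z = p (fst z) * prod_\<pi> \<pi> k (fst z) a (snd z) * prod_g g n (fst z) a (snd z)"

lemma joint_measurable [measurable]:
  "k \<le> Suc n \<Longrightarrow> k \<le> Suc T \<Longrightarrow> n \<le> Suc T \<Longrightarrow> joint a k n \<in> borel_measurable (traj n)"
  unfolding joint_def[abs_def] by measurable

lemma joint_nonneg:
  "k \<le> Suc n \<Longrightarrow> k \<le> Suc T \<Longrightarrow> n \<le> Suc T \<Longrightarrow> z \<in> space (traj n) \<Longrightarrow> 0 \<le> joint a k n z"
  unfolding joint_def by (intro mult_nonneg_nonneg p_nonneg prod_\<pi>_true_nonneg prod_g_nonneg) auto

lemma obs_hist_agree:
  "\<omega> \<in> agree a n \<Longrightarrow> obs_hist W A M n k \<omega> = (fst (obs_traj k \<omega>), past n a, snd (obs_traj k \<omega>))"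
  by (auto simp: agree_def obs_hist_def obs_traj_def intro!: past_cong)

lemma treatment_pred_measurable:
  "{h \<in> space (hist_space \<mu>W \<mu>M n k). \<forall>j\<in>{..<n}. fst (snd h) j = a j} \<in> sets (hist_space \<mu>W \<mu>M n k)"
proof (rule sets.sets_Collect_finite_All)
  fix j assume j: "j \<in> {..<n}"
  have "(\<lambda>h. fst (snd h) j) \<in> measurable (hist_space \<mu>W \<mu>M n k) (count_space UNIV)"
    unfolding hist_space_def
    by (rule measurable_compose[OF measurable_compose[OF measurable_snd measurable_fst]
          measurable_component_singleton[OF j]])
  then show "{h \<in> space (hist_space \<mu>W \<mu>M n k). fst (snd h) j = a j} \<in> sets (hist_space \<mu>W \<mu>M n k)"
    by measurable
qed auto

lemma hist_traj_measurable [measurable]: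
  "(\<lambda>h. (fst h, snd (snd h))) \<in> measurable (hist_space \<mu>W \<mu>M n k) (traj k)"
  unfolding hist_space_def traj_def by measurable

text \<open>On \<open>agree a t\<close> the history before treatment \<open>t\<close> is determined
  by the trajectory. Conditioning on that history turns the indicator of the event that treatment
  \<open>t\<close> follows \<open>a\<close> into a factor \<pi>.\<close>

lemma treatment_extend:
  assumes t: "t \<le> T" and phi: "\<phi> \<in> borel_measurable (traj t)"
  shows "(\<integral>\<^sup>+\<omega>. indicator (agree a (Suc t)) \<omega> * \<phi> (obs_traj t \<omega>) \<partial>P)
       = (\<integral>\<^sup>+\<omega>. indicator (agree a t) \<omega> *
            (ennreal (\<pi> t (fst (obs_traj t \<omega>), past t a, snd (obs_traj t \<omega>)) (a t)) * \<phi> (obs_traj t \<omega>)) \<partial>P)"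
proof -
  let ?H = "hist_space \<mu>W \<mu>M t t"
  let ?C = "{h \<in> space ?H. \<forall>j\<in>{..<t}. fst (snd h) j = a j}"
  define f where "f = (\<lambda>h. indicator ?C h * \<phi> (fst h, snd (snd h)))"
  have f: "f \<in> borel_measurable ?H"
    unfolding f_def using treatment_pred_measurable measurable_compose[OF hist_traj_measurable phi]
    by (intro borel_measurable_times_ennreal borel_measurable_indicator) auto
  have fo: "f (obs_hist W A M t t \<omega>) = indicator (agree a t) \<omega> * \<phi> (obs_traj t \<omega>)" if "\<omega> \<in> space P" for \<omega>
    using measurable_space[OF obs_hist_measurable that, of t t] t that
    by (auto simp: f_def indicator_def agree_def obs_hist_def obs_traj_def past_apply)
  have "(\<integral>\<^sup>+\<omega>. indicator (agree a (Suc t)) \<omega> * \<phi> (obs_traj t \<omega>) \<partial>P)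
      = (\<integral>\<^sup>+\<omega>. f (obs_hist W A M t t \<omega>) * indicator {\<omega> \<in> space P. A t \<omega> = a t} \<omega> \<partial>P)"
    by (rule nn_integral_cong) (auto simp: fo agree_def indicator_def less_Suc_eq)
  also have "\<dots> = (\<integral>\<^sup>+\<omega>. f (obs_hist W A M t t \<omega>) * ennreal (\<pi> t (obs_hist W A M t t \<omega>) (a t)) \<partial>P)"
    by (rule nn_integral_treatment_step[OF t f])
  also have "\<dots> = (\<integral>\<^sup>+\<omega>. indicator (agree a t) \<omega> *
            (ennreal (\<pi> t (fst (obs_traj t \<omega>), past t a, snd (obs_traj t \<omega>)) (a t)) * \<phi> (obs_traj t \<omega>)) \<partial>P)"
  proof (rule nn_integral_cong)
    fix \<omega> assume w: "\<omega> \<in> space P"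
    show "f (obs_hist W A M t t \<omega>) * ennreal (\<pi> t (obs_hist W A M t t \<omega>) (a t)) =
      indicator (agree a t) \<omega> *
        (ennreal (\<pi> t (fst (obs_traj t \<omega>), past t a, snd (obs_traj t \<omega>)) (a t)) * \<phi> (obs_traj t \<omega>))"
      unfolding fo[OF w]
      by (cases "\<omega> \<in> agree a t") (auto simp: obs_hist_agree mult_ac)
  qed
  finally show ?thesis .
qed

text \<open>The counterpart for mediators: the conditional density at the treatments
  \<open>a\<close> integrates out the newest mediator, and the event stays the same because it only
  involves treatments that precede this mediator.\<close>

lemma mediator_extend:
  assumes t: "t \<le> T" and phi: "\<phi> \<in> borel_measurable (traj (Suc t))"
  shows "(\<integral>\<^sup>+\<omega>. indicator (agree a (Suc t)) \<omega> * \<phi> (obs_traj (Suc t) \<omega>) \<partial>P)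
       = (\<integral>\<^sup>+\<omega>. indicator (agree a (Suc t)) \<omega> *
            (\<integral>\<^sup>+x. ennreal (g t (fst (obs_traj t \<omega>), past (Suc t) a, snd (obs_traj t \<omega>)) x) *
                 \<phi> (fst (obs_traj t \<omega>), (snd (obs_traj t \<omega>))(t := x)) \<partial>\<mu>M t) \<partial>P)"
proof -
  let ?H = "hist_space \<mu>W \<mu>M (Suc t) t"
  let ?C = "{h \<in> space ?H. \<forall>j\<in>{..<Suc t}. fst (snd h) j = a j}"
  define f where "f = (\<lambda>z. indicator ?C (fst z) * \<phi> (fst (fst z), (snd (snd (fst z)))(t := snd z)))"
  have "(\<lambda>z. (snd (snd (fst z)))(t := snd z)) \<in> measurable (?H \<Otimes>\<^sub>M \<mu>M t) (PiM {..<Suc t} \<mu>M)"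
    unfolding hist_space_def by (rule measurable_fun_upd[where J="{..<t}"]) auto
  then have "(\<lambda>z. (fst (fst z), (snd (snd (fst z)))(t := snd z))) \<in> measurable (?H \<Otimes>\<^sub>M \<mu>M t) (traj (Suc t))"
    unfolding traj_def hist_space_def by measurable
  then have "(\<lambda>z. \<phi> (fst (fst z), (snd (snd (fst z)))(t := snd z))) \<in> borel_measurable (?H \<Otimes>\<^sub>M \<mu>M t)"
    by (rule measurable_compose[OF _ phi])
  moreover have "(\<lambda>z. indicator ?C (fst z) :: ennreal) \<in> borel_measurable (?H \<Otimes>\<^sub>M \<mu>M t)"
    by (rule measurable_compose[OF measurable_fst borel_measurable_indicator])
       (rule treatment_pred_measurable)
  ultimately have f: "f \<in> borel_measurable (?H \<Otimes>\<^sub>M \<mu>M t)"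
    unfolding f_def by simp
  have o: "obs_hist W A M (Suc t) t \<omega> \<in> ?C \<longleftrightarrow> \<omega> \<in> agree a (Suc t)" if "\<omega> \<in> space P" for \<omega>
  proof -
    have "obs_hist W A M (Suc t) t \<omega> \<in> space ?H"
      by (rule measurable_space[OF obs_hist_measurable that]) (use t in auto)
    then show ?thesis using that by (auto simp: agree_def obs_hist_def past_apply)
  qed
  have upd: "past (Suc t) m = (past t m)(t := m t)" for m :: "nat \<Rightarrow> real^'p"
    by (auto simp: past_def fun_eq_iff)
  have "(\<integral>\<^sup>+\<omega>. indicator (agree a (Suc t)) \<omega> * \<phi> (obs_traj (Suc t) \<omega>) \<partial>P)
      = (\<integral>\<^sup>+\<omega>. f (obs_hist W A M (Suc t) t \<omega>, M t \<omega>) \<partial>P)"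
    by (rule nn_integral_cong) (use o in \<open>auto simp: f_def indicator_def obs_hist_def obs_traj_def upd\<close>)
  also have "\<dots> = (\<integral>\<^sup>+\<omega>. \<integral>\<^sup>+x. ennreal (g t (obs_hist W A M (Suc t) t \<omega>) x) *
             f (obs_hist W A M (Suc t) t \<omega>, x) \<partial>\<mu>M t \<partial>P)"
    by (rule nn_integral_mediator_step[OF t f])
  also have "\<dots> = (\<integral>\<^sup>+\<omega>. indicator (agree a (Suc t)) \<omega> *
            (\<integral>\<^sup>+x. ennreal (g t (fst (obs_traj t \<omega>), past (Suc t) a, snd (obs_traj t \<omega>)) x) *
                 \<phi> (fst (obs_traj t \<omega>), (snd (obs_traj t \<omega>))(t := x)) \<partial>\<mu>M t) \<partial>P)"
  proof (rule nn_integral_cong)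
    fix \<omega> assume w: "\<omega> \<in> space P"
    show "(\<integral>\<^sup>+x. ennreal (g t (obs_hist W A M (Suc t) t \<omega>) x) *
             f (obs_hist W A M (Suc t) t \<omega>, x) \<partial>\<mu>M t) =
      indicator (agree a (Suc t)) \<omega> *
            (\<integral>\<^sup>+x. ennreal (g t (fst (obs_traj t \<omega>), past (Suc t) a, snd (obs_traj t \<omega>)) x) *
                 \<phi> (fst (obs_traj t \<omega>), (snd (obs_traj t \<omega>))(t := x)) \<partial>\<mu>M t)"
      using o[OF w]
      by (cases "\<omega> \<in> agree a (Suc t)") (auto simp: f_def obs_hist_agree)
  qed
  finally show ?thesis .
qed

text \<open>Induction along the time order. The local fact \<open>step\<close> appends a treatment
  and leads from \<open>k = n\<close> to \<open>k = Suc n\<close>; the induction step then appends a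
  mediator and leads back to the diagonal at the next time.\<close>

lemma nn_integral_law:
  assumes "n \<le> Suc T" "k = n \<or> k = Suc n" "k \<le> Suc T" "\<phi> \<in> borel_measurable (traj n)"
  shows "(\<integral>\<^sup>+\<omega>. indicator (agree a k) \<omega> * \<phi> (obs_traj n \<omega>) \<partial>P)
       = (\<integral>\<^sup>+z. ennreal (joint a k n z) * \<phi> z \<partial>traj n)"
proof -
  have step: "(\<integral>\<^sup>+\<omega>. indicator (agree a (Suc n)) \<omega> * \<phi> (obs_traj n \<omega>) \<partial>P)
       = (\<integral>\<^sup>+z. ennreal (joint a (Suc n) n z) * \<phi> z \<partial>traj n)"
    if n: "n \<le> T" and phi: "\<phi> \<in> borel_measurable (traj n)"
      and IH: "\<And>\<phi>. \<phi> \<in> borel_measurable (traj n) \<Longrightarrow>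
        (\<integral>\<^sup>+\<omega>. indicator (agree a n) \<omega> * \<phi> (obs_traj n \<omega>) \<partial>P)
       = (\<integral>\<^sup>+z. ennreal (joint a n n z) * \<phi> z \<partial>traj n)" for n \<phi>
  proof -
    note [measurable] = phi
    have "(\<lambda>z. \<pi> n (fst z, past n a, past n (snd z)) (a n)) \<in> borel_measurable (traj n)"
      by (rule measurable_compose[OF traj_hist_measurable \<pi>_measurable]) (use n in auto)
    then have q [measurable]: "(\<lambda>z. \<pi> n (fst z, past n a, snd z) (a n)) \<in> borel_measurable (traj n)"
      by (rule measurable_cong[THEN iffD1, rotated]) (simp add: past_snd_traj)
    have "(\<integral>\<^sup>+\<omega>. indicator (agree a (Suc n)) \<omega> * \<phi> (obs_traj n \<omega>) \<partial>P)
       = (\<integral>\<^sup>+z. ennreal (joint a n n z) * (ennreal (\<pi> n (fst z, past n a, snd z) (a n)) * \<phi> z) \<partial>traj n)"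
      unfolding treatment_extend[OF n phi]
      by (rule IH[of "\<lambda>z. ennreal (\<pi> n (fst z, past n a, snd z) (a n)) * \<phi> z"]) measurable
    also have "\<dots> = (\<integral>\<^sup>+z. ennreal (joint a (Suc n) n z) * \<phi> z \<partial>traj n)"
    proof (rule nn_integral_cong)
      fix z assume z: "z \<in> space (traj n)"
      have "joint a (Suc n) n z = joint a n n z * \<pi> n (fst z, past n a, snd z) (a n)"
        by (simp add: joint_def prod_\<pi>_Suc past_snd_traj[OF z])
      then show "ennreal (joint a n n z) * (ennreal (\<pi> n (fst z, past n a, snd z) (a n)) * \<phi> z)
          = ennreal (joint a (Suc n) n z) * \<phi> z"
        using joint_nonneg[of n n z a] z n by (simp add: ennreal_mult' mult_ac)
    qed
    finally show ?thesis .
  qed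
  have diag: "(\<integral>\<^sup>+\<omega>. indicator (agree a n) \<omega> * \<phi> (obs_traj n \<omega>) \<partial>P)
       = (\<integral>\<^sup>+z. ennreal (joint a n n z) * \<phi> z \<partial>traj n)"
    if "n \<le> Suc T" "\<phi> \<in> borel_measurable (traj n)" for n \<phi>
    using that
  proof (induction n arbitrary: \<phi>)
    case 0
    interpret S0: sigma_finite_measure "PiM {..<0} \<mu>M" by (rule sigma_finite_PiM_mediators) simp
    \<comment> \<open>The empty sequence is the constant \<open>undefined\<close>, and the empty
      product measure is a unit mass at it; the claim reduces to the density of
      \<open>W\<close>.\<close>
    have past0: "past 0 m = (\<lambda>_. undefined)" for m :: "nat \<Rightarrow> real^'p" by (simp add: past_def restrict_def)
    define m0 :: "nat \<Rightarrow> real^'p" where "m0 = (\<lambda>_. undefined)"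
    have phi [measurable]: "\<phi> \<in> borel_measurable (\<mu>W \<Otimes>\<^sub>M PiM {..<0} \<mu>M)" using 0 by (simp add: traj_def)
    have m0 [measurable]: "m0 \<in> space (PiM {..<0} \<mu>M)" by (simp add: space_PiM m0_def)
    have "(\<integral>\<^sup>+\<omega>. indicator (agree a 0) \<omega> * \<phi> (obs_traj 0 \<omega>) \<partial>P) = (\<integral>\<^sup>+\<omega>. \<phi> (W \<omega>, m0) \<partial>P)"
      by (rule nn_integral_cong) (auto simp: agree_def obs_traj_def past0 m0_def)
    also have "\<dots> = (\<integral>\<^sup>+w. ennreal (p w) * \<phi> (w, m0) \<partial>\<mu>W)"
      by (rule distributed_nn_integral[OF p_density, symmetric]) (use m0 in measurable)
    also have "\<dots> = (\<integral>\<^sup>+w. \<integral>\<^sup>+m. ennreal (p w) * \<phi> (w, m) \<partial>PiM {..<0} \<mu>M \<partial>\<mu>W)"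
      by (rule nn_integral_cong)
         (simp add: PiM_empty nn_integral_count_space_finite m0_def[symmetric])
    also have "\<dots> = (\<integral>\<^sup>+z. ennreal (p (fst z)) * \<phi> z \<partial>(\<mu>W \<Otimes>\<^sub>M PiM {..<0} \<mu>M))"
    proof -
      have "(\<lambda>z. ennreal (p (fst z)) * \<phi> z) \<in> borel_measurable (\<mu>W \<Otimes>\<^sub>M PiM {..<0} \<mu>M)"
        by measurable
      from S0.nn_integral_fst[OF this] show ?thesis by (simp only: fst_conv)
    qed
    also have "\<dots> = (\<integral>\<^sup>+z. ennreal (joint a 0 0 z) * \<phi> z \<partial>traj 0)"
      by (simp add: traj_def joint_def)
    finally show ?case .
  next
    case (Suc n)
    then have n: "n \<le> T" by simp
    note [measurable] = Suc.prems(2)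
    interpret Sn: sigma_finite_measure "\<mu>M n" using n by (rule sigma_finite_\<mu>M)
    \<comment> \<open>The inner \<open>past n\<close> changes nothing on trajectories of length
      \<open>n\<close>; it lets measurability in \<open>z\<close> follow from that of the map from
      trajectories to histories.\<close>
    define G where "G z = (\<integral>\<^sup>+x. ennreal (g n (fst z, past (Suc n) a, past n (snd z)) x) *
                 \<phi> (fst z, (snd z)(n := x)) \<partial>\<mu>M n)" for z
    have [measurable]: "(\<lambda>y. (fst (fst y), (snd (fst y))(n := snd y))) \<in> measurable (traj n \<Otimes>\<^sub>M \<mu>M n) (traj (Suc n))"
    proof -
      have "(\<lambda>z. (snd (fst z))(n := snd z)) \<in> measurable (traj n \<Otimes>\<^sub>M \<mu>M n) (PiM {..<Suc n} \<mu>M)"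
        unfolding traj_def by (rule measurable_fun_upd[where J="{..<n}"]) auto
      then show ?thesis unfolding traj_def by measurable
    qed
    have "(\<lambda>y. ((fst (fst y), past (Suc n) a, past n (snd (fst y))), snd y))
        \<in> measurable (traj n \<Otimes>\<^sub>M \<mu>M n) (hist_space \<mu>W \<mu>M (Suc n) n \<Otimes>\<^sub>M \<mu>M n)"
      by (intro measurable_Pair measurable_compose[OF measurable_fst traj_hist_measurable]) auto
    from measurable_compose[OF this g_measurable[OF n]]
    have [measurable]: "(\<lambda>y. g n (fst (fst y), past (Suc n) a, past n (snd (fst y))) (snd y))
        \<in> borel_measurable (traj n \<Otimes>\<^sub>M \<mu>M n)" by simp
    have Gm: "(\<lambda>(z, x). ennreal (g n (fst z, past (Suc n) a, past n (snd z)) x) *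
               \<phi> (fst z, (snd z)(n := x))) \<in> borel_measurable (traj n \<Otimes>\<^sub>M \<mu>M n)"
      unfolding split_beta' by measurable
    have G_meas: "G \<in> borel_measurable (traj n)"
      unfolding G_def[abs_def] by (rule Sn.borel_measurable_nn_integral[OF Gm])
    have "(\<integral>\<^sup>+\<omega>. indicator (agree a (Suc n)) \<omega> * \<phi> (obs_traj (Suc n) \<omega>) \<partial>P)
        = (\<integral>\<^sup>+\<omega>. indicator (agree a (Suc n)) \<omega> * G (obs_traj n \<omega>) \<partial>P)"
      unfolding mediator_extend[OF n Suc.prems(2)] G_def by (simp add: obs_traj_def)
    also have "\<dots> = (\<integral>\<^sup>+z. ennreal (joint a (Suc n) n z) * G z \<partial>traj n)"
      by (rule step[OF n G_meas]) (use Suc n in auto)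
    also have "\<dots> = (\<integral>\<^sup>+z. \<integral>\<^sup>+x. ennreal (joint a (Suc n) (Suc n) (fst z, (snd z)(n := x))) *
            \<phi> (fst z, (snd z)(n := x)) \<partial>\<mu>M n \<partial>traj n)"
    proof (rule nn_integral_cong)
      fix z assume z: "z \<in> space (traj n)"
      have meas: "(\<lambda>x. ennreal (g n (fst z, past (Suc n) a, past n (snd z)) x) *
                 \<phi> (fst z, (snd z)(n := x))) \<in> borel_measurable (\<mu>M n)"
        using measurable_compose[OF measurable_Pair1'[OF z] Gm] by simp
      have J: "joint a (Suc n) (Suc n) (fst z, (snd z)(n := x))
          = joint a (Suc n) n z * g n (fst z, past (Suc n) a, past n (snd z)) x" for x
      proof -
        have "prod_\<pi> \<pi> (Suc n) (fst z) a ((snd z)(n := x)) = prod_\<pi> \<pi> (Suc n) (fst z) a (snd z)"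
          by (rule prod_\<pi>_cong) auto
        moreover have "prod_g g n (fst z) a ((snd z)(n := x)) = prod_g g n (fst z) a (snd z)"
          by (rule prod_g_cong) auto
        ultimately show ?thesis by (simp add: joint_def prod_g_Suc)
      qed
      show "ennreal (joint a (Suc n) n z) * G z = (\<integral>\<^sup>+x. ennreal (joint a (Suc n) (Suc n) (fst z, (snd z)(n := x))) *
            \<phi> (fst z, (snd z)(n := x)) \<partial>\<mu>M n)"
        unfolding G_def
        by (subst nn_integral_cmult[symmetric, OF meas], rule nn_integral_cong)
           (use joint_nonneg[of "Suc n" n z a] z n in \<open>simp add: J ennreal_mult' mult_ac\<close>)
    qed
    also have "\<dots> = (\<integral>\<^sup>+z. ennreal (joint a (Suc n) (Suc n) z) * \<phi> z \<partial>traj (Suc n))"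
    proof (rule nn_integral_traj_Suc[OF n, symmetric])
      have [measurable]: "joint a (Suc n) (Suc n) \<in> borel_measurable (traj (Suc n))"
        by (rule joint_measurable) (use n in auto)
      show "(\<lambda>z. ennreal (joint a (Suc n) (Suc n) z) * \<phi> z) \<in> borel_measurable (traj (Suc n))"
        by measurable
    qed
    finally show ?case .
  qed
  show ?thesis
    using assms diag step[of n \<phi>] by auto
qed

end

section \<open>Change of measure\<close>

context true_nuisance
begin

text \<open>As an equality of measures, the law transfers Bochner integrals and almost everywhere
  statements, not only nonnegative integrals.\<close>

lemma distr_law:
  assumes "n \<le> Suc T" "k = n \<or> k = Suc n" "k \<le> Suc T"
  shows "distr (density P (indicator (agree a k))) (traj n) (obs_traj n)
       = density (traj n) (\<lambda>z. ennreal (joint a k n z))"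
proof (rule measure_eqI)
  note [measurable] = agree_measurable[OF assms(3)] obs_traj_measurable[OF assms(1)]
  fix B assume "B \<in> sets (distr (density P (indicator (agree a k))) (traj n) (obs_traj n))"
  then have [measurable]: "B \<in> sets (traj n)" by simp
  have [measurable]: "joint a k n \<in> borel_measurable (traj n)" using assms by (auto intro!: joint_measurable)
  have "emeasure (distr (density P (indicator (agree a k))) (traj n) (obs_traj n)) B
      = (\<integral>\<^sup>+z. indicator B z \<partial>distr (density P (indicator (agree a k))) (traj n) (obs_traj n))"
    by simp
  also have "\<dots> = (\<integral>\<^sup>+\<omega>. indicator (agree a k) \<omega> * indicator B (obs_traj n \<omega>) \<partial>P)"
    by (subst nn_integral_distr, simp, simp, subst nn_integral_density) auto
  also have "\<dots> = (\<integral>\<^sup>+z. ennreal (joint a k n z) * indicator B z \<partial>traj n)"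
    by (rule nn_integral_law) (use assms in auto)
  also have "\<dots> = emeasure (density (traj n) (\<lambda>z. ennreal (joint a k n z))) B"
    by (subst emeasure_density) auto
  finally show "emeasure (distr (density P (indicator (agree a k))) (traj n) (obs_traj n)) B
      = emeasure (density (traj n) (\<lambda>z. ennreal (joint a k n z))) B" .
qed simp

text \<open>Integrability is an equivalence because it is carried in both directions between
  \<open>P\<close> and trajectories.\<close>

lemma integral_law:
  fixes \<phi> :: "(real^'d) \<times> (nat \<Rightarrow> real^'p) \<Rightarrow> real"
  assumes n: "n \<le> Suc T" "k = n \<or> k = Suc n" "k \<le> Suc T" and phi: "\<phi> \<in> borel_measurable (traj n)"
  shows "integrable P (\<lambda>\<omega>. indicator (agree a k) \<omega> * \<phi> (obs_traj n \<omega>))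
           \<longleftrightarrow> integrable (traj n) (\<lambda>z. joint a k n z * \<phi> z)" (is ?I)
    and "(\<integral>\<omega>. indicator (agree a k) \<omega> * \<phi> (obs_traj n \<omega>) \<partial>P) = (\<integral>z. joint a k n z * \<phi> z \<partial>traj n)" (is ?E)
proof -
  note [measurable] = agree_measurable[OF n(3)] obs_traj_measurable[OF n(1)] phi
  have [measurable]: "joint a k n \<in> borel_measurable (traj n)" using n by (auto intro!: joint_measurable)
  have nonneg: "AE z in traj n. 0 \<le> joint a k n z"
    using n by (intro AE_I2 joint_nonneg) auto
  have ind: "indicator (agree a k) = (\<lambda>\<omega>. ennreal (indicator (agree a k) \<omega>))"
    by (auto simp: fun_eq_iff indicator_def)
  let ?D = "density P (\<lambda>\<omega>. ennreal (indicator (agree a k) \<omega>))"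
  have D: "distr ?D (traj n) (obs_traj n) = density (traj n) (\<lambda>z. ennreal (joint a k n z))"
    using distr_law[OF n, of a] unfolding ind by simp
  have [measurable]: "obs_traj n \<in> measurable ?D (traj n)" by simp
  have "integrable P (\<lambda>\<omega>. indicator (agree a k) \<omega> * \<phi> (obs_traj n \<omega>))
      \<longleftrightarrow> integrable ?D (\<lambda>\<omega>. \<phi> (obs_traj n \<omega>))"
    by (subst integrable_real_density) auto
  also have "\<dots> \<longleftrightarrow> integrable (distr ?D (traj n) (obs_traj n)) \<phi>"
    by (rule integrable_distr_eq[symmetric]) auto
  also have "\<dots> \<longleftrightarrow> integrable (traj n) (\<lambda>z. joint a k n z * \<phi> z)"
    unfolding D by (rule integrable_real_density) (use nonneg in auto)
  finally show ?I .
  have "(\<integral>\<omega>. indicator (agree a k) \<omega> * \<phi> (obs_traj n \<omega>) \<partial>P) = (\<integral>\<omega>. \<phi> (obs_traj n \<omega>) \<partial>?D)"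
    by (subst integral_real_density) auto
  also have "\<dots> = (\<integral>z. \<phi> z \<partial>distr ?D (traj n) (obs_traj n))"
    by (rule integral_distr[symmetric]) auto
  also have "\<dots> = (\<integral>z. joint a k n z * \<phi> z \<partial>traj n)"
    unfolding D by (rule integral_real_density) (use nonneg in auto)
  finally show ?E .
qed

lemma AE_law_D:
  assumes n: "n \<le> Suc T" "k = n \<or> k = Suc n" "k \<le> Suc T"
    and R: "AE z in traj n. 0 < joint a k n z \<longrightarrow> R z"
  shows "AE \<omega> in P. \<omega> \<in> agree a k \<longrightarrow> R (obs_traj n \<omega>)"
proof -
  note [measurable] = agree_measurable[OF n(3)] obs_traj_measurable[OF n(1)]
  have [measurable]: "joint a k n \<in> borel_measurable (traj n)" using n by (auto intro!: joint_measurable)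
  have "AE z in density (traj n) (\<lambda>z. ennreal (joint a k n z)). R z"
    by (subst AE_density) (use R in auto)
  then have "AE z in distr (density P (indicator (agree a k))) (traj n) (obs_traj n). R z"
    by (simp only: distr_law[OF n])
  then have "AE \<omega> in density P (indicator (agree a k)). R (obs_traj n \<omega>)"
    by (rule AE_distrD[rotated]) simp
  then have "AE \<omega> in P. 0 < (indicator (agree a k) \<omega> :: ennreal) \<longrightarrow> R (obs_traj n \<omega>)"
    by (subst (asm) AE_density) auto
  then show ?thesis by eventually_elim auto
qed

text \<open>Going from observations back to trajectories requires \<open>R\<close> to be measurable:
  a null set of observations need not be the preimage of a measurable null set of
  trajectories.\<close>

lemma AE_law_I:
  assumes n: "n \<le> Suc T" "k = n \<or> k = Suc n" "k \<le> Suc T"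
    and R: "AE \<omega> in P. \<omega> \<in> agree a k \<longrightarrow> R (obs_traj n \<omega>)"
    and R_meas: "{z \<in> space (traj n). R z} \<in> sets (traj n)"
  shows "AE z in traj n. 0 < joint a k n z \<longrightarrow> R z"
proof -
  note [measurable] = agree_measurable[OF n(3)] obs_traj_measurable[OF n(1)]
  have [measurable]: "joint a k n \<in> borel_measurable (traj n)" using n by (auto intro!: joint_measurable)
  have "AE \<omega> in density P (indicator (agree a k)). R (obs_traj n \<omega>)"
    using R by (subst AE_density) (auto simp: indicator_def elim: AE_mp intro!: AE_I2)
  then have "AE z in distr (density P (indicator (agree a k))) (traj n) (obs_traj n). R z"
    by (subst AE_distr_iff) (use R_meas in auto)
  then have "AE z in density (traj n) (\<lambda>z. ennreal (joint a k n z)). R z"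
    by (simp only: distr_law[OF n])
  then show ?thesis by (subst (asm) AE_density) auto
qed

section \<open>Monotonicity and extension of products of treatment probabilities\<close>

lemma \<pi>_le_1:
  assumes "t \<le> T" "h \<in> space (hist_space \<mu>W \<mu>M t t)"
  shows "\<pi> t h b \<le> 1"
proof -
  have "\<pi> t h b \<le> (\<Sum>b\<in>UNIV. \<pi> t h b)"
    by (rule member_le_sum) (use assms \<pi>_nonneg in auto)
  then show ?thesis using \<pi>_sum[OF assms] by simp
qed

text \<open>Every factor lies between 0 and 1. Hence the lower bound \<delta>, assumed at full
  length, holds for all shorter products too.\<close>

lemma prod_\<pi>_antimono:
  assumes "k \<le> l" "l \<le> Suc n" "l \<le> Suc T" "z \<in> space (traj n)"
  shows "prod_\<pi> \<pi> l (fst z) b (snd z) \<le> prod_\<pi> \<pi> k (fst z) b (snd z)"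
  using assms(1,2,3)
proof (induction l rule: dec_induct)
  case (step l)
  then have l: "l \<le> T" "l \<le> n" by auto
  have "\<pi> l (fst z, past l b, past l (snd z)) (b l) \<le> 1"
    by (rule \<pi>_le_1[OF l(1) measurable_space[OF traj_hist_measurable[OF l(2)] assms(4)]])
  moreover have "0 \<le> prod_\<pi> \<pi> l (fst z) b (snd z)"
    by (rule prod_\<pi>_true_nonneg[OF _ _ assms(4)]) (use l in auto)
  ultimately have "prod_\<pi> \<pi> (Suc l) (fst z) b (snd z) \<le> prod_\<pi> \<pi> l (fst z) b (snd z)"
    unfolding prod_\<pi>_Suc by (intro mult_left_le) auto
  with step show ?case by simp
qed simp

text \<open>Since the probabilities sum to one at every history, some next treatment always has
  positive probability. This makes mediator positivity, assumed for full sequences only, applicable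
  to prefixes.\<close>

lemma prod_\<pi>_extend:
  assumes "k \<le> l" "l \<le> Suc n" "l \<le> Suc T" "z \<in> space (traj n)" "0 < prod_\<pi> \<pi> k (fst z) b (snd z)"
  shows "\<exists>b'. (\<forall>j<k. b' j = b j) \<and> 0 < prod_\<pi> \<pi> l (fst z) b' (snd z)"
  using assms(1,2,3)
proof (induction l rule: dec_induct)
  case base
  show ?case using assms(5) by blast
next
  case (step l)
  then obtain b' where b': "\<forall>j<k. b' j = b j" "0 < prod_\<pi> \<pi> l (fst z) b' (snd z)" by auto
  have l: "l \<le> T" "l \<le> n" using step by auto
  let ?h = "(fst z, past l b', past l (snd z))"
  have h: "?h \<in> space (hist_space \<mu>W \<mu>M l l)"
    by (rule measurable_space[OF traj_hist_measurable[OF l(2)] assms(4)])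
  have "\<exists>c. 0 < \<pi> l ?h c"
  proof (rule ccontr)
    assume "\<not> (\<exists>c. 0 < \<pi> l ?h c)"
    then have "\<pi> l ?h c = 0" for c
      using \<pi>_nonneg[OF l(1) h, of c] by (auto simp: not_less intro: antisym)
    then have "(\<Sum>b\<in>UNIV. \<pi> l ?h b) = 0" by simp
    then show False using \<pi>_sum[OF l(1) h] by simp
  qed
  then obtain c where c: "0 < \<pi> l ?h c" ..
  have "prod_\<pi> \<pi> l (fst z) (b'(l := c)) (snd z) = prod_\<pi> \<pi> l (fst z) b' (snd z)"
    by (rule prod_\<pi>_cong) auto
  then have "0 < prod_\<pi> \<pi> (Suc l) (fst z) (b'(l := c)) (snd z)"
    using b'(2) c by (simp add: prod_\<pi>_Suc)
  moreover have "\<forall>j<k. (b'(l := c)) j = b j" using b'(1) step(1) by auto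
  ultimately show ?case by blast
qed

end

section \<open>Positivity and the target law\<close>

locale front_door_setting = true_nuisance P T W A M Y MM \<mu>W \<mu>M p \<pi> g QY
  for P :: "'o measure" and T :: nat and W :: "'o \<Rightarrow> real^'d"
    and A :: "nat \<Rightarrow> 'o \<Rightarrow> bool" and M :: "nat \<Rightarrow> 'o \<Rightarrow> real^'p" and Y :: "'o \<Rightarrow> real"
    and MM :: "nat \<Rightarrow> (real^'p) set"
    and \<mu>W :: "(real^'d) measure" and \<mu>M :: "nat \<Rightarrow> (real^'p) measure"
    and p :: "real^'d \<Rightarrow> real"
    and \<pi> :: "nat \<Rightarrow> (real^'d, real^'p) hist \<Rightarrow> bool \<Rightarrow> real"
    and g :: "nat \<Rightarrow> (real^'d, real^'p) hist \<Rightarrow> real^'p \<Rightarrow> real"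
    and QY :: "(real^'d, real^'p) hist \<Rightarrow> real" +
  fixes a :: "nat \<Rightarrow> bool"
  assumes positivity_treatment: "positivity_treatment T \<mu>W \<mu>M p \<pi> g a"
    and positivity_mediator: "positivity_mediator T \<mu>W \<mu>M p \<pi> g a"
begin

text \<open>
  The law of \<open>(W, M\<^sub>0, \<dots>, M\<^sub>n\<^sub>-\<^sub>1)\<close> when the treatments are set to \<open>a\<close> in the mediator mechanism.
\<close>

definition target :: "nat \<Rightarrow> (real^'d) \<times> (nat \<Rightarrow> real^'p) \<Rightarrow> real" where
  "target n z = p (fst z) * prod_g g n (fst z) a (snd z)"

definition target_law :: "nat \<Rightarrow> ((real^'d) \<times> (nat \<Rightarrow> real^'p)) measure" where
  "target_law n = density (traj n) (\<lambda>z. ennreal (target n z))"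

lemma target_measurable [measurable]: "n \<le> Suc T \<Longrightarrow> target n \<in> borel_measurable (traj n)"
  unfolding target_def[abs_def] by measurable

lemma target_nonneg: "n \<le> Suc T \<Longrightarrow> z \<in> space (traj n) \<Longrightarrow> 0 \<le> target n z"
  unfolding target_def by (intro mult_nonneg_nonneg p_nonneg prod_g_nonneg) auto

lemma sets_target_law [measurable_cong, simp]: "sets (target_law n) = sets (traj n)"
  by (simp add: target_law_def)

lemma space_target_law [simp]: "space (target_law n) = space (traj n)"
  by (simp add: target_law_def)

abbreviation past_traj :: "nat \<Rightarrow> (real^'d) \<times> (nat \<Rightarrow> real^'p) \<Rightarrow> (real^'d) \<times> (nat \<Rightarrow> real^'p)" where
  "past_traj n z \<equiv> (fst z, past n (snd z))"

lemma past_traj_measurable_target: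
  "n \<le> Suc T \<Longrightarrow> past_traj n \<in> measurable (target_law (Suc T)) (traj n)"
  by (subst measurable_cong_sets[OF sets_target_law refl]) (rule past_traj_measurable)

lemma past_traj_id: "z \<in> space (traj n) \<Longrightarrow> past_traj n z = z"
  by (simp add: past_snd_traj)

text \<open>The density \<open>g n\<close> integrates to one at every history, so integrating out
  the last mediator leaves the shorter law. Expectations at all times can therefore be taken under
  the single law \<open>target_law (Suc T)\<close>.\<close>

lemma target_law_Suc:
  assumes n: "n \<le> T"
  shows "distr (target_law (Suc n)) (traj n) (past_traj n) = target_law n"
proof (rule measure_eqI)
  fix B assume "B \<in> sets (distr (target_law (Suc n)) (traj n) (past_traj n))"
  then have B [measurable]: "B \<in> sets (traj n)" by simp
  have [measurable]: "target (Suc n) \<in> borel_measurable (traj (Suc n))"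
    "target n \<in> borel_measurable (traj n)" using n by (auto intro!: joint_measurable target_measurable prod_\<pi>_true_measurable
        prod_g_measurable past_traj_measurable)
  have [measurable]: "past_traj n \<in> measurable (traj (Suc n)) (traj n)" by measurable
  have "emeasure (distr (target_law (Suc n)) (traj n) (past_traj n)) B
      = (\<integral>\<^sup>+z. indicator B z \<partial>distr (target_law (Suc n)) (traj n) (past_traj n))"
    by simp
  also have "\<dots> = (\<integral>\<^sup>+z. indicator B (past_traj n z) \<partial>target_law (Suc n))"
    by (rule nn_integral_distr) measurable
  also have "\<dots> = (\<integral>\<^sup>+z. ennreal (target (Suc n) z) * indicator B (past_traj n z) \<partial>traj (Suc n))"
    unfolding target_law_def by (rule nn_integral_density) measurable
  also have "\<dots> = (\<integral>\<^sup>+z. \<integral>\<^sup>+x. ennreal (target (Suc n) (fst z, (snd z)(n := x))) *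
      indicator B (past_traj n z) \<partial>\<mu>M n \<partial>traj n)"
    by (subst nn_integral_traj_Suc[OF n]) auto
  also have "\<dots> = (\<integral>\<^sup>+z. ennreal (target n z) * indicator B z \<partial>traj n)"
  proof (rule nn_integral_cong)
    fix z assume z: "z \<in> space (traj n)"
    let ?h = "(fst z, past (Suc n) a, past n (snd z))"
    have h: "?h \<in> space (hist_space \<mu>W \<mu>M (Suc n) n)"
      by (rule measurable_space[OF traj_hist_measurable z]) simp
    have "prod_g g n (fst z) a ((snd z)(n := x)) = prod_g g n (fst z) a (snd z)" for x
      by (rule prod_g_cong) auto
    then have t: "target (Suc n) (fst z, (snd z)(n := x)) = target n z * g n ?h x" for x
      by (simp add: target_def prod_g_Suc)
    have gm: "g n ?h \<in> borel_measurable (\<mu>M n)"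
      using measurable_compose[OF measurable_Pair1'[OF h] g_measurable[OF n]] by simp
    have "(\<integral>\<^sup>+x. ennreal (target (Suc n) (fst z, (snd z)(n := x))) * indicator B (past_traj n z) \<partial>\<mu>M n)
        = (\<integral>\<^sup>+x. (ennreal (target n z) * indicator B z) * ennreal (g n ?h x) \<partial>\<mu>M n)"
      using target_nonneg[of n z] n z
      by (intro nn_integral_cong) (simp add: t ennreal_mult' past_traj_id mult_ac)
    also have "\<dots> = ennreal (target n z) * indicator B z"
      using gm by (subst nn_integral_cmult) (auto simp: g_normalised[OF n h])
    finally show "(\<integral>\<^sup>+x. ennreal (target (Suc n) (fst z, (snd z)(n := x))) *
      indicator B (past_traj n z) \<partial>\<mu>M n) = ennreal (target n z) * indicator B z" .
  qed
  also have "\<dots> = emeasure (target_law n) B"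
    unfolding target_law_def by (subst emeasure_density) auto
  finally show "emeasure (distr (target_law (Suc n)) (traj n) (past_traj n)) B = emeasure (target_law n) B" .
qed simp

lemma target_law_past:
  assumes "n \<le> Suc T"
  shows "distr (target_law (Suc T)) (traj n) (past_traj n) = target_law n"
  using assms
proof (induction n rule: inc_induct)
  case base
  have "distr (target_law (Suc T)) (traj (Suc T)) (past_traj (Suc T)) = distr (target_law (Suc T)) (target_law (Suc T)) (\<lambda>z. z)"
    by (rule distr_cong) (auto simp: past_traj_id simp del: prod.collapse)
  then show ?case by (simp add: distr_id)
next
  case (step n)
  have "target_law n = distr (distr (target_law (Suc T)) (traj (Suc n)) (past_traj (Suc n))) (traj n) (past_traj n)"
    using step target_law_Suc[of n] by simp
  also have "\<dots> = distr (target_law (Suc T)) (traj n) (past_traj n \<circ> past_traj (Suc n))"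
    by (rule distr_distr) (use step in \<open>auto intro!: past_traj_measurable past_traj_measurable_target\<close>)
  also have "past_traj n \<circ> past_traj (Suc n) = past_traj n"
    by (auto simp: fun_eq_iff)
  finally show ?case by simp
qed

abbreviation E_target :: "((real^'d) \<times> (nat \<Rightarrow> real^'p) \<Rightarrow> real) \<Rightarrow> real" where
  "E_target f \<equiv> integral\<^sup>L (target_law (Suc T)) f"

lemma integral_target_past:
  fixes \<phi> :: "(real^'d) \<times> (nat \<Rightarrow> real^'p) \<Rightarrow> real"
  assumes n: "n \<le> Suc T" and phi [measurable]: "\<phi> \<in> borel_measurable (traj n)"
  shows "integrable (target_law (Suc T)) (\<lambda>z. \<phi> (past_traj n z))
           \<longleftrightarrow> integrable (traj n) (\<lambda>z. target n z * \<phi> z)" (is ?I)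
    and "E_target (\<lambda>z. \<phi> (past_traj n z)) = (\<integral>z. target n z * \<phi> z \<partial>traj n)" (is ?E)
proof -
  have [measurable]: "target n \<in> borel_measurable (traj n)" using n by (auto intro!: joint_measurable target_measurable prod_\<pi>_true_measurable
        prod_g_measurable past_traj_measurable)
  have [measurable]: "past_traj n \<in> measurable (target_law (Suc T)) (traj n)" using n by (auto intro!: joint_measurable target_measurable prod_\<pi>_true_measurable
        prod_g_measurable past_traj_measurable)
  have nonneg: "AE z in traj n. 0 \<le> target n z"
    using n by (intro AE_I2 target_nonneg) auto
  have "integrable (target_law (Suc T)) (\<lambda>z. \<phi> (past_traj n z)) \<longleftrightarrow> integrable (target_law n) \<phi>"
    unfolding target_law_past[OF n, symmetric] by (rule integrable_distr_eq[symmetric]) measurable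
  also have "\<dots> \<longleftrightarrow> integrable (traj n) (\<lambda>z. target n z * \<phi> z)"
    unfolding target_law_def by (rule integrable_real_density) (use nonneg in auto)
  finally show ?I .
  have "E_target (\<lambda>z. \<phi> (past_traj n z)) = (\<integral>z. \<phi> z \<partial>target_law n)"
    unfolding target_law_past[OF n, symmetric] by (rule integral_distr[symmetric]) measurable
  also have "\<dots> = (\<integral>z. target n z * \<phi> z \<partial>traj n)"
    unfolding target_law_def by (rule integral_real_density) (use nonneg in auto)
  finally show ?E .
qed

lemma AE_target_past_I:
  assumes n: "n \<le> Suc T" and R: "AE z in traj n. 0 < target n z \<longrightarrow> R z"
  shows "AE z in target_law (Suc T). R (past_traj n z)"
proof -
  have [measurable]: "target n \<in> borel_measurable (traj n)" using n by (auto intro!: joint_measurable target_measurable prod_\<pi>_true_measurable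
        prod_g_measurable past_traj_measurable)
  have "AE z in target_law n. R z"
    unfolding target_law_def by (subst AE_density) (use R in auto)
  then have "AE z in distr (target_law (Suc T)) (traj n) (past_traj n). R z"
    by (simp only: target_law_past[OF n])
  then show ?thesis
    by (rule AE_distrD[rotated]) (use n in measurable)
qed

lemma AE_target_past_D:
  assumes n: "n \<le> Suc T" and R: "AE z in target_law (Suc T). R (past_traj n z)"
    and R_meas: "{z \<in> space (traj n). R z} \<in> sets (traj n)"
  shows "AE z in traj n. 0 < target n z \<longrightarrow> R z"
proof -
  have [measurable]: "target n \<in> borel_measurable (traj n)" using n by (auto intro!: joint_measurable target_measurable prod_\<pi>_true_measurable
        prod_g_measurable past_traj_measurable)
  have [measurable]: "past_traj n \<in> measurable (target_law (Suc T)) (traj n)" using n by (auto intro!: joint_measurable target_measurable prod_\<pi>_true_measurable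
        prod_g_measurable past_traj_measurable)
  have "AE z in distr (target_law (Suc T)) (traj n) (past_traj n). R z"
    by (subst AE_distr_iff) (use R R_meas in auto)
  then have "AE z in target_law n. R z" by (simp only: target_law_past[OF n])
  then show ?thesis unfolding target_law_def by (subst (asm) AE_density) auto
qed

lemma positivity_treatment':
  obtains \<delta> where "0 < \<delta>"
    "\<And>k. k \<le> Suc T \<Longrightarrow> AE z in target_law (Suc T). \<delta> \<le> prod_\<pi> \<pi> k (fst z) a (snd z)"
proof -
  obtain \<delta> where \<delta>: "0 < \<delta>"
    and AE: "AE z in target_law (Suc T). \<delta> \<le> prod_\<pi> \<pi> (Suc T) (fst z) a (snd z)"
    using positivity_treatment
    unfolding positivity_treatment_def target_law_def target_def traj_def case_prod_unfold by auto
  show thesis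
  proof (rule that[OF \<delta>])
    fix k assume k: "k \<le> Suc T"
    show "AE z in target_law (Suc T). \<delta> \<le> prod_\<pi> \<pi> k (fst z) a (snd z)"
      using AE AE_space
    proof eventually_elim
      case (elim z)
      then show ?case using k prod_\<pi>_antimono[of k "Suc T" "Suc T" z a] by auto
    qed
  qed
qed

text \<open>At full length, the product of densities at \<open>a\<close> is positive under the
  target law and is at most \<open>C\<close> times the product at \<open>b\<close>, which therefore
  cannot vanish. A prefix of positive probability is extended to a full sequence; a nonzero product
  has nonzero factors, so the prefix inherits the conclusion.\<close>

lemma positivity_mediator':
  assumes k: "n \<le> k" "k \<le> Suc T"
  shows "AE z in target_law (Suc T).
    0 < prod_\<pi> \<pi> k (fst z) b (snd z) \<longrightarrow> 0 < prod_g g n (fst z) b (snd z)"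
proof -
  have [measurable]: "target (Suc T) \<in> borel_measurable (traj (Suc T))" by measurable
  obtain C where C: "\<And>b. b \<in> bin_seqs (Suc T) \<Longrightarrow>
        AE z in density (traj (Suc T)) (\<lambda>z. ennreal (p (fst z))).
          0 < prod_\<pi> \<pi> (Suc T) (fst z) b (snd z) \<longrightarrow>
          prod_g g (Suc T) (fst z) a (snd z) \<le> C * prod_g g (Suc T) (fst z) b (snd z)"
    using positivity_mediator
    unfolding positivity_mediator_def traj_def case_prod_unfold by auto
  have "AE z in traj (Suc T). \<forall>b\<in>bin_seqs (Suc T). 0 < p (fst z) \<longrightarrow>
          0 < prod_\<pi> \<pi> (Suc T) (fst z) b (snd z) \<longrightarrow>
          prod_g g (Suc T) (fst z) a (snd z) \<le> C * prod_g g (Suc T) (fst z) b (snd z)"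
    by (rule AE_finite_allI[OF finite_bin_seqs]) (use C in \<open>subst (asm) AE_density, auto\<close>)
  then have "AE z in traj (Suc T). 0 < ennreal (target (Suc T) z) \<longrightarrow> (\<forall>b\<in>bin_seqs (Suc T).
      0 < prod_\<pi> \<pi> (Suc T) (fst z) b (snd z) \<longrightarrow> prod_g g (Suc T) (fst z) b (snd z) \<noteq> 0)"
  proof eventually_elim
    case (elim z)
    show ?case
    proof (intro impI ballI)
      fix b assume t: "0 < ennreal (target (Suc T) z)"
        and b: "b \<in> bin_seqs (Suc T)" "0 < prod_\<pi> \<pi> (Suc T) (fst z) b (snd z)"
      have "0 < p (fst z)" "0 < prod_g g (Suc T) (fst z) a (snd z)"
        using t p_nonneg[of "fst z"] by (auto simp: target_def zero_less_mult_iff)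
      \<comment> \<open>If the product at \<open>b\<close> were zero, the product at
        \<open>a\<close> would be at most zero, whatever the sign of \<open>C\<close>.\<close>
      with elim b show "prod_g g (Suc T) (fst z) b (snd z) \<noteq> 0" by fastforce
    qed
  qed
  then have "AE z in target_law (Suc T). \<forall>b\<in>bin_seqs (Suc T).
      0 < prod_\<pi> \<pi> (Suc T) (fst z) b (snd z) \<longrightarrow> prod_g g (Suc T) (fst z) b (snd z) \<noteq> 0"
    unfolding target_law_def by (subst AE_density) auto
  then show ?thesis using AE_space
  proof eventually_elim
    case (elim z)
    then have z: "z \<in> space (traj (Suc T))" by simp
    show ?case
    proof
      assume "0 < prod_\<pi> \<pi> k (fst z) b (snd z)"
      then obtain b' where b': "\<forall>j<k. b' j = b j" "0 < prod_\<pi> \<pi> (Suc T) (fst z) b' (snd z)"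
        using prod_\<pi>_extend[OF k(2) _ _ z] by auto
      \<comment> \<open>Members of \<open>bin_seqs\<close> are extensional, which \<open>b'\<close>
        need not be; truncating it to length \<open>Suc T\<close> changes neither product.\<close>
      let ?b = "past (Suc T) b'"
      have "prod_g g (Suc T) (fst z) ?b (snd z) \<noteq> 0"
        using bspec[OF elim(1), of ?b] b'(2) past_in_bin_seqs by simp
      then have "\<forall>t<Suc T. g t (fst z, past (Suc t) b', past t (snd z)) (snd z t) \<noteq> 0"
        by (simp add: prod_g_def del: prod.lessThan_Suc)
      then have "prod_g g n (fst z) b' (snd z) \<noteq> 0"
        using k unfolding prod_g_def by simp
      moreover have "prod_g g n (fst z) b' (snd z) = prod_g g n (fst z) b (snd z)"
        by (rule prod_g_cong) (use b' k in auto)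
      moreover have "0 \<le> prod_g g n (fst z) b (snd z)"
        by (rule prod_g_nonneg[OF _ _ z]) (use k in auto)
      ultimately show "0 < prod_g g n (fst z) b (snd z)" by simp
    qed
  qed
qed

lemma target_treatment_pos:
  assumes n: "n \<le> Suc T" "k = n \<or> k = Suc n" "k \<le> Suc T"
  shows "AE z in traj n. 0 < target n z \<longrightarrow> 0 < prod_\<pi> \<pi> k (fst z) a (snd z)"
proof (rule AE_target_past_D[OF n(1)])
  obtain \<delta> where \<delta>: "0 < \<delta>" "AE z in target_law (Suc T). \<delta> \<le> prod_\<pi> \<pi> k (fst z) a (snd z)"
    by (rule positivity_treatment') (use n(3) in blast)
  from \<delta>(2) show "AE z in target_law (Suc T). 0 < prod_\<pi> \<pi> k (fst (past_traj n z)) a (snd (past_traj n z))"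
    by eventually_elim (use \<delta>(1) n in auto)
  have [measurable]: "(\<lambda>z. prod_\<pi> \<pi> k (fst z) a (snd z)) \<in> borel_measurable (traj n)"
    using n by (auto intro!: joint_measurable target_measurable prod_\<pi>_true_measurable
        prod_g_measurable past_traj_measurable)
  show "{z \<in> space (traj n). 0 < prod_\<pi> \<pi> k (fst z) a (snd z)} \<in> sets (traj n)"
    by measurable
qed

lemma target_mediator_pos:
  assumes n: "n \<le> Suc T" "k = n \<or> k = Suc n" "k \<le> Suc T"
  shows "AE z in traj n. 0 < target n z \<longrightarrow>
    0 < prod_\<pi> \<pi> k (fst z) b (snd z) \<longrightarrow> 0 < prod_g g n (fst z) b (snd z)"
proof (rule AE_target_past_D[OF n(1)])
  have "AE z in target_law (Suc T).
    0 < prod_\<pi> \<pi> k (fst z) b (snd z) \<longrightarrow> 0 < prod_g g n (fst z) b (snd z)"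
    by (rule positivity_mediator') (use n in auto)
  then show "AE z in target_law (Suc T). 0 < prod_\<pi> \<pi> k (fst (past_traj n z)) b (snd (past_traj n z)) \<longrightarrow>
      0 < prod_g g n (fst (past_traj n z)) b (snd (past_traj n z))"
    by eventually_elim (use n in auto)
  have [measurable]: "(\<lambda>z. prod_\<pi> \<pi> k (fst z) b (snd z)) \<in> borel_measurable (traj n)"
    "(\<lambda>z. prod_g g n (fst z) b (snd z)) \<in> borel_measurable (traj n)"
    using n by (auto intro!: joint_measurable target_measurable prod_\<pi>_true_measurable
        prod_g_measurable past_traj_measurable)
  show "{z \<in> space (traj n). 0 < prod_\<pi> \<pi> k (fst z) b (snd z) \<longrightarrow> 0 < prod_g g n (fst z) b (snd z)} \<in> sets (traj n)"
    by measurable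
qed

text \<open>In \<open>joint b k n\<close> times the ratio, the density product at \<open>b\<close>
  cancels and leaves \<open>target n\<close> times the treatment probabilities of \<open>b\<close>.
  Where the cancelled product is zero, the left side is zero by the convention for division, and the
  right side is zero by mediator positivity: the target density or the probability of
  \<open>b\<close> vanishes there.\<close>

lemma mediator_weight:
  fixes \<phi> :: "(real^'d) \<times> (nat \<Rightarrow> real^'p) \<Rightarrow> real" and b :: "nat \<Rightarrow> bool"
  assumes n: "n \<le> Suc T" "k = n \<or> k = Suc n" "k \<le> Suc T" and phi [measurable]: "\<phi> \<in> borel_measurable (traj n)"
  defines "w \<equiv> \<lambda>\<omega>. prod_g g n (W \<omega>) a (\<lambda>j. M j \<omega>) / prod_g g n (W \<omega>) b (\<lambda>j. M j \<omega>)"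
  shows "integrable P (\<lambda>\<omega>. indicator (agree b k) \<omega> * (w \<omega> * \<phi> (obs_traj n \<omega>)))
      \<longleftrightarrow> integrable (target_law (Suc T)) (\<lambda>z. prod_\<pi> \<pi> k (fst z) b (snd z) * \<phi> (past_traj n z))" (is ?I)
    and "(\<integral>\<omega>. indicator (agree b k) \<omega> * (w \<omega> * \<phi> (obs_traj n \<omega>)) \<partial>P)
      = E_target (\<lambda>z. prod_\<pi> \<pi> k (fst z) b (snd z) * \<phi> (past_traj n z))" (is ?E)
proof -
  have m [measurable]: "target n \<in> borel_measurable (traj n)"
    "joint b k n \<in> borel_measurable (traj n)"
    "(\<lambda>z. prod_\<pi> \<pi> k (fst z) b (snd z)) \<in> borel_measurable (traj n)"
    "(\<lambda>z. prod_g g n (fst z) b (snd z)) \<in> borel_measurable (traj n)"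
    "(\<lambda>z. prod_g g n (fst z) a (snd z)) \<in> borel_measurable (traj n)"
    using n by (auto intro!: joint_measurable target_measurable prod_\<pi>_true_measurable
        prod_g_measurable past_traj_measurable)
  define \<psi> where "\<psi> z = prod_g g n (fst z) a (snd z) / prod_g g n (fst z) b (snd z) * \<phi> z" for z
  have [measurable]: "\<psi> \<in> borel_measurable (traj n)" unfolding \<psi>_def[abs_def] by measurable
  have w: "w \<omega> * \<phi> (obs_traj n \<omega>) = \<psi> (obs_traj n \<omega>)" for \<omega>
    by (simp add: w_def \<psi>_def obs_traj_def)
  define \<eta> where "\<eta> z = prod_\<pi> \<pi> k (fst z) b (snd z) * \<phi> z" for z
  have [measurable]: "\<eta> \<in> borel_measurable (traj n)" unfolding \<eta>_def[abs_def] by measurable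
  have \<eta>: "prod_\<pi> \<pi> k (fst z) b (snd z) * \<phi> (past_traj n z) = \<eta> (past_traj n z)" for z
    using n by (auto simp: \<eta>_def)
  have eq: "AE z in traj n. joint b k n z * \<psi> z = target n z * \<eta> z"
    using target_mediator_pos[OF n, of b] AE_space
  proof eventually_elim
    case (elim z)
    have "0 \<le> target n z"
      by (rule target_nonneg[OF n(1) elim(2)])
    moreover have "0 \<le> prod_\<pi> \<pi> k (fst z) b (snd z)"
      by (rule prod_\<pi>_true_nonneg[OF _ _ elim(2)]) (use n in auto)
    ultimately show ?case
      using elim by (cases "prod_g g n (fst z) b (snd z) = 0") (auto simp: joint_def \<psi>_def \<eta>_def target_def)
  qed
  have "integrable (traj n) (\<lambda>z. joint b k n z * \<psi> z) \<longleftrightarrow> integrable (traj n) (\<lambda>z. target n z * \<eta> z)"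
    by (rule integrable_cong_AE) (use eq in auto)
  then show ?I
    unfolding w \<eta> by (subst integral_law(1)[OF n], simp, subst integral_target_past(1)[OF n(1)]) auto
  have "(\<integral>z. joint b k n z * \<psi> z \<partial>traj n) = (\<integral>z. target n z * \<eta> z \<partial>traj n)"
    by (rule integral_cong_AE) (use eq in auto)
  then show ?E
    unfolding w \<eta> by (subst integral_law(2)[OF n], simp, subst integral_target_past(2)[OF n(1)]) auto
qed

text \<open>The treatment probabilities cancel in \<open>joint a k n\<close> and leave
  \<open>target n\<close>. They are positive where the target density is, and elsewhere both sides
  are zero. The right side does not depend on \<open>k\<close>, so both stages at a given
  \<open>n\<close> lead to the same expectation.\<close>

lemma treatment_weight:
  fixes \<phi> :: "(real^'d) \<times> (nat \<Rightarrow> real^'p) \<Rightarrow> real"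
  assumes n: "n \<le> Suc T" "k = n \<or> k = Suc n" "k \<le> Suc T" and phi [measurable]: "\<phi> \<in> borel_measurable (traj n)"
  defines "w \<equiv> \<lambda>\<omega>. 1 / prod_\<pi> \<pi> k (W \<omega>) a (\<lambda>j. M j \<omega>)"
  shows "integrable P (\<lambda>\<omega>. indicator (agree a k) \<omega> * (w \<omega> * \<phi> (obs_traj n \<omega>)))
      \<longleftrightarrow> integrable (target_law (Suc T)) (\<lambda>z. \<phi> (past_traj n z))" (is ?I)
    and "(\<integral>\<omega>. indicator (agree a k) \<omega> * (w \<omega> * \<phi> (obs_traj n \<omega>)) \<partial>P)
      = E_target (\<lambda>z. \<phi> (past_traj n z))" (is ?E)
proof -
  have m [measurable]: "target n \<in> borel_measurable (traj n)"
    "joint a k n \<in> borel_measurable (traj n)"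
    "(\<lambda>z. prod_\<pi> \<pi> k (fst z) a (snd z)) \<in> borel_measurable (traj n)"
    using n by (auto intro!: joint_measurable target_measurable prod_\<pi>_true_measurable
        prod_g_measurable past_traj_measurable)
  define \<psi> where "\<psi> z = 1 / prod_\<pi> \<pi> k (fst z) a (snd z) * \<phi> z" for z
  have [measurable]: "\<psi> \<in> borel_measurable (traj n)" unfolding \<psi>_def[abs_def] by measurable
  have w: "w \<omega> * \<phi> (obs_traj n \<omega>) = \<psi> (obs_traj n \<omega>)" for \<omega>
    using n by (auto simp: w_def \<psi>_def obs_traj_def)
  have eq: "AE z in traj n. joint a k n z * \<psi> z = target n z * \<phi> z"
    using target_treatment_pos[OF n] AE_space
  proof eventually_elim
    case (elim z)
    have "0 \<le> target n z"
      using elim n by (auto intro!: target_nonneg)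
    then show ?case
      using elim by (cases "target n z = 0") (auto simp: joint_def \<psi>_def target_def)
  qed
  have "integrable (traj n) (\<lambda>z. joint a k n z * \<psi> z) \<longleftrightarrow> integrable (traj n) (\<lambda>z. target n z * \<phi> z)"
    by (rule integrable_cong_AE) (use eq in auto)
  then show ?I
    unfolding w by (subst integral_law(1)[OF n], simp, subst integral_target_past(1)[OF n(1)]) auto
  have "(\<integral>z. joint a k n z * \<psi> z \<partial>traj n) = (\<integral>z. target n z * \<phi> z \<partial>traj n)"
    by (rule integral_cong_AE) (use eq in auto)
  then show ?E
    unfolding w by (subst integral_law(2)[OF n], simp, subst integral_target_past(2)[OF n(1)]) auto
qed

end

section \<open>Regressions and the front-door functional\<close>

context longitudinal_data
begin

lemma indicator_agree_sum:
  fixes x :: real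
  assumes "\<omega> \<in> space P"
  shows "(\<Sum>b\<in>bin_seqs k. indicator (agree b k) \<omega> * x) = x"
proof -
  let ?A = "past k (\<lambda>j. A j \<omega>)"
  have "\<omega> \<in> agree b k \<longleftrightarrow> b = ?A" if "b \<in> bin_seqs k" for b
  proof
    assume "\<omega> \<in> agree b k"
    then have "past k b = ?A" by (intro past_cong) (auto simp: agree_def)
    then show "b = ?A" using that by (simp add: past_bin_seqs)
  qed (use assms in \<open>auto simp: agree_def past_apply\<close>)
  then have "(\<Sum>b\<in>bin_seqs k. indicator (agree b k) \<omega> * x) = (\<Sum>b\<in>bin_seqs k. if b = ?A then x else 0)"
    by (intro sum.cong) (auto simp: indicator_def)
  also have "\<dots> = x" by (simp add: sum.delta)
  finally show ?thesis .
qed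

lemma integral_split_treatment:
  fixes f :: "'o \<Rightarrow> real"
  assumes k: "k \<le> Suc T" and f: "integrable P f"
  shows "integral\<^sup>L P f = (\<Sum>b\<in>bin_seqs k. \<integral>\<omega>. indicator (agree b k) \<omega> * f \<omega> \<partial>P)"
proof -
  have "integrable P (\<lambda>\<omega>. indicator (agree b k) \<omega> * f \<omega>)" for b
    using integrable_mult_indicator[OF agree_measurable[OF k] f] by simp
  then have "(\<Sum>b\<in>bin_seqs k. \<integral>\<omega>. indicator (agree b k) \<omega> * f \<omega> \<partial>P)
      = (\<integral>\<omega>. (\<Sum>b\<in>bin_seqs k. indicator (agree b k) \<omega> * f \<omega>) \<partial>P)"
    by (rule Bochner_Integration.integral_sum[symmetric])
  also have "\<dots> = integral\<^sup>L P f"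
    by (rule Bochner_Integration.integral_cong[OF refl]) (rule indicator_agree_sum)
  finally show ?thesis by simp
qed

lemma treated_event_eq: "treated_event P A a t = agree a (Suc t)"
  by (auto simp: treated_event_def agree_def less_Suc_eq_le)

lemma finite_measure_subalgebra_hist_sigma:
  "n \<le> Suc T \<Longrightarrow> k \<le> Suc T \<Longrightarrow> finite_measure_subalgebra P (hist_sigma P W A M \<mu>W \<mu>M n k)"
  by unfold_locales (rule subalgebra_hist_sigma)

text \<open>The equality of \<open>q\<close> with the conditional expectation is required only after
  multiplication by \<open>f\<close>. A regression that is determined only on the event of following
  \<open>a\<close> is thus admissible as long as \<open>f\<close> vanishes off that event.\<close>

lemma integral_mult_cond_exp:
  fixes f :: "(real^'d, real^'p) hist \<Rightarrow> real" and x q :: "'o \<Rightarrow> real"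
  assumes nk: "n \<le> Suc T" "k \<le> Suc T"
    and f: "f \<in> borel_measurable (hist_space \<mu>W \<mu>M n k)"
    and x: "x \<in> borel_measurable P" and q: "q \<in> borel_measurable P"
    and eq: "AE \<omega> in P. f (obs_hist W A M n k \<omega>) * q \<omega>
        = f (obs_hist W A M n k \<omega>) * real_cond_exp P (hist_sigma P W A M \<mu>W \<mu>M n k) x \<omega>"
    and int: "integrable P (\<lambda>\<omega>. f (obs_hist W A M n k \<omega>) * x \<omega>)"
  shows "integrable P (\<lambda>\<omega>. f (obs_hist W A M n k \<omega>) * q \<omega>)"
    and "(\<integral>\<omega>. f (obs_hist W A M n k \<omega>) * q \<omega> \<partial>P) = (\<integral>\<omega>. f (obs_hist W A M n k \<omega>) * x \<omega> \<partial>P)"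
proof -
  let ?F = "hist_sigma P W A M \<mu>W \<mu>M n k"
  interpret F: finite_measure_subalgebra P ?F
    by (rule finite_measure_subalgebra_hist_sigma[OF nk])
  have fF: "(\<lambda>\<omega>. f (obs_hist W A M n k \<omega>)) \<in> borel_measurable ?F"
    by (rule hist_sigma_measurable[OF nk f])
  have fP [measurable]: "(\<lambda>\<omega>. f (obs_hist W A M n k \<omega>)) \<in> borel_measurable P"
    by (rule measurable_from_subalg[OF subalgebra_hist_sigma[OF nk] fF])
  note [measurable] = q
  note * = F.real_cond_exp_intg[OF int fF x]
  show "integrable P (\<lambda>\<omega>. f (obs_hist W A M n k \<omega>) * q \<omega>)"
    by (subst integrable_cong_AE[OF _ _ eq]) (use * in auto)
  show "(\<integral>\<omega>. f (obs_hist W A M n k \<omega>) * q \<omega> \<partial>P) = (\<integral>\<omega>. f (obs_hist W A M n k \<omega>) * x \<omega> \<partial>P)"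
    by (subst integral_cong_AE[OF _ _ eq]) (use * in auto)
qed

end

context true_nuisance
begin

text \<open>With \<open>f\<close> constantly 1 this yields integrability of the outcome regression;
  with \<open>f\<close> a weight it replaces the outcome by a function of the history, to which the
  change of measure applies.\<close>

lemma integral_outcome:
  fixes f :: "(real^'d, real^'p) hist \<Rightarrow> real"
  defines "ob \<equiv> obs_hist W A M (Suc T) (Suc T)"
  assumes f: "f \<in> borel_measurable (hist_space \<mu>W \<mu>M (Suc T) (Suc T))"
    and int: "integrable P (\<lambda>\<omega>. f (ob \<omega>) * Y \<omega>)"
  shows "integrable P (\<lambda>\<omega>. f (ob \<omega>) * QY (ob \<omega>))"
    and "(\<integral>\<omega>. f (ob \<omega>) * QY (ob \<omega>) \<partial>P) = (\<integral>\<omega>. f (ob \<omega>) * Y \<omega> \<partial>P)"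
proof -
  have q: "(\<lambda>\<omega>. QY (ob \<omega>)) \<in> borel_measurable P"
    unfolding ob_def by (rule measurable_compose[OF obs_hist_measurable QY_measurable]) auto
  have eq: "AE \<omega> in P. f (ob \<omega>) * QY (ob \<omega>)
      = f (ob \<omega>) * real_cond_exp P (hist_sigma P W A M \<mu>W \<mu>M (Suc T) (Suc T)) Y \<omega>"
    using QY_cond_exp unfolding ob_def by eventually_elim simp
  note * = integral_mult_cond_exp[OF le_refl le_refl f borel_measurable_integrable[OF Y_integrable] q,
      folded ob_def, OF eq int]
  show "integrable P (\<lambda>\<omega>. f (ob \<omega>) * QY (ob \<omega>))" by (rule *(1))
  show "(\<integral>\<omega>. f (ob \<omega>) * QY (ob \<omega>) \<partial>P) = (\<integral>\<omega>. f (ob \<omega>) * Y \<omega> \<partial>P)" by (rule *(2))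
qed

lemma integral_treatment:
  fixes f :: "(real^'d, real^'p) hist \<Rightarrow> real"
  assumes t: "t \<le> T" and f: "f \<in> borel_measurable (hist_space \<mu>W \<mu>M t t)"
    and int: "integrable P (\<lambda>\<omega>. f (obs_hist W A M t t \<omega>) * of_bool (A t \<omega> = b))"
  shows "(\<integral>\<omega>. f (obs_hist W A M t t \<omega>) * \<pi> t (obs_hist W A M t t \<omega>) b \<partial>P)
       = (\<integral>\<omega>. f (obs_hist W A M t t \<omega>) * of_bool (A t \<omega> = b) \<partial>P)"
proof (rule integral_mult_cond_exp(2)[OF _ _ f _ _ _ int])
  have [measurable]: "A t \<in> measurable P (count_space UNIV)" using t by (rule A_measurable)
  show "(\<lambda>\<omega>. of_bool (A t \<omega> = b) :: real) \<in> borel_measurable P"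
    by measurable
  show "(\<lambda>\<omega>. \<pi> t (obs_hist W A M t t \<omega>) b) \<in> borel_measurable P"
    by (rule measurable_compose[OF obs_hist_measurable \<pi>_measurable]) (use t in auto)
  have "indicator {\<omega>. A t \<omega> = b} = (\<lambda>\<omega>. of_bool (A t \<omega> = b) :: real)"
    by (auto simp: fun_eq_iff indicator_def)
  then show "AE \<omega> in P. f (obs_hist W A M t t \<omega>) * \<pi> t (obs_hist W A M t t \<omega>) b
      = f (obs_hist W A M t t \<omega>) *
        real_cond_exp P (hist_sigma P W A M \<mu>W \<mu>M t t) (\<lambda>\<omega>. of_bool (A t \<omega> = b)) \<omega>"
    using \<pi>_cond_prob[OF t, of b] by auto
qed (use t in auto)

end

section \<open>Density-ratio weights, transfer of null sets and iterated regressions\<close>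

context front_door_setting
begin

text \<open>The true weight \<open>H_true\<close> at the observed history, indexed by the number of
  mediators instead of the last time point. The weight before time 0 is then
  \<open>mweight 0\<close>, an empty product.\<close>

definition mweight :: "nat \<Rightarrow> 'o \<Rightarrow> real" where
  "mweight n \<omega> = prod_g g n (W \<omega>) a (\<lambda>j. M j \<omega>) / prod_g g n (W \<omega>) (\<lambda>j. A j \<omega>) (\<lambda>j. M j \<omega>)"

lemma mweight_0 [simp]: "mweight 0 \<omega> = 1"
  by (simp add: mweight_def)

lemma H_true_obs: "H_true g a t (obs_hist W A M (Suc t) (Suc t) \<omega>) = mweight (Suc t) \<omega>"
  by (simp add: obs_hist_def H_true_eq mweight_def)

text \<open>The observed treatments sit both in the denominator and in the integrand. Splitting over
  the finitely many treatment sequences freezes them at some \<open>b\<close>, which reduces the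
  claim to \<open>mediator_weight\<close>.\<close>

lemma integral_mweight:
  fixes \<phi> :: "(nat \<Rightarrow> bool) \<Rightarrow> (real^'d) \<times> (nat \<Rightarrow> real^'p) \<Rightarrow> real"
  assumes n: "n \<le> Suc T" "k = n \<or> k = Suc n" "k \<le> Suc T"
    and phi: "\<And>b. b \<in> bin_seqs k \<Longrightarrow> \<phi> b \<in> borel_measurable (traj n)"
    and int: "integrable P (\<lambda>\<omega>. mweight n \<omega> * \<phi> (past k (\<lambda>j. A j \<omega>)) (obs_traj n \<omega>))"
  shows "b \<in> bin_seqs k \<Longrightarrow>
      integrable (target_law (Suc T)) (\<lambda>z. prod_\<pi> \<pi> k (fst z) b (snd z) * \<phi> b (past_traj n z))"
    and "(\<integral>\<omega>. mweight n \<omega> * \<phi> (past k (\<lambda>j. A j \<omega>)) (obs_traj n \<omega>) \<partial>P)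
      = (\<Sum>b\<in>bin_seqs k. E_target (\<lambda>z. prod_\<pi> \<pi> k (fst z) b (snd z) * \<phi> b (past_traj n z)))"
proof -
  have eq: "indicator (agree b k) \<omega> * (mweight n \<omega> * \<phi> (past k (\<lambda>j. A j \<omega>)) (obs_traj n \<omega>))
      = indicator (agree b k) \<omega> * (prod_g g n (W \<omega>) a (\<lambda>j. M j \<omega>) /
          prod_g g n (W \<omega>) b (\<lambda>j. M j \<omega>) * \<phi> b (obs_traj n \<omega>))" if "b \<in> bin_seqs k" for b \<omega>
  proof (cases "\<omega> \<in> agree b k")
    case True
    then have A: "A j \<omega> = b j" if "j < k" for j using that by (auto simp: agree_def)
    then have "past k (\<lambda>j. A j \<omega>) = past k b" by (intro past_cong) auto
    moreover have "prod_g g n (W \<omega>) (\<lambda>j. A j \<omega>) (\<lambda>j. M j \<omega>) = prod_g g n (W \<omega>) b (\<lambda>j. M j \<omega>)"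
      by (rule prod_g_cong) (use A n in auto)
    ultimately show ?thesis using that by (simp add: mweight_def past_bin_seqs)
  qed simp
  show "integrable (target_law (Suc T)) (\<lambda>z. prod_\<pi> \<pi> k (fst z) b (snd z) * \<phi> b (past_traj n z))"
    if b: "b \<in> bin_seqs k"
    using integrable_mult_indicator[OF agree_measurable[OF n(3)] int, of b]
    by (simp only: real_scaleR_def eq[OF b] mediator_weight(1)[OF n phi[OF b]])
  show "(\<integral>\<omega>. mweight n \<omega> * \<phi> (past k (\<lambda>j. A j \<omega>)) (obs_traj n \<omega>) \<partial>P)
      = (\<Sum>b\<in>bin_seqs k. E_target (\<lambda>z. prod_\<pi> \<pi> k (fst z) b (snd z) * \<phi> b (past_traj n z)))"
    unfolding integral_split_treatment[OF n(3) int]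
    by (rule sum.cong[OF refl]) (simp only: eq mediator_weight(2)[OF n phi])
qed

text \<open>The transfer rule for conditions that hold along observed histories. If the target
  density and the probability of \<open>b\<close> are positive, mediator positivity makes
  \<open>joint b n n\<close> positive, so a null set of observations is also null here. The
  trajectory may thus be paired with a \<open>b\<close> different from \<open>a\<close>.\<close>

lemma AE_obs_to_target:
  assumes n: "n \<le> Suc T" and R: "AE \<omega> in P. R (obs_hist W A M n n \<omega>)"
    and R_meas: "{h \<in> space (hist_space \<mu>W \<mu>M n n). R h} \<in> sets (hist_space \<mu>W \<mu>M n n)"
  shows "AE z in target_law (Suc T).
    0 < prod_\<pi> \<pi> n (fst z) b (snd z) \<longrightarrow> R (fst z, past n b, past n (snd z))"
proof -
  define R' where "R' z \<longleftrightarrow> R (fst z, past n b, past n (snd z))" for z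
  have m: "(\<lambda>z. (fst z, past n b, past n (snd z))) \<in> measurable (traj n) (hist_space \<mu>W \<mu>M n n)"
    by measurable
  have R'_meas: "{z \<in> space (traj n). R' z} \<in> sets (traj n)"
  proof -
    have "{z \<in> space (traj n). R' z} = (\<lambda>z. (fst z, past n b, past n (snd z))) -`
        {h \<in> space (hist_space \<mu>W \<mu>M n n). R h} \<inter> space (traj n)"
      using measurable_space[OF m] by (auto simp: R'_def)
    then show ?thesis using measurable_sets[OF m R_meas] by simp
  qed
  have "AE \<omega> in P. \<omega> \<in> agree b n \<longrightarrow> R' (obs_traj n \<omega>)"
    using R by eventually_elim (auto simp: R'_def obs_hist_agree obs_traj_def)
  then have "AE z in traj n. 0 < joint b n n z \<longrightarrow> R' z"
    by (intro AE_law_I[OF n _ n] R'_meas) auto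
  moreover have "AE z in traj n. 0 < target n z \<longrightarrow>
    0 < prod_\<pi> \<pi> n (fst z) b (snd z) \<longrightarrow> 0 < prod_g g n (fst z) b (snd z)"
    by (rule target_mediator_pos) (use n in auto)
  ultimately have "AE z in traj n. 0 < target n z \<longrightarrow> 0 < prod_\<pi> \<pi> n (fst z) b (snd z) \<longrightarrow> R' z"
  proof eventually_elim
    case (elim z)
    show ?case
    proof (intro impI)
      assume t: "0 < target n z" and q: "0 < prod_\<pi> \<pi> n (fst z) b (snd z)"
      have "0 < p (fst z)" using t p_nonneg[of "fst z"] by (auto simp: target_def zero_less_mult_iff)
      then have "0 < joint b n n z" using elim t q by (simp add: joint_def)
      then show "R' z" using elim by simp
    qed
  qed
  from AE_target_past_I[OF n this] show ?thesis
    by (simp add: R'_def)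
qed

text \<open>On the event of following \<open>a\<close>, the trajectory has density
  \<open>target\<close> times treatment probabilities, hence is absolutely continuous with respect
  to the target law, under which the lower bound is assumed.\<close>

lemma AE_treated_pos:
  obtains \<delta> where "0 < \<delta>"
    "AE \<omega> in P. \<omega> \<in> agree a (Suc T) \<longrightarrow> \<delta> \<le> prod_\<pi> \<pi> (Suc T) (W \<omega>) a (\<lambda>j. M j \<omega>)"
proof -
  obtain \<delta> where \<delta>: "0 < \<delta>"
    and AE: "AE z in target_law (Suc T). \<delta> \<le> prod_\<pi> \<pi> (Suc T) (fst z) a (snd z)"
    by (rule positivity_treatment') blast
  have m [measurable]: "target (Suc T) \<in> borel_measurable (traj (Suc T))" by measurable
  have "AE z in traj (Suc T). 0 < ennreal (target (Suc T) z) \<longrightarrow> \<delta> \<le> prod_\<pi> \<pi> (Suc T) (fst z) a (snd z)"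
    using AE unfolding target_law_def by (subst (asm) AE_density) auto
  then have "AE z in traj (Suc T). 0 < joint a (Suc T) (Suc T) z \<longrightarrow> \<delta> \<le> prod_\<pi> \<pi> (Suc T) (fst z) a (snd z)"
    using AE_space
  proof eventually_elim
    case (elim z)
    then show ?case
      using target_nonneg[OF le_refl elim(2)]
      by (cases "target (Suc T) z = 0") (auto simp: joint_def target_def)
  qed
  then have "AE \<omega> in P. \<omega> \<in> agree a (Suc T) \<longrightarrow>
      \<delta> \<le> prod_\<pi> \<pi> (Suc T) (fst (obs_traj (Suc T) \<omega>)) a (snd (obs_traj (Suc T) \<omega>))"
    by (intro AE_law_D) auto
  with \<delta> show thesis by (intro that) (auto simp: obs_traj_def)
qed

text \<open>Mediator positivity bounds the target density times the probability of \<open>b\<close>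
  by \<open>C\<close> times the observed density at \<open>b\<close>, and the outcome regression is
  integrable under the latter because \<open>Y\<close> is integrable.\<close>

lemma integrable_QY_target:
  assumes b: "b \<in> bin_seqs (Suc T)"
  shows "integrable (target_law (Suc T)) (\<lambda>z. prod_\<pi> \<pi> (Suc T) (fst z) b (snd z) * QY (fst z, b, past (Suc T) (snd z)))"
proof -
  have m [measurable]: "target (Suc T) \<in> borel_measurable (traj (Suc T))"
    "joint b (Suc T) (Suc T) \<in> borel_measurable (traj (Suc T))"
    "(\<lambda>z. prod_\<pi> \<pi> (Suc T) (fst z) b (snd z)) \<in> borel_measurable (traj (Suc T))"
    by (auto intro!: target_measurable joint_measurable prod_\<pi>_true_measurable)
  define f where "f z = QY (fst z, past (Suc T) b, past (Suc T) (snd z))" for z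
  have f [measurable]: "f \<in> borel_measurable (traj (Suc T))"
    unfolding f_def[abs_def] by (rule measurable_compose[OF traj_hist_measurable QY_measurable]) simp
  have QYf: "QY (fst z, b, past (Suc T) (snd z)) = f z" for z
    using b by (simp add: f_def past_bin_seqs)
  obtain C where "AE z in density (traj (Suc T)) (\<lambda>z. ennreal (p (fst z))).
          0 < prod_\<pi> \<pi> (Suc T) (fst z) b (snd z) \<longrightarrow>
          prod_g g (Suc T) (fst z) a (snd z) \<le> C * prod_g g (Suc T) (fst z) b (snd z)"
    using positivity_mediator b
    unfolding positivity_mediator_def traj_def case_prod_unfold by auto
  then have C: "AE z in traj (Suc T). 0 < p (fst z) \<longrightarrow> 0 < prod_\<pi> \<pi> (Suc T) (fst z) b (snd z) \<longrightarrow>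
          prod_g g (Suc T) (fst z) a (snd z) \<le> C * prod_g g (Suc T) (fst z) b (snd z)"
    by (subst (asm) AE_density) auto
  have "integrable P (\<lambda>\<omega>. QY (obs_hist W A M (Suc T) (Suc T) \<omega>))"
    using integral_outcome(1)[of "\<lambda>_. 1"] Y_integrable by simp
  from integrable_mult_indicator[OF agree_measurable[OF le_refl] this, of b]
  have "integrable P (\<lambda>\<omega>. indicator (agree b (Suc T)) \<omega> * f (obs_traj (Suc T) \<omega>))"
    by (rule Bochner_Integration.integrable_cong[THEN iffD1, OF refl, rotated])
       (auto simp: indicator_def obs_hist_agree f_def obs_traj_def)
  then have int: "integrable (traj (Suc T)) (\<lambda>z. joint b (Suc T) (Suc T) z * f z)"
    by (subst (asm) integral_law(1)) auto
  have "integrable (traj (Suc T)) (\<lambda>z. target (Suc T) z * (prod_\<pi> \<pi> (Suc T) (fst z) b (snd z) * f z))"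
  proof (rule Bochner_Integration.integrable_bound)
    show "integrable (traj (Suc T)) (\<lambda>z. C * (joint b (Suc T) (Suc T) z * f z))"
      using int by (rule integrable_mult_right)
    show "AE z in traj (Suc T). norm (target (Suc T) z * (prod_\<pi> \<pi> (Suc T) (fst z) b (snd z) * f z))
        \<le> norm (C * (joint b (Suc T) (Suc T) z * f z))"
      using C AE_space
    proof eventually_elim
      case (elim z)
      define u where "u = prod_\<pi> \<pi> (Suc T) (fst z) b (snd z)"
      define v where "v = prod_g g (Suc T) (fst z) a (snd z)"
      define v' where "v' = prod_g g (Suc T) (fst z) b (snd z)"
      have nn: "0 \<le> u" "0 \<le> v" "0 \<le> p (fst z)"
        unfolding u_def v_def
        by (intro prod_\<pi>_true_nonneg[OF _ _ elim(2)] prod_g_nonneg[OF _ _ elim(2)] p_nonneg; simp)+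
      \<comment> \<open>The bound with \<open>C\<close> is available only where \<open>p\<close> and
        the probability of \<open>b\<close> are positive; otherwise both sides are zero.\<close>
      have "norm (p (fst z) * v * (u * f z)) \<le> norm (C * (p (fst z) * u * v' * f z))"
      proof (cases "0 < p (fst z) \<and> 0 < u")
        case True
        then have "v \<le> C * v'" using elim by (simp add: u_def v_def v'_def)
        then have "\<bar>v\<bar> \<le> \<bar>C * v'\<bar>" using nn by linarith
        then have "(p (fst z) * u * \<bar>f z\<bar>) * \<bar>v\<bar> \<le> (p (fst z) * u * \<bar>f z\<bar>) * \<bar>C * v'\<bar>"
          using nn by (intro mult_left_mono) auto
        then show ?thesis using nn by (simp add: abs_mult mult_ac)
      next
        case False
        then have "p (fst z) = 0 \<or> u = 0" using nn by linarith
        then show ?thesis by auto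
      qed
      then show ?case by (simp add: target_def joint_def u_def v_def v'_def)
    qed
  qed measurable
  then have "integrable (target_law (Suc T)) (\<lambda>z. prod_\<pi> \<pi> (Suc T) (fst (past_traj (Suc T) z)) b
      (snd (past_traj (Suc T) z)) * f (past_traj (Suc T) z))"
    by (subst integral_target_past(1)) auto
  then show ?thesis by (simp add: QYf f_def)
qed

text \<open>Fubini for the product of baseline and mediator measures. Integrability of each
  treatment term under the target law justifies both the iterated integral and moving the sum
  outside.\<close>

lemma front_door_eq:
  "front_door T \<mu>W \<mu>M p \<pi> g QY a =
    (\<Sum>b\<in>bin_seqs (Suc T). E_target (\<lambda>z. prod_\<pi> \<pi> (Suc T) (fst z) b (snd z) * QY (fst z, b, past (Suc T) (snd z))))"
proof -
  define h where "h z = (\<Sum>b\<in>bin_seqs (Suc T). prod_\<pi> \<pi> (Suc T) (fst z) b (snd z) *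
      QY (fst z, b, past (Suc T) (snd z)))" for z
  have QYm: "(\<lambda>z. QY (fst z, b, past (Suc T) (snd z))) \<in> borel_measurable (traj (Suc T))" if "b \<in> bin_seqs (Suc T)" for b
    using measurable_compose[OF traj_hist_measurable[of "Suc T" "Suc T" "Suc T" b] QY_measurable] that
    by (simp add: past_bin_seqs)
  have h [measurable]: "h \<in> borel_measurable (traj (Suc T))"
    unfolding h_def[abs_def]
    by (intro borel_measurable_sum borel_measurable_times prod_\<pi>_true_measurable QYm) auto
  have hp: "h (past_traj (Suc T) z) = h z" for z by (simp add: h_def)
  have int: "integrable (target_law (Suc T)) h"
    unfolding h_def[abs_def] by (intro Bochner_Integration.integrable_sum integrable_QY_target)
  have int': "integrable (traj (Suc T)) (\<lambda>z. target (Suc T) z * h z)"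
    using int integral_target_past(1)[OF le_refl h] by (simp add: hp)
  interpret S: sigma_finite_measure "PiM {..<Suc T} \<mu>M" by (rule sigma_finite_PiM_mediators) simp
  interpret SW: sigma_finite_measure \<mu>W by (rule sigma_finite_\<mu>W)
  interpret pair_sigma_finite \<mu>W "PiM {..<Suc T} \<mu>M" ..
  have "(\<Sum>b\<in>bin_seqs (Suc T). E_target (\<lambda>z. prod_\<pi> \<pi> (Suc T) (fst z) b (snd z) * QY (fst z, b, past (Suc T) (snd z))))
      = E_target h"
    unfolding h_def[abs_def]
    by (rule Bochner_Integration.integral_sum[symmetric]) (rule integrable_QY_target)
  also have "\<dots> = (\<integral>z. target (Suc T) z * h z \<partial>traj (Suc T))"
    using integral_target_past(2)[OF le_refl h] by (simp add: hp)
  also have "\<dots> = (\<integral>w. \<integral>m. target (Suc T) (w, m) * h (w, m) \<partial>PiM {..<Suc T} \<mu>M \<partial>\<mu>W)"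
    using int' unfolding traj_def by (rule integral_fst'[symmetric])
  also have "\<dots> = front_door T \<mu>W \<mu>M p \<pi> g QY a"
    unfolding front_door_def
  proof (intro Bochner_Integration.integral_cong refl)
    fix w and m assume "m \<in> space (PiM {..<Suc T} \<mu>M)"
    then have "past (Suc T) m = m"
      by (auto simp: space_PiM past_def fun_eq_iff PiE_def extensional_def)
    then show "target (Suc T) (w, m) * h (w, m) = prod_g g (Suc T) w a m *
              (\<Sum>a'\<in>bin_seqs (Suc T). QY (w, a', m) * prod_\<pi> \<pi> (Suc T) w a' m) * p w"
      by (simp add: target_def h_def mult_ac)
  qed
  finally show ?thesis by simp
qed

text \<open>Regressions defined under \<open>P\<close> on the event of following \<open>a\<close>
  are regressions under the target law as well. The true inverse probability weight depends only on
  the conditioning history, so it can be multiplied into the conditional expectation before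
  \<open>treatment_weight\<close> changes the measure on both sides. The free multiplier
  \<open>c\<close> allows the same fact to be used with 1 and with products of true or candidate
  probabilities of another treatment sequence.\<close>

lemma cond_exp_on_target:
  fixes F G c :: "(real^'d) \<times> (nat \<Rightarrow> real^'p) \<Rightarrow> real"
  assumes t: "t \<le> T"
    and F [measurable]: "F \<in> borel_measurable (traj (Suc t))"
    and G [measurable]: "G \<in> borel_measurable (traj t)" and c [measurable]: "c \<in> borel_measurable (traj t)"
    and ce: "cond_exp_on P (hist_sigma P W A M \<mu>W \<mu>M (Suc t) t) (treated_event P A a t)
       (\<lambda>\<omega>. F (obs_traj (Suc t) \<omega>)) (\<lambda>\<omega>. G (obs_traj t \<omega>))"
    and int: "integrable (target_law (Suc T)) (\<lambda>z. c (past_traj t z) * F (past_traj (Suc t) z))"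
  shows "integrable (target_law (Suc T)) (\<lambda>z. c (past_traj t z) * G (past_traj t z))"
    and "E_target (\<lambda>z. c (past_traj t z) * G (past_traj t z))
       = E_target (\<lambda>z. c (past_traj t z) * F (past_traj (Suc t) z))"
proof -
  let ?o = "obs_hist W A M (Suc t) t" and ?H = "hist_space \<mu>W \<mu>M (Suc t) t"
  let ?C = "{h \<in> space ?H. \<forall>j\<in>{..<Suc t}. fst (snd h) j = a j}"
  let ?E = "agree a (Suc t)"
  have [measurable]: "?E \<in> sets P" by (rule agree_measurable) (use t in auto)
  have [measurable]: "obs_traj (Suc t) \<in> measurable P (traj (Suc t))" "obs_traj t \<in> measurable P (traj t)"
    by (rule obs_traj_measurable, use t in simp)+
  define V where "V z = 1 / prod_\<pi> \<pi> (Suc t) (fst z) a (snd z)" for z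
  have V [measurable]: "V \<in> borel_measurable (traj t)"
    unfolding V_def[abs_def]
    by (intro borel_measurable_divide borel_measurable_const prod_\<pi>_true_measurable) (use t in auto)
  \<comment> \<open>Multiplier, inverse weight and the indicator of following \<open>a\<close> are
    collected into one function of the history, as required to multiply a conditional
    expectation.\<close>
  define f where "f h = indicator ?C h * (V (fst h, snd (snd h)) * c (fst h, snd (snd h)))" for h
  have f: "f \<in> borel_measurable ?H"
    unfolding f_def[abs_def]
    by (intro borel_measurable_times borel_measurable_indicator treatment_pred_measurable
        measurable_compose[OF hist_traj_measurable V] measurable_compose[OF hist_traj_measurable c])
  have oC: "?o \<omega> \<in> ?C \<longleftrightarrow> \<omega> \<in> ?E" if "\<omega> \<in> space P" for \<omega>
  proof -
    have "?o \<omega> \<in> space ?H"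
      by (rule measurable_space[OF obs_hist_measurable that]) (use t in auto)
    then show ?thesis using that by (auto simp: agree_def obs_hist_def past_apply)
  qed
  have fo: "f (?o \<omega>) = indicator ?E \<omega> * (1 / prod_\<pi> \<pi> (Suc t) (W \<omega>) a (\<lambda>j. M j \<omega>) * c (obs_traj t \<omega>))"
    if "\<omega> \<in> space P" for \<omega>
    using oC[OF that] by (auto simp: f_def V_def indicator_def obs_hist_def obs_traj_def)
  let ?x = "\<lambda>\<omega>. indicator ?E \<omega> * F (obs_traj (Suc t) \<omega>)"
  let ?q = "\<lambda>\<omega>. indicator ?E \<omega> * G (obs_traj t \<omega>)"
  have fx: "f (?o \<omega>) * ?x \<omega> = indicator ?E \<omega> * (1 / prod_\<pi> \<pi> (Suc t) (W \<omega>) a (\<lambda>j. M j \<omega>) *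
      (c (past_traj t (obs_traj (Suc t) \<omega>)) * F (obs_traj (Suc t) \<omega>)))" if "\<omega> \<in> space P" for \<omega>
    unfolding fo[OF that] by (simp add: indicator_def obs_traj_def)
  have fq: "f (?o \<omega>) * ?q \<omega> = indicator ?E \<omega> * (1 / prod_\<pi> \<pi> (Suc t) (W \<omega>) a (\<lambda>j. M j \<omega>) *
      (c (obs_traj t \<omega>) * G (obs_traj t \<omega>)))" if "\<omega> \<in> space P" for \<omega>
    unfolding fo[OF that] by (simp add: indicator_def)
  have m1: "(\<lambda>z. c (past_traj t z) * F z) \<in> borel_measurable (traj (Suc t))"
    by (intro borel_measurable_times F measurable_compose[OF past_traj_measurable c]) simp
  have m2: "(\<lambda>z. c z * G z) \<in> borel_measurable (traj t)" by measurable
  \<comment> \<open>The trajectories have lengths \<open>Suc t\<close> and \<open>t\<close>, but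
    both carry the weight with \<open>Suc t\<close> treatments. These are the two stages allowed by
    the change of measure.\<close>
  have T1: "Suc t \<le> Suc T" "Suc t = Suc t \<or> Suc t = Suc (Suc t)" "Suc t \<le> Suc T" using t by auto
  have T2: "t \<le> Suc T" "Suc t = t \<or> Suc t = Suc t" "Suc t \<le> Suc T" using t by auto
  note w1 = treatment_weight[OF T1 m1]
  note w2 = treatment_weight[OF T2 m2]
  have pp: "past_traj t (past_traj (Suc t) z) = past_traj t z" for z :: "(real^'d) \<times> (nat \<Rightarrow> real^'p)" by simp
  have intx: "integrable P (\<lambda>\<omega>. f (?o \<omega>) * ?x \<omega>)"
    using w1(1) int by (simp only: fx pp cong: Bochner_Integration.integrable_cong)
  have eq: "AE \<omega> in P. f (?o \<omega>) * ?q \<omega> = f (?o \<omega>) *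
      real_cond_exp P (hist_sigma P W A M \<mu>W \<mu>M (Suc t) t) ?x \<omega>"
    using ce[unfolded cond_exp_on_def treated_event_eq] AE_space
    by eventually_elim (auto simp: fo indicator_def)
  note ic = integral_mult_cond_exp[OF T1(1) T2(1) f _ _ eq intx]
  have mx: "?x \<in> borel_measurable P" "?q \<in> borel_measurable P" by measurable
  note ic = ic[OF mx]
  show "integrable (target_law (Suc T)) (\<lambda>z. c (past_traj t z) * G (past_traj t z))"
    using w2(1) ic(1) by (simp only: fq cong: Bochner_Integration.integrable_cong)
  show "E_target (\<lambda>z. c (past_traj t z) * G (past_traj t z))
       = E_target (\<lambda>z. c (past_traj t z) * F (past_traj (Suc t) z))"
    using w2(2) ic(2) w1(2)
    by (simp only: fq fx pp cong: Bochner_Integration.integral_cong)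
qed

end

section \<open>Candidate nuisance functions\<close>

lemma sum_bin_seqs_Suc:
  fixes f :: "(nat \<Rightarrow> bool) \<Rightarrow> real"
  shows "(\<Sum>b\<in>bin_seqs (Suc n). f b) = (\<Sum>b\<in>bin_seqs n. \<Sum>c\<in>UNIV. f (b(n := c)))"
proof -
  have "(\<Sum>b\<in>bin_seqs n. \<Sum>c\<in>UNIV. f (b(n := c))) = (\<Sum>(b, c)\<in>bin_seqs n \<times> UNIV. f (b(n := c)))"
    by (rule sum.cartesian_product)
  also have "\<dots> = (\<Sum>b\<in>bin_seqs (Suc n). f b)"
  proof (rule sum.reindex_bij_witness[where i = "\<lambda>b. (past n b, b n)" and j = "\<lambda>(b, c). b(n := c)"])
    fix x :: "(nat \<Rightarrow> bool) \<times> bool" assume x: "x \<in> bin_seqs n \<times> UNIV"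
    then show "(past n ((case x of (b, c) \<Rightarrow> b(n := c))), (case x of (b, c) \<Rightarrow> b(n := c)) n) = x"
      by (cases x) (simp add: past_bin_seqs)
    show "(case x of (b, c) \<Rightarrow> b(n := c)) \<in> bin_seqs (Suc n)"
      using x by (cases x) (auto simp: bin_seqs_def PiE_def extensional_def)
    show "f (case x of (b, c) \<Rightarrow> b(n := c)) = (case x of (b, c) \<Rightarrow> f (b(n := c)))"
      by (cases x) simp
  next
    fix b assume b: "b \<in> bin_seqs (Suc n)"
    then have "(past n b)(n := b n) = b"
      using past_Suc_upd[of n b "b n"] by (simp add: past_bin_seqs)
    then show "(case (past n b, b n) of (b, c) \<Rightarrow> b(n := c)) = b" by simp
    show "(past n b, b n) \<in> bin_seqs n \<times> UNIV" by simp
  qed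
  finally show ?thesis by simp
qed

locale candidate_setting = front_door_setting P T W A M Y MM \<mu>W \<mu>M p \<pi> g QY a
  for P :: "'o measure" and T :: nat and W :: "'o \<Rightarrow> real^'d"
    and A :: "nat \<Rightarrow> 'o \<Rightarrow> bool" and M :: "nat \<Rightarrow> 'o \<Rightarrow> real^'p" and Y :: "'o \<Rightarrow> real"
    and MM :: "nat \<Rightarrow> (real^'p) set"
    and \<mu>W :: "(real^'d) measure" and \<mu>M :: "nat \<Rightarrow> (real^'p) measure"
    and p :: "real^'d \<Rightarrow> real"
    and \<pi> :: "nat \<Rightarrow> (real^'d, real^'p) hist \<Rightarrow> bool \<Rightarrow> real"
    and g :: "nat \<Rightarrow> (real^'d, real^'p) hist \<Rightarrow> real^'p \<Rightarrow> real"
    and QY :: "(real^'d, real^'p) hist \<Rightarrow> real"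
    and a :: "nat \<Rightarrow> bool" +
  fixes N :: "(real^'d, real^'p) nuisance"
  assumes candidate: "candidate_nuisance T \<mu>W \<mu>M N"
    and \<pi>_star_pos: "\<And>t. t \<le> T \<Longrightarrow>
           AE \<omega> in P. \<omega> \<in> treated_event P A a t \<longrightarrow> 0 < \<pi>_star N t (obs_hist W A M t t \<omega>) (a t)"
    and products: "products_integrable P T W A M Y N a"
begin

lemma QY_star_measurable: "QY_star N \<in> borel_measurable (hist_space \<mu>W \<mu>M (Suc T) (Suc T))"
  and \<pi>_star_measurable: "t \<le> T \<Longrightarrow> (\<lambda>h. \<pi>_star N t h c) \<in> borel_measurable (hist_space \<mu>W \<mu>M t t)"
  and \<pi>_star_nonneg: "t \<le> T \<Longrightarrow> h \<in> space (hist_space \<mu>W \<mu>M t t) \<Longrightarrow> 0 \<le> \<pi>_star N t h c"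
  and \<pi>_star_sum: "t \<le> T \<Longrightarrow> h \<in> space (hist_space \<mu>W \<mu>M t t) \<Longrightarrow> (\<Sum>c\<in>UNIV. \<pi>_star N t h c) = 1"
  and H_star_measurable: "t \<le> T \<Longrightarrow> H_star N t \<in> borel_measurable (hist_space \<mu>W \<mu>M (Suc t) (Suc t))"
  and QM_star_measurable: "t \<le> T \<Longrightarrow> QM_star N t \<in> borel_measurable (traj t)"
  and RM_star_measurable: "t \<le> T \<Longrightarrow> RM_star N t \<in> borel_measurable (hist_space \<mu>W \<mu>M (Suc t) t)"
  using candidate unfolding candidate_nuisance_def traj_def by blast+

section \<open>Candidate functions on trajectories and at the observed data\<close>

abbreviation "qm t z \<equiv> QM T N t (fst z) (snd z)"
abbreviation "rA t b z \<equiv> RA T N t (fst z) b (snd z)"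
abbreviation "rM t b z \<equiv> RM N t (fst z) b (snd z)"
abbreviation "prod_star k b z \<equiv> prod_\<pi> (\<pi>_star N) k (fst z) b (snd z)"

abbreviation "obsW t \<omega> \<equiv> W_star N a t (W \<omega>) (\<lambda>j. A j \<omega>) (\<lambda>j. M j \<omega>)"
abbreviation "obsH t \<omega> \<equiv> H_prev N t (W \<omega>) (\<lambda>j. A j \<omega>) (\<lambda>j. M j \<omega>)"
abbreviation "obsQM t \<omega> \<equiv> QM T N t (W \<omega>) (\<lambda>j. M j \<omega>)"
abbreviation "obsRM t \<omega> \<equiv> RM N t (W \<omega>) (\<lambda>j. A j \<omega>) (\<lambda>j. M j \<omega>)"
abbreviation "obsRA t \<omega> \<equiv> RA T N t (W \<omega>) (\<lambda>j. A j \<omega>) (\<lambda>j. M j \<omega>)"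

lemma qm_past: "t \<le> Suc T \<Longrightarrow> QM T N t w (past t m) = QM T N t w m"
  by (auto simp: QM_def)

lemma rM_past: "RM N t w (past (Suc t) b) (past t m) = RM N t w b m"
  by (simp add: RM_def)

lemma rA_past: "t \<le> Suc T \<Longrightarrow> RA T N t w (past t b) (past t m) = RA T N t w b m"
  by (auto simp: RA_def RM_def past_Suc_upd)

lemma prod_star_measurable:
  "k \<le> Suc n \<Longrightarrow> k \<le> Suc T \<Longrightarrow> (\<lambda>z. prod_star k b z) \<in> borel_measurable (traj n)"
  by (rule prod_\<pi>_measurable) (rule \<pi>_star_measurable)

lemma rM_measurable:
  assumes "t \<le> T" shows "(\<lambda>z. rM t b z) \<in> borel_measurable (traj t)"
  unfolding RM_def
  by (rule measurable_compose[OF traj_hist_measurable RM_star_measurable]) (use assms in auto)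

lemma rA_measurable:
  assumes "t \<le> Suc T" shows "(\<lambda>z. rA t b z) \<in> borel_measurable (traj t)"
proof (cases "t = Suc T")
  case True
  then show ?thesis
    unfolding RA_def
    by (auto intro!: measurable_compose[OF traj_hist_measurable QY_star_measurable])
next
  case False
  then have t: "t \<le> T" using assms by simp
  have "(\<lambda>z. \<pi>_star N t (fst z, past t b, past t (snd z)) c) \<in> borel_measurable (traj t)" for c
    by (rule measurable_compose[OF traj_hist_measurable \<pi>_star_measurable]) (use t in auto)
  then show ?thesis
    using False unfolding RA_def
    by (auto intro!: borel_measurable_sum borel_measurable_times rM_measurable[OF t])
qed

lemma rA_last: "RA T N (Suc T) w b m = QY_star N (w, past (Suc T) b, past (Suc T) m)"
  by (simp add: RA_def)

lemma qm_last: "qm (Suc T) z = (\<Sum>b\<in>bin_seqs (Suc T). prod_star (Suc T) b z * rA (Suc T) b z)"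
  by (simp add: QM_def rA_last past_bin_seqs mult.commute cong: sum.cong)

lemma qm_measurable:
  assumes "t \<le> Suc T" shows "(\<lambda>z. qm t z) \<in> borel_measurable (traj t)"
proof (cases "t = Suc T")
  case True
  show ?thesis
    unfolding True qm_last
    by (intro borel_measurable_sum borel_measurable_times prod_star_measurable rA_measurable) auto
next
  case False
  then have t: "t \<le> T" using assms by simp
  show ?thesis
    using False measurable_compose[OF past_traj_measurable QM_star_measurable[OF t], of t]
    by (simp add: QM_def)
qed

lemma qm_obs: "t \<le> Suc T \<Longrightarrow> qm t (obs_traj t \<omega>) = obsQM t \<omega>"
  by (simp add: obs_traj_def qm_past)

lemma rM_obs: "rM t (past (Suc t) (\<lambda>j. A j \<omega>)) (obs_traj t \<omega>) = obsRM t \<omega>"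
  by (simp add: obs_traj_def rM_past)

lemma rA_obs: "t \<le> Suc T \<Longrightarrow> rA t (past t (\<lambda>j. A j \<omega>)) (obs_traj t \<omega>) = obsRA t \<omega>"
  by (simp add: obs_traj_def rA_past)

lemma obsH_0 [simp]: "obsH 0 \<omega> = 1"
  by (simp add: H_prev_def)

lemma obsH_Suc: "obsH (Suc t) \<omega> = H_star N t (obs_hist W A M (Suc t) (Suc t) \<omega>)"
  by (simp add: H_prev_def obs_hist_def)

text \<open>Because of this convention the product of \<open>H_star\<close> and
  \<open>QY_star\<close> in the outcome term is also the endpoint of the telescoping sum of
  \<open>R\<close> terms.\<close>

lemma obsRA_last: "obsRA (Suc T) \<omega> = QY_star N (obs_hist W A M (Suc T) (Suc T) \<omega>)"
  by (simp add: rA_last obs_hist_def)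

lemma obsRA_eq:
  "t \<le> T \<Longrightarrow> obsRA t \<omega> =
    (\<Sum>c\<in>UNIV. RM N t (W \<omega>) ((\<lambda>j. A j \<omega>)(t := c)) (\<lambda>j. M j \<omega>) * \<pi>_star N t (obs_hist W A M t t \<omega>) c)"
  by (simp add: RA_def obs_hist_def)

lemma obsW_eq:
  assumes "\<omega> \<in> space P"
  shows "obsW t \<omega> = indicator (agree a (Suc t)) \<omega> / prod_\<pi> (\<pi>_star N) (Suc t) (W \<omega>) a (\<lambda>j. M j \<omega>)"
proof (cases "\<omega> \<in> agree a (Suc t)")
  case True
  then have A: "A j \<omega> = a j" if "j < Suc t" for j using that by (auto simp: agree_def)
  then have "past k (\<lambda>j. A j \<omega>) = past k a" if "k < Suc t" for k
    using that by (intro past_cong) auto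
  then have "obsW t \<omega> = (\<Prod>k<Suc t. 1 / \<pi>_star N k (W \<omega>, past k a, past k (\<lambda>j. M j \<omega>)) (a k))"
    unfolding W_star_def by (intro prod.cong) (auto simp: A)
  also have "\<dots> = 1 / prod_\<pi> (\<pi>_star N) (Suc t) (W \<omega>) a (\<lambda>j. M j \<omega>)"
    unfolding prod_\<pi>_def by (simp add: prod_dividef del: prod.lessThan_Suc)
  finally show ?thesis using True by simp
next
  case False
  then obtain j where "j < Suc t" "A j \<omega> \<noteq> a j" using assms by (auto simp: agree_def)
  then have "obsW t \<omega> = 0" unfolding W_star_def by (intro prod_zero) auto
  then show ?thesis using False by simp
qed

lemma integrable_HY: "integrable P (\<lambda>\<omega>. obsH (Suc T) \<omega> * Y \<omega>)"
  using products unfolding products_integrable_def obsH_Suc by blast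

lemma integrable_W_QY_star:
  assumes "b \<in> bin_seqs (Suc T)"
  shows "integrable P (\<lambda>\<omega>. obsW T \<omega> * (prod_star (Suc T) b (obs_traj (Suc T) \<omega>) * rA (Suc T) b (obs_traj (Suc T) \<omega>)))"
proof -
  have "integrable P (\<lambda>\<omega>. obsW T \<omega> * (QY_star N (W \<omega>, b, past (Suc T) (\<lambda>j. M j \<omega>))
      * prod_\<pi> (\<pi>_star N) (Suc T) (W \<omega>) b (\<lambda>j. M j \<omega>)))"
    using products assms unfolding products_integrable_def by blast
  then show ?thesis
    using assms by (simp add: obs_traj_def rA_last past_bin_seqs mult_ac)
qed

lemma integrable_W_QM: "t \<le> T \<Longrightarrow> integrable P (\<lambda>\<omega>. obsW t \<omega> * obsQM t \<omega>)"
  using products unfolding products_integrable_def by blast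

lemma integrable_W_QM_Suc:
  assumes "t \<le> T"
  shows "integrable P (\<lambda>\<omega>. obsW t \<omega> * obsQM (Suc t) \<omega>)"
proof (cases "t = T")
  case True
  have "integrable P (\<lambda>\<omega>. \<Sum>b\<in>bin_seqs (Suc T). obsW T \<omega> *
      (prod_star (Suc T) b (obs_traj (Suc T) \<omega>) * rA (Suc T) b (obs_traj (Suc T) \<omega>)))"
    by (rule Bochner_Integration.integrable_sum) (rule integrable_W_QY_star)
  then show ?thesis
    by (simp only: True sum_distrib_left[symmetric] qm_last[symmetric] qm_obs[OF le_refl])
next
  case False
  then show ?thesis using assms products unfolding products_integrable_def by auto
qed

lemma integrable_H_RM: "t \<le> T \<Longrightarrow> integrable P (\<lambda>\<omega>. obsH t \<omega> * obsRM t \<omega>)"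
  using products unfolding products_integrable_def by blast

lemma integrable_H_RA:
  assumes "t \<le> Suc T"
  shows "integrable P (\<lambda>\<omega>. obsH t \<omega> * obsRA t \<omega>)"
proof (cases "t = Suc T")
  case True
  then show ?thesis
    using products unfolding products_integrable_def obsRA_last obsH_Suc
    by (simp add: obsH_Suc obsRA_last)
next
  case False
  then have t: "t \<le> T" using assms by simp
  have "integrable P (\<lambda>\<omega>. \<Sum>c\<in>UNIV. obsH t \<omega> * (RM N t (W \<omega>) ((\<lambda>j. A j \<omega>)(t := c)) (\<lambda>j. M j \<omega>)
      * \<pi>_star N t (obs_hist W A M t t \<omega>) c))"
    using products t unfolding products_integrable_def by (intro Bochner_Integration.integrable_sum) blast
  then show ?thesis
    by (simp only: obsRA_eq[OF t] sum_distrib_left[symmetric])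
qed

text \<open>The terms outside the sums are kept as \<open>obsRA (Suc T)\<close> and
  \<open>obsQM 0\<close>, the endpoints against which the two sums later cancel.\<close>

lemma integral_D_star:
  "(\<integral>\<omega>. D_star T N a \<psi> (W \<omega>) (\<lambda>j. A j \<omega>) (\<lambda>j. M j \<omega>) (Y \<omega>) \<partial>P) =
    (\<integral>\<omega>. obsH (Suc T) \<omega> * Y \<omega> \<partial>P) - (\<integral>\<omega>. obsH (Suc T) \<omega> * obsRA (Suc T) \<omega> \<partial>P)
    + (\<Sum>t\<le>T. (\<integral>\<omega>. obsW t \<omega> * obsQM (Suc t) \<omega> \<partial>P) - (\<integral>\<omega>. obsW t \<omega> * obsQM t \<omega> \<partial>P))
    + (\<Sum>t\<le>T. (\<integral>\<omega>. obsH t \<omega> * obsRM t \<omega> \<partial>P) - (\<integral>\<omega>. obsH t \<omega> * obsRA t \<omega> \<partial>P))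
    + (\<integral>\<omega>. obsQM 0 \<omega> \<partial>P) - \<psi>"
proof -
  have Q0: "integrable P (\<lambda>\<omega>. obsQM 0 \<omega>)"
    using products unfolding products_integrable_def by blast
  have D: "D_star T N a \<psi> (W \<omega>) (\<lambda>j. A j \<omega>) (\<lambda>j. M j \<omega>) (Y \<omega>) =
      obsH (Suc T) \<omega> * Y \<omega> - obsH (Suc T) \<omega> * obsRA (Suc T) \<omega>
      + (\<Sum>t\<le>T. obsW t \<omega> * obsQM (Suc t) \<omega> - obsW t \<omega> * obsQM t \<omega>)
      + (\<Sum>t\<le>T. obsH t \<omega> * obsRM t \<omega> - obsH t \<omega> * obsRA t \<omega>) + obsQM 0 \<omega> - \<psi>" for \<omega>
    unfolding D_star_def right_diff_distrib
    by (simp add: H_prev_def[of _ "Suc T"] rA_last)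
  have 1: "integrable P (\<lambda>\<omega>. obsH (Suc T) \<omega> * Y \<omega> - obsH (Suc T) \<omega> * obsRA (Suc T) \<omega>)"
    by (intro Bochner_Integration.integrable_diff integrable_HY integrable_H_RA) simp
  have 2: "integrable P (\<lambda>\<omega>. \<Sum>t\<le>T. obsW t \<omega> * obsQM (Suc t) \<omega> - obsW t \<omega> * obsQM t \<omega>)"
    by (intro Bochner_Integration.integrable_sum Bochner_Integration.integrable_diff
        integrable_W_QM_Suc integrable_W_QM) auto
  have 3: "integrable P (\<lambda>\<omega>. \<Sum>t\<le>T. obsH t \<omega> * obsRM t \<omega> - obsH t \<omega> * obsRA t \<omega>)"
    by (intro Bochner_Integration.integrable_sum Bochner_Integration.integrable_diff
        integrable_H_RM integrable_H_RA) auto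
  have W_sum: "(\<integral>\<omega>. (\<Sum>t\<le>T. obsW t \<omega> * obsQM (Suc t) \<omega> - obsW t \<omega> * obsQM t \<omega>) \<partial>P)
      = (\<Sum>t\<le>T. (\<integral>\<omega>. obsW t \<omega> * obsQM (Suc t) \<omega> \<partial>P) - (\<integral>\<omega>. obsW t \<omega> * obsQM t \<omega> \<partial>P))"
    by (subst Bochner_Integration.integral_sum)
       (auto intro!: sum.cong Bochner_Integration.integral_diff Bochner_Integration.integrable_diff
         integrable_W_QM_Suc integrable_W_QM)
  have R_sum: "(\<integral>\<omega>. (\<Sum>t\<le>T. obsH t \<omega> * obsRM t \<omega> - obsH t \<omega> * obsRA t \<omega>) \<partial>P)
      = (\<Sum>t\<le>T. (\<integral>\<omega>. obsH t \<omega> * obsRM t \<omega> \<partial>P) - (\<integral>\<omega>. obsH t \<omega> * obsRA t \<omega> \<partial>P))"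
    by (subst Bochner_Integration.integral_sum)
       (auto intro!: sum.cong Bochner_Integration.integral_diff Bochner_Integration.integrable_diff
         integrable_H_RM integrable_H_RA)
  show ?thesis
    unfolding D using 1 2 3 Q0 integrable_HY integrable_H_RA[OF le_refl]
    by (simp add: W_sum R_sum prob_space)
qed

text \<open>The baseline variable has density \<open>p\<close> under both laws; formally this is the
  change of measure with no treatments and weight one.\<close>

lemma integral_QM_0: "(\<integral>\<omega>. obsQM 0 \<omega> \<partial>P) = E_target (qm 0)"
proof -
  have "(\<integral>\<omega>. indicator (agree a 0) \<omega> * (1 / prod_\<pi> \<pi> 0 (W \<omega>) a (\<lambda>j. M j \<omega>) * qm 0 (obs_traj 0 \<omega>)) \<partial>P)
      = E_target (\<lambda>z. qm 0 (past_traj 0 z))"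
    by (rule treatment_weight(2)) (auto intro: qm_measurable)
  moreover have "(\<integral>\<omega>. indicator (agree a 0) \<omega> * (1 / prod_\<pi> \<pi> 0 (W \<omega>) a (\<lambda>j. M j \<omega>) * qm 0 (obs_traj 0 \<omega>)) \<partial>P)
      = (\<integral>\<omega>. obsQM 0 \<omega> \<partial>P)"
    by (rule Bochner_Integration.integral_cong) (auto simp: agree_def qm_obs indicator_def)
  ultimately show ?thesis by (simp add: qm_past)
qed

text \<open>The upper bound makes the candidate weight at least one on the event of following
  \<open>a\<close>, so that it can dominate a bounded weight.\<close>

lemma prod_star_bounds:
  assumes "\<omega> \<in> space P" "\<omega> \<in> agree a (Suc T)"
    and "\<And>t. t \<le> T \<Longrightarrow> 0 < \<pi>_star N t (obs_hist W A M t t \<omega>) (a t)"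
  shows "0 < prod_star (Suc T) a (obs_traj (Suc T) \<omega>)" "prod_star (Suc T) a (obs_traj (Suc T) \<omega>) \<le> 1"
proof -
  have f: "0 < \<pi>_star N t (W \<omega>, past t a, past t (\<lambda>j. M j \<omega>)) (a t) \<and>
      \<pi>_star N t (W \<omega>, past t a, past t (\<lambda>j. M j \<omega>)) (a t) \<le> 1" if t: "t < Suc T" for t
  proof -
    have "past t (\<lambda>j. A j \<omega>) = past t a"
      using assms(2) t by (intro past_cong) (auto simp: agree_def)
    then have o: "obs_hist W A M t t \<omega> = (W \<omega>, past t a, past t (\<lambda>j. M j \<omega>))"
      by (simp add: obs_hist_def)
    have h: "obs_hist W A M t t \<omega> \<in> space (hist_space \<mu>W \<mu>M t t)"
      by (rule measurable_space[OF obs_hist_measurable assms(1)]) (use t in auto)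
    have "\<pi>_star N t (obs_hist W A M t t \<omega>) (a t) \<le> (\<Sum>c\<in>UNIV. \<pi>_star N t (obs_hist W A M t t \<omega>) c)"
      by (rule member_le_sum) (use t h \<pi>_star_nonneg in auto)
    then show ?thesis using assms(3)[of t] t \<pi>_star_sum[OF _ h] unfolding o by simp
  qed
  show "0 < prod_star (Suc T) a (obs_traj (Suc T) \<omega>)"
    unfolding prod_\<pi>_def by (rule prod_pos) (use f in \<open>auto simp: obs_traj_def\<close>)
  show "prod_star (Suc T) a (obs_traj (Suc T) \<omega>) \<le> 1"
    unfolding prod_\<pi>_def by (rule prod_le_1) (use f in \<open>auto simp: obs_traj_def less_imp_le\<close>)
qed

text \<open>
  On the event that the treatments follow \<open>a\<close> the true inverse probability weight is bounded
  by \<open>1 / \<delta>\<close>, hence by \<open>1 / \<delta>\<close> times the candidate weight.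
\<close>

lemma integrable_star_target:
  assumes b: "b \<in> bin_seqs (Suc T)"
  shows "integrable (target_law (Suc T)) (\<lambda>z. prod_star (Suc T) b z * rA (Suc T) b z)"
proof -
  define \<phi> where "\<phi> z = prod_star (Suc T) b z * rA (Suc T) b z" for z
  have phi [measurable]: "\<phi> \<in> borel_measurable (traj (Suc T))"
    unfolding \<phi>_def[abs_def]
    by (intro borel_measurable_times prod_star_measurable rA_measurable) auto
  have n: "Suc T \<le> Suc T" "Suc T = Suc T \<or> Suc T = Suc (Suc T)" "Suc T \<le> Suc T" by auto
  obtain \<delta> where \<delta>: "0 < \<delta>"
    and AE: "AE \<omega> in P. \<omega> \<in> agree a (Suc T) \<longrightarrow> \<delta> \<le> prod_\<pi> \<pi> (Suc T) (W \<omega>) a (\<lambda>j. M j \<omega>)"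
    by (rule AE_treated_pos)
  have "AE \<omega> in P. \<forall>t\<in>{..T}. \<omega> \<in> treated_event P A a t \<longrightarrow> 0 < \<pi>_star N t (obs_hist W A M t t \<omega>) (a t)"
    by (rule AE_finite_allI) (use \<pi>_star_pos in auto)
  then have pos: "AE \<omega> in P. \<omega> \<in> agree a (Suc T) \<longrightarrow> (\<forall>t\<le>T. 0 < \<pi>_star N t (obs_hist W A M t t \<omega>) (a t))"
    by eventually_elim (auto simp: treated_event_def agree_def)
  have [measurable]: "agree a (Suc T) \<in> sets P" by (rule agree_measurable) simp
  have [measurable]: "obs_traj (Suc T) \<in> measurable P (traj (Suc T))" by (rule obs_traj_measurable) simp
  have [measurable]: "(\<lambda>z. prod_\<pi> \<pi> (Suc T) (fst z) a (snd z)) \<in> borel_measurable (traj (Suc T))"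
    by (rule prod_\<pi>_true_measurable) auto
  have e: "prod_\<pi> \<pi> (Suc T) (W \<omega>) a (\<lambda>j. M j \<omega>)
      = prod_\<pi> \<pi> (Suc T) (fst (obs_traj (Suc T) \<omega>)) a (snd (obs_traj (Suc T) \<omega>))" for \<omega>
    by (simp add: obs_traj_def)
  have "integrable P (\<lambda>\<omega>. indicator (agree a (Suc T)) \<omega> *
      (1 / prod_\<pi> \<pi> (Suc T) (W \<omega>) a (\<lambda>j. M j \<omega>) * \<phi> (obs_traj (Suc T) \<omega>)))"
  proof (rule Bochner_Integration.integrable_bound)
    show "integrable P (\<lambda>\<omega>. (1 / \<delta>) * (obsW T \<omega> * \<phi> (obs_traj (Suc T) \<omega>)))"
      unfolding \<phi>_def by (intro integrable_mult_right integrable_W_QY_star b)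
    show "(\<lambda>\<omega>. indicator (agree a (Suc T)) \<omega> *
      (1 / prod_\<pi> \<pi> (Suc T) (W \<omega>) a (\<lambda>j. M j \<omega>) * \<phi> (obs_traj (Suc T) \<omega>))) \<in> borel_measurable P"
      unfolding e by measurable
    show "AE \<omega> in P. norm (indicator (agree a (Suc T)) \<omega> *
      (1 / prod_\<pi> \<pi> (Suc T) (W \<omega>) a (\<lambda>j. M j \<omega>) * \<phi> (obs_traj (Suc T) \<omega>)))
      \<le> norm ((1 / \<delta>) * (obsW T \<omega> * \<phi> (obs_traj (Suc T) \<omega>)))"
      using AE pos AE_space
    proof eventually_elim
      case (elim \<omega>)
      show ?case
      proof (cases "\<omega> \<in> agree a (Suc T)")
        case True
        define u where "u = prod_\<pi> \<pi> (Suc T) (W \<omega>) a (\<lambda>j. M j \<omega>)"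
        define v where "v = prod_\<pi> (\<pi>_star N) (Suc T) (W \<omega>) a (\<lambda>j. M j \<omega>)"
        have u: "\<delta> \<le> u" using elim True by (simp add: u_def)
        have v: "0 < v" "v \<le> 1"
          using prod_star_bounds[OF elim(3) True] elim True by (auto simp: v_def obs_traj_def)
        have "1 / u \<le> 1 / \<delta>" using u \<delta> by (intro divide_left_mono mult_pos_pos) auto
        also have "\<dots> \<le> 1 / \<delta> * (1 / v)" using \<delta> v by (simp add: field_simps)
        finally have "1 / u * \<bar>\<phi> (obs_traj (Suc T) \<omega>)\<bar> \<le> 1 / \<delta> * (1 / v) * \<bar>\<phi> (obs_traj (Suc T) \<omega>)\<bar>"
          by (rule mult_right_mono) simp
        then show ?thesis
          using True u v \<delta>
          by (simp add: obsW_eq[OF elim(3)] u_def[symmetric] v_def[symmetric] abs_mult)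
      qed simp
    qed
  qed
  from this[unfolded treatment_weight(1)[OF n phi]]
  show ?thesis by (simp add: \<phi>_def qm_past rA_past rA_last)
qed

lemma E_target_qm_last:
  "E_target (qm (Suc T)) = (\<Sum>b\<in>bin_seqs (Suc T). E_target (\<lambda>z. prod_star (Suc T) b z * rA (Suc T) b z))"
  unfolding qm_last
  by (rule Bochner_Integration.integral_sum) (rule integrable_star_target)

lemma integrable_qm_last: "integrable (target_law (Suc T)) (qm (Suc T))"
  unfolding qm_last
  by (rule Bochner_Integration.integrable_sum) (rule integrable_star_target)

text \<open>Measurability of density products is available for fixed treatments only. The observed
  sequence takes finitely many values, so the weight is a finite sum of indicators times measurable
  ratios; \<open>obsRA_measurable\<close> follows the same pattern.\<close>

lemma measurable_mweight:
  assumes n: "n \<le> Suc T"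
  shows "mweight n \<in> borel_measurable P"
proof -
  have "(\<lambda>\<omega>. indicator (agree b n) \<omega> * (prod_g g n (fst (obs_traj n \<omega>)) a (snd (obs_traj n \<omega>))
      / prod_g g n (fst (obs_traj n \<omega>)) b (snd (obs_traj n \<omega>)))) \<in> borel_measurable P" for b
    using measurable_compose[OF obs_traj_measurable[OF n] prod_g_measurable[OF le_refl n]] agree_measurable[OF n]
    by (intro borel_measurable_times borel_measurable_divide borel_measurable_indicator)
  then have "(\<lambda>\<omega>. \<Sum>b\<in>bin_seqs n. indicator (agree b n) \<omega> * (prod_g g n (W \<omega>) a (\<lambda>j. M j \<omega>)
      / prod_g g n (W \<omega>) b (\<lambda>j. M j \<omega>))) \<in> borel_measurable P"
    by (intro borel_measurable_sum) (simp add: obs_traj_def)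
  moreover have "(\<Sum>b\<in>bin_seqs n. indicator (agree b n) \<omega> * (prod_g g n (W \<omega>) a (\<lambda>j. M j \<omega>)
      / prod_g g n (W \<omega>) b (\<lambda>j. M j \<omega>))) = mweight n \<omega>" if "\<omega> \<in> space P" for \<omega>
  proof -
    have "indicator (agree b n) \<omega> * (prod_g g n (W \<omega>) a (\<lambda>j. M j \<omega>) / prod_g g n (W \<omega>) b (\<lambda>j. M j \<omega>))
        = indicator (agree b n) \<omega> * mweight n \<omega>" for b
    proof (cases "\<omega> \<in> agree b n")
      case True
      then have "prod_g g n (W \<omega>) (\<lambda>j. A j \<omega>) (\<lambda>j. M j \<omega>) = prod_g g n (W \<omega>) b (\<lambda>j. M j \<omega>)"
        by (intro prod_g_cong) (auto simp: agree_def)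
      then show ?thesis by (simp add: mweight_def)
    qed simp
    then show ?thesis by (simp only: indicator_agree_sum[OF that])
  qed
  ultimately show ?thesis by (simp cong: measurable_cong)
qed

lemma obsRM_measurable:
  assumes t: "t \<le> T" shows "(\<lambda>\<omega>. obsRM t \<omega>) \<in> borel_measurable P"
  using measurable_compose[OF obs_hist_measurable RM_star_measurable[OF t]] t
  by (simp add: obs_hist_def RM_def)

lemma obsRA_measurable:
  assumes t: "t \<le> Suc T" shows "(\<lambda>\<omega>. obsRA t \<omega>) \<in> borel_measurable P"
proof -
  have "(\<lambda>\<omega>. \<Sum>b\<in>bin_seqs t. indicator (agree b t) \<omega> * rA t b (obs_traj t \<omega>)) \<in> borel_measurable P"
    using measurable_compose[OF obs_traj_measurable[OF t] rA_measurable[OF t]] agree_measurable[OF t]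
    by (intro borel_measurable_sum borel_measurable_times borel_measurable_indicator)
  moreover have "(\<Sum>b\<in>bin_seqs t. indicator (agree b t) \<omega> * rA t b (obs_traj t \<omega>)) = obsRA t \<omega>"
    if "\<omega> \<in> space P" for \<omega>
  proof -
    have "indicator (agree b t) \<omega> * rA t b (obs_traj t \<omega>) = indicator (agree b t) \<omega> * obsRA t \<omega>" for b
    proof (cases "\<omega> \<in> agree b t")
      case True
      then have "past t (\<lambda>j. A j \<omega>) = past t b" by (intro past_cong) (auto simp: agree_def)
      then show ?thesis
        using rA_past[OF t, of "W \<omega>" b "\<lambda>j. M j \<omega>"] rA_past[OF t, of "W \<omega>" "\<lambda>j. A j \<omega>" "\<lambda>j. M j \<omega>"]
          rA_past[OF t, of "W \<omega>" b "past t (\<lambda>j. M j \<omega>)"]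
        by (simp add: obs_traj_def)
    qed simp
    then show ?thesis by (simp only: indicator_agree_sum[OF that])
  qed
  ultimately show ?thesis by (simp cong: measurable_cong)
qed

lemma target_law_measurableI:
  "f \<in> borel_measurable (traj (Suc T)) \<Longrightarrow> f \<in> borel_measurable (target_law (Suc T))"
  by (simp cong: measurable_cong_sets)

section \<open>Consequences of correct treatment probabilities\<close>

context
  assumes \<pi>_correct: "\<forall>t\<le>T. \<forall>c.
    AE \<omega> in P. \<pi>_star N t (obs_hist W A M t t \<omega>) c = \<pi> t (obs_hist W A M t t \<omega>) c"
begin

text \<open>\<open>obsRA t\<close> averages the \<open>RM\<close> function over treatment
  \<open>t\<close> with its correct conditional probabilities, and the weight \<open>obsH t\<close>
  involves only the history before that treatment. So the difference has conditional mean zero, for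
  an arbitrary \<open>RM_star\<close>.\<close>

lemma integral_H_RM_eq_H_RA:
  assumes t: "t \<le> T"
  shows "(\<integral>\<omega>. obsH t \<omega> * obsRM t \<omega> \<partial>P) = (\<integral>\<omega>. obsH t \<omega> * obsRA t \<omega> \<partial>P)"
proof -
  let ?o = "obs_hist W A M t t"
  define R where "R c \<omega> = RM N t (W \<omega>) ((\<lambda>j. A j \<omega>)(t := c)) (\<lambda>j. M j \<omega>)" for c \<omega>
  have [measurable]: "A t \<in> measurable P (count_space UNIV)" using t by (rule A_measurable)
  \<comment> \<open>Writing the candidate value \<open>c\<close> into the history makes weight times
    regression a function of the history before treatment \<open>t\<close>. The integral is then
    split over \<open>c\<close>, because integrability is given for each \<open>c\<close>
    separately.\<close>
  define f where "f c h = (if t = 0 then 1 else H_star N (t - 1) h) *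
      RM_star N t (fst h, (fst (snd h))(t := c), snd (snd h))" for c h
  have fo: "obsH t \<omega> * R c \<omega> = f c (?o \<omega>)" for c \<omega>
    by (simp add: f_def R_def H_prev_def RM_def obs_hist_def past_Suc_upd)
  have fm: "f c \<in> borel_measurable (hist_space \<mu>W \<mu>M t t)" for c
  proof -
    have "(\<lambda>h. (fst (snd h))(t := c)) \<in> measurable (hist_space \<mu>W \<mu>M t t) (PiM {..<Suc t} (\<lambda>_. count_space UNIV))"
      unfolding hist_space_def by (rule measurable_fun_upd[where J = "{..<t}"]) auto
    then have "(\<lambda>h. (fst h, (fst (snd h))(t := c), snd (snd h))) \<in> measurable (hist_space \<mu>W \<mu>M t t) (hist_space \<mu>W \<mu>M (Suc t) t)"
      unfolding hist_space_def by measurable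
    from measurable_compose[OF this RM_star_measurable[OF t]]
    have "(\<lambda>h. RM_star N t (fst h, (fst (snd h))(t := c), snd (snd h))) \<in> borel_measurable (hist_space \<mu>W \<mu>M t t)" .
    moreover have "(\<lambda>h. if t = 0 then 1 else H_star N (t - 1) h) \<in> borel_measurable (hist_space \<mu>W \<mu>M t t)"
      using t H_star_measurable[of "t - 1"] by (cases "t = 0") auto
    ultimately show ?thesis unfolding f_def[abs_def] by (intro borel_measurable_times) auto
  qed
  have eq: "obsH t \<omega> * obsRM t \<omega> * of_bool (A t \<omega> = c) = f c (?o \<omega>) * of_bool (A t \<omega> = c)" for c \<omega>
  proof (cases "A t \<omega> = c")
    case True
    then have "(\<lambda>j. A j \<omega>)(t := c) = (\<lambda>j. A j \<omega>)" by auto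
    then show ?thesis by (simp add: fo[symmetric] R_def)
  qed simp
  have int: "integrable P (\<lambda>\<omega>. f c (?o \<omega>) * of_bool (A t \<omega> = c))" for c
  proof -
    have "{\<omega> \<in> space P. A t \<omega> = c} \<in> sets P" by measurable
    from integrable_mult_indicator[OF this integrable_H_RM[OF t]]
    have "integrable P (\<lambda>\<omega>. obsH t \<omega> * obsRM t \<omega> * of_bool (A t \<omega> = c))"
      by (rule Bochner_Integration.integrable_cong[THEN iffD1, OF refl, rotated])
         (auto simp: indicator_def)
    then show ?thesis by (simp only: eq)
  qed
  have int': "integrable P (\<lambda>\<omega>. f c (?o \<omega>) * \<pi>_star N t (?o \<omega>) c)" for c
  proof -
    have "integrable P (\<lambda>\<omega>. obsH t \<omega> * (R c \<omega> * \<pi>_star N t (?o \<omega>) c))"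
      using products t unfolding products_integrable_def R_def by blast
    then show ?thesis by (simp only: fo[symmetric] mult.assoc)
  qed
  have "(\<integral>\<omega>. obsH t \<omega> * obsRM t \<omega> \<partial>P) = (\<integral>\<omega>. (\<Sum>c\<in>UNIV. f c (?o \<omega>) * of_bool (A t \<omega> = c)) \<partial>P)"
    by (rule Bochner_Integration.integral_cong) (auto simp: eq[symmetric] UNIV_bool)
  also have "\<dots> = (\<Sum>c\<in>UNIV. \<integral>\<omega>. f c (?o \<omega>) * of_bool (A t \<omega> = c) \<partial>P)"
    by (rule Bochner_Integration.integral_sum) (rule int)
  also have "\<dots> = (\<Sum>c\<in>UNIV. \<integral>\<omega>. f c (?o \<omega>) * \<pi> t (?o \<omega>) c \<partial>P)"
    by (rule sum.cong[OF refl]) (rule integral_treatment[OF t fm int, symmetric])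
  also have "\<dots> = (\<Sum>c\<in>UNIV. \<integral>\<omega>. f c (?o \<omega>) * \<pi>_star N t (?o \<omega>) c \<partial>P)"
  proof (rule sum.cong[OF refl], rule integral_cong_AE)
    fix c
    have o: "?o \<in> measurable P (hist_space \<mu>W \<mu>M t t)" by (rule obs_hist_measurable) (use t in auto)
    show "(\<lambda>\<omega>. f c (?o \<omega>) * \<pi> t (?o \<omega>) c) \<in> borel_measurable P"
      "(\<lambda>\<omega>. f c (?o \<omega>) * \<pi>_star N t (?o \<omega>) c) \<in> borel_measurable P"
      by (intro borel_measurable_times measurable_compose[OF o fm]
          measurable_compose[OF o \<pi>_measurable[OF t]] measurable_compose[OF o \<pi>_star_measurable[OF t]])+
    show "AE \<omega> in P. f c (?o \<omega>) * \<pi> t (?o \<omega>) c = f c (?o \<omega>) * \<pi>_star N t (?o \<omega>) c"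
      using \<pi>_correct[rule_format, OF t, of c] by eventually_elim simp
  qed
  also have "\<dots> = (\<integral>\<omega>. (\<Sum>c\<in>UNIV. f c (?o \<omega>) * \<pi>_star N t (?o \<omega>) c) \<partial>P)"
    by (rule Bochner_Integration.integral_sum[symmetric]) (rule int')
  also have "\<dots> = (\<integral>\<omega>. obsH t \<omega> * obsRA t \<omega> \<partial>P)"
    by (rule Bochner_Integration.integral_cong)
       (simp_all only: obsRA_eq[OF t] fo[symmetric] R_def sum_distrib_left mult.assoc)
  finally show ?thesis .
qed

text \<open>On the event of following \<open>a\<close> the candidate weight is the true inverse
  probability weight. The result depends on \<open>s\<close> only, so neighbouring summands share an
  expectation and the sum telescopes for arbitrary \<open>QM_star\<close>.\<close>

lemma integral_W_target:
  assumes t: "t \<le> T" and s: "s = t \<or> s = Suc t"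
  shows "(\<integral>\<omega>. obsW t \<omega> * obsQM s \<omega> \<partial>P) = E_target (qm s)"
proof -
  have n: "s \<le> Suc T" "Suc t = s \<or> Suc t = Suc s" "Suc t \<le> Suc T" using t s by auto
  note qmm = qm_measurable[OF n(1)]
  have AE: "AE \<omega> in P. \<forall>k\<in>{..t}. \<pi>_star N k (obs_hist W A M k k \<omega>) (a k) = \<pi> k (obs_hist W A M k k \<omega>) (a k)"
    by (rule AE_finite_allI) (use \<pi>_correct t in auto)
  have meas: "(\<lambda>\<omega>. indicator (agree a (Suc t)) \<omega> * (1 / prod_\<pi> \<pi> (Suc t) (W \<omega>) a (\<lambda>j. M j \<omega>) * qm s (obs_traj s \<omega>)))
      \<in> borel_measurable P"
  proof -
    have "(\<lambda>\<omega>. prod_\<pi> \<pi> (Suc t) (fst (obs_traj t \<omega>)) a (snd (obs_traj t \<omega>))) \<in> borel_measurable P"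
      by (rule measurable_compose[OF obs_traj_measurable prod_\<pi>_true_measurable]) (use t in auto)
    then have "(\<lambda>\<omega>. prod_\<pi> \<pi> (Suc t) (W \<omega>) a (\<lambda>j. M j \<omega>)) \<in> borel_measurable P"
      by (simp add: obs_traj_def)
    then show ?thesis
      using measurable_compose[OF obs_traj_measurable[OF n(1)] qmm] agree_measurable[OF n(3)]
      by (intro borel_measurable_times borel_measurable_divide borel_measurable_const borel_measurable_indicator)
  qed
  have "(\<integral>\<omega>. obsW t \<omega> * obsQM s \<omega> \<partial>P) =
    (\<integral>\<omega>. indicator (agree a (Suc t)) \<omega> * (1 / prod_\<pi> \<pi> (Suc t) (W \<omega>) a (\<lambda>j. M j \<omega>) * qm s (obs_traj s \<omega>)) \<partial>P)"
  proof (rule integral_cong_AE)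
    show "(\<lambda>\<omega>. obsW t \<omega> * obsQM s \<omega>) \<in> borel_measurable P"
      using integrable_W_QM[OF t] integrable_W_QM_Suc[OF t] s by auto
    show "AE \<omega> in P. obsW t \<omega> * obsQM s \<omega> =
      indicator (agree a (Suc t)) \<omega> * (1 / prod_\<pi> \<pi> (Suc t) (W \<omega>) a (\<lambda>j. M j \<omega>) * qm s (obs_traj s \<omega>))"
      using AE AE_space
    proof eventually_elim
      case (elim \<omega>)
      show ?case
      proof (cases "\<omega> \<in> agree a (Suc t)")
        case True
        have "prod_\<pi> (\<pi>_star N) (Suc t) (W \<omega>) a (\<lambda>j. M j \<omega>) = prod_\<pi> \<pi> (Suc t) (W \<omega>) a (\<lambda>j. M j \<omega>)"
          unfolding prod_\<pi>_def
        proof (rule prod.cong[OF refl])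
          fix k assume k: "k \<in> {..<Suc t}"
          have "past k (\<lambda>j. A j \<omega>) = past k a"
            using True k by (intro past_cong) (auto simp: agree_def)
          then have "obs_hist W A M k k \<omega> = (W \<omega>, past k a, past k (\<lambda>j. M j \<omega>))"
            by (simp add: obs_hist_def)
          then show "\<pi>_star N k (W \<omega>, past k a, past k (\<lambda>j. M j \<omega>)) (a k) = \<pi> k (W \<omega>, past k a, past k (\<lambda>j. M j \<omega>)) (a k)"
            using bspec[OF elim(1), of k] k by simp
        qed
        then show ?thesis using elim n by (simp add: obsW_eq qm_obs)
      qed (use elim n in \<open>simp add: obsW_eq\<close>)
    qed
  qed (rule meas)
  also have "\<dots> = E_target (\<lambda>z. qm s (past_traj s z))"
    by (rule treatment_weight(2)[OF n qmm])
  finally show ?thesis using n by (simp add: qm_past)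
qed

text \<open>By induction, the new factors agree where the true product so far is positive, which is
  all that observed histories reveal. Where it is zero, the candidate product is zero too by the
  induction hypothesis, and the new factors are irrelevant.\<close>

lemma prod_star_eq_target:
  "n \<le> Suc T \<Longrightarrow> AE z in target_law (Suc T). prod_star n b z = prod_\<pi> \<pi> n (fst z) b (snd z)"
proof (induction n)
  case (Suc n)
  then have n: "n \<le> T" by simp
  have meas: "{h \<in> space (hist_space \<mu>W \<mu>M n n). \<pi>_star N n h (b n) = \<pi> n h (b n)} \<in> sets (hist_space \<mu>W \<mu>M n n)"
    using \<pi>_star_measurable[OF n, of "b n"] \<pi>_measurable[OF n, of "b n"] by measurable
  have "AE z in target_law (Suc T). 0 < prod_\<pi> \<pi> n (fst z) b (snd z) \<longrightarrow>
      \<pi>_star N n (fst z, past n b, past n (snd z)) (b n) = \<pi> n (fst z, past n b, past n (snd z)) (b n)"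
    by (rule AE_obs_to_target[OF _ \<pi>_correct[rule_format, OF n] meas]) (use n in auto)
  moreover have "AE z in target_law (Suc T). prod_star n b z = prod_\<pi> \<pi> n (fst z) b (snd z)"
    using Suc by simp
  ultimately show ?case using AE_space
  proof eventually_elim
    case (elim z)
    have "0 \<le> prod_\<pi> \<pi> n (fst z) b (snd z)"
      using elim(3) n by (intro prod_\<pi>_true_nonneg[of _ "Suc T"]) auto
    then show ?case
      using elim by (cases "prod_\<pi> \<pi> n (fst z) b (snd z) = 0") (auto simp: prod_\<pi>_Suc)
  qed
qed simp

lemma E_target_qm_last':
  "E_target (qm (Suc T)) =
    (\<Sum>b\<in>bin_seqs (Suc T). E_target (\<lambda>z. prod_\<pi> \<pi> (Suc T) (fst z) b (snd z) * rA (Suc T) b z))"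
  unfolding E_target_qm_last
proof (rule sum.cong[OF refl], rule integral_cong_AE)
  fix b
  show "(\<lambda>z. prod_star (Suc T) b z * rA (Suc T) b z) \<in> borel_measurable (target_law (Suc T))"
    "(\<lambda>z. prod_\<pi> \<pi> (Suc T) (fst z) b (snd z) * rA (Suc T) b z) \<in> borel_measurable (target_law (Suc T))"
    by (intro target_law_measurableI borel_measurable_times prod_star_measurable
        prod_\<pi>_true_measurable rA_measurable; simp)+
  show "AE z in target_law (Suc T). prod_star (Suc T) b z * rA (Suc T) b z =
      prod_\<pi> \<pi> (Suc T) (fst z) b (snd z) * rA (Suc T) b z"
    using prod_star_eq_target[OF le_refl, of b] by eventually_elim simp
qed

lemma integral_D_star_treatment:
  "(\<integral>\<omega>. D_star T N a \<psi> (W \<omega>) (\<lambda>j. A j \<omega>) (\<lambda>j. M j \<omega>) (Y \<omega>) \<partial>P) =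
    (\<integral>\<omega>. obsH (Suc T) \<omega> * Y \<omega> \<partial>P) - (\<integral>\<omega>. obsH (Suc T) \<omega> * obsRA (Suc T) \<omega> \<partial>P)
    + E_target (qm (Suc T)) - \<psi>"
proof -
  have "(\<Sum>t\<le>T. (\<integral>\<omega>. obsW t \<omega> * obsQM (Suc t) \<omega> \<partial>P) - (\<integral>\<omega>. obsW t \<omega> * obsQM t \<omega> \<partial>P))
      = (\<Sum>t<Suc T. E_target (qm (Suc t)) - E_target (qm t))"
    by (rule sum.cong) (auto simp: integral_W_target)
  also have "\<dots> = E_target (qm (Suc T)) - E_target (qm 0)"
    by (rule sum_lessThan_telescope)
  finally show ?thesis
    unfolding integral_D_star by (simp add: integral_QM_0 integral_H_RM_eq_H_RA)
qed

end

end

section \<open>Multiple robustness\<close>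

context candidate_setting
begin

text \<open>The outcome is first replaced by its regression, since the change of measure handles
  only functions of treatments and trajectory; the sum over observed treatment sequences then
  becomes the inner sum of the functional.\<close>

lemma integral_H_Y:
  assumes H: "AE \<omega> in P. H_star N T (obs_hist W A M (Suc T) (Suc T) \<omega>) =
      H_true g a T (obs_hist W A M (Suc T) (Suc T) \<omega>)"
  shows "(\<integral>\<omega>. obsH (Suc T) \<omega> * Y \<omega> \<partial>P) = front_door T \<mu>W \<mu>M p \<pi> g QY a"
proof -
  let ?o = "obs_hist W A M (Suc T) (Suc T)"
  have HQ: "integrable P (\<lambda>\<omega>. obsH (Suc T) \<omega> * QY (?o \<omega>))"
    "(\<integral>\<omega>. obsH (Suc T) \<omega> * QY (?o \<omega>) \<partial>P) = (\<integral>\<omega>. obsH (Suc T) \<omega> * Y \<omega> \<partial>P)"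
    using integral_outcome[OF H_star_measurable[OF le_refl]] integrable_HY by (simp_all add: obsH_Suc)
  define \<phi> where "\<phi> b z = QY (fst z, past (Suc T) b, past (Suc T) (snd z))"
    for b and z :: "(real^'d) \<times> (nat \<Rightarrow> real^'p)"
  have phi: "\<phi> b \<in> borel_measurable (traj (Suc T))" for b
    unfolding \<phi>_def[abs_def] by (rule measurable_compose[OF traj_hist_measurable QY_measurable]) simp
  have phi_obs: "\<phi> (past (Suc T) (\<lambda>j. A j \<omega>)) (obs_traj (Suc T) \<omega>) = QY (?o \<omega>)" for \<omega>
    by (simp add: \<phi>_def obs_traj_def obs_hist_def)
  have mw: "mweight (Suc T) \<in> borel_measurable P"
    using measurable_mweight by simp
  have QYo: "(\<lambda>\<omega>. QY (?o \<omega>)) \<in> borel_measurable P"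
    by (rule measurable_compose[OF obs_hist_measurable QY_measurable]) auto
  have eq: "AE \<omega> in P. obsH (Suc T) \<omega> * QY (?o \<omega>) =
      mweight (Suc T) \<omega> * \<phi> (past (Suc T) (\<lambda>j. A j \<omega>)) (obs_traj (Suc T) \<omega>)"
    using H by eventually_elim (simp add: obsH_Suc H_true_obs phi_obs)
  have mm: "(\<lambda>\<omega>. mweight (Suc T) \<omega> * \<phi> (past (Suc T) (\<lambda>j. A j \<omega>)) (obs_traj (Suc T) \<omega>)) \<in> borel_measurable P"
    unfolding phi_obs by (intro borel_measurable_times mw QYo)
  note mHQ = borel_measurable_integrable[OF HQ(1)]
  have int: "integrable P (\<lambda>\<omega>. mweight (Suc T) \<omega> * \<phi> (past (Suc T) (\<lambda>j. A j \<omega>)) (obs_traj (Suc T) \<omega>))"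
    using HQ(1) by (subst (asm) integrable_cong_AE[OF mHQ mm eq])
  have n: "Suc T \<le> Suc T" "Suc T = Suc T \<or> Suc T = Suc (Suc T)" "Suc T \<le> Suc T" by auto
  have "(\<integral>\<omega>. obsH (Suc T) \<omega> * Y \<omega> \<partial>P) = (\<integral>\<omega>. obsH (Suc T) \<omega> * QY (?o \<omega>) \<partial>P)"
    by (simp add: HQ(2))
  also have "\<dots> = (\<integral>\<omega>. mweight (Suc T) \<omega> * \<phi> (past (Suc T) (\<lambda>j. A j \<omega>)) (obs_traj (Suc T) \<omega>) \<partial>P)"
    by (rule integral_cong_AE[OF mHQ mm eq])
  also have "\<dots> = (\<Sum>b\<in>bin_seqs (Suc T). E_target (\<lambda>z. prod_\<pi> \<pi> (Suc T) (fst z) b (snd z) * \<phi> b (past_traj (Suc T) z)))"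
    by (rule integral_mweight(2)[OF n phi int])
  also have "\<dots> = front_door T \<mu>W \<mu>M p \<pi> g QY a"
    unfolding front_door_eq by (rule sum.cong) (auto simp: \<phi>_def past_bin_seqs)
  finally show ?thesis .
qed

lemma obsH_mweight:
  assumes H: "\<forall>t\<le>T. AE \<omega> in P. H_star N t (obs_hist W A M (Suc t) (Suc t) \<omega>) =
      H_true g a t (obs_hist W A M (Suc t) (Suc t) \<omega>)"
    and t: "t \<le> Suc T"
  shows "AE \<omega> in P. obsH t \<omega> = mweight t \<omega>"
proof (cases t)
  case (Suc s)
  then show ?thesis using H t by (simp add: obsH_Suc H_true_obs)
qed simp

text \<open>The density ratio moves the expectation to the target law and leaves the true treatment
  probabilities as weights. The integrability part is what later permits replacing \<open>rA\<close>
  by its regression under that law.\<close>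

lemma integral_H_RA:
  assumes H: "\<forall>t\<le>T. AE \<omega> in P. H_star N t (obs_hist W A M (Suc t) (Suc t) \<omega>) =
      H_true g a t (obs_hist W A M (Suc t) (Suc t) \<omega>)"
    and t: "t \<le> Suc T"
  shows "b \<in> bin_seqs t \<Longrightarrow> integrable (target_law (Suc T)) (\<lambda>z. prod_\<pi> \<pi> t (fst z) b (snd z) * rA t b z)"
    and "(\<integral>\<omega>. obsH t \<omega> * obsRA t \<omega> \<partial>P) =
      (\<Sum>b\<in>bin_seqs t. E_target (\<lambda>z. prod_\<pi> \<pi> t (fst z) b (snd z) * rA t b z))"
proof -
  have n: "t \<le> Suc T" "t = t \<or> t = Suc t" "t \<le> Suc T" using t by auto
  have phi_obs: "rA t (past t (\<lambda>j. A j \<omega>)) (obs_traj t \<omega>) = obsRA t \<omega>" for \<omega>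
    by (rule rA_obs[OF t])
  have eq: "AE \<omega> in P. obsH t \<omega> * obsRA t \<omega> = mweight t \<omega> * rA t (past t (\<lambda>j. A j \<omega>)) (obs_traj t \<omega>)"
    using obsH_mweight[OF H t] by eventually_elim (simp only: phi_obs)
  have m: "(\<lambda>\<omega>. obsH t \<omega> * obsRA t \<omega>) \<in> borel_measurable P"
    using integrable_H_RA[OF t] by simp
  have m': "(\<lambda>\<omega>. mweight t \<omega> * rA t (past t (\<lambda>j. A j \<omega>)) (obs_traj t \<omega>)) \<in> borel_measurable P"
    unfolding phi_obs
    by (intro borel_measurable_times measurable_mweight t) (rule obsRA_measurable[OF t])
  have int: "integrable P (\<lambda>\<omega>. mweight t \<omega> * rA t (past t (\<lambda>j. A j \<omega>)) (obs_traj t \<omega>))"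
    using integrable_H_RA[OF t] by (subst (asm) integrable_cong_AE[OF m m' eq])
  have past: "rA t b (past_traj t z) = rA t b z" if "b \<in> bin_seqs t" for b z
    using rA_past[OF t, of "fst z" b "snd z"] that by (simp add: past_bin_seqs)
  note * = integral_mweight[OF n rA_measurable[OF t] int]
  show "integrable (target_law (Suc T)) (\<lambda>z. prod_\<pi> \<pi> t (fst z) b (snd z) * rA t b z)" if b: "b \<in> bin_seqs t"
    using *(1)[OF b] by (simp only: past[OF b])
  show "(\<integral>\<omega>. obsH t \<omega> * obsRA t \<omega> \<partial>P) =
      (\<Sum>b\<in>bin_seqs t. E_target (\<lambda>z. prod_\<pi> \<pi> t (fst z) b (snd z) * rA t b z))"
    unfolding integral_cong_AE[OF m m' eq] *(2)
    by (rule sum.cong[OF refl]) (simp only: past)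
qed

text \<open>\<open>RM\<close> at time \<open>t\<close> already reads treatment \<open>t\<close> but
  not mediator \<open>t\<close>. Hence there is one more treatment probability than there are
  density ratios.\<close>

lemma integral_H_RM:
  assumes H: "\<forall>t\<le>T. AE \<omega> in P. H_star N t (obs_hist W A M (Suc t) (Suc t) \<omega>) =
      H_true g a t (obs_hist W A M (Suc t) (Suc t) \<omega>)"
    and t: "t \<le> T"
  shows "(\<integral>\<omega>. obsH t \<omega> * obsRM t \<omega> \<partial>P) =
      (\<Sum>b\<in>bin_seqs (Suc t). E_target (\<lambda>z. prod_\<pi> \<pi> (Suc t) (fst z) b (snd z) * rM t b z))"
proof -
  have n: "t \<le> Suc T" "Suc t = t \<or> Suc t = Suc t" "Suc t \<le> Suc T" using t by auto
  have eq: "AE \<omega> in P. obsH t \<omega> * obsRM t \<omega> = mweight t \<omega> * rM t (past (Suc t) (\<lambda>j. A j \<omega>)) (obs_traj t \<omega>)"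
    using obsH_mweight[OF H n(1)] by eventually_elim (simp only: rM_obs)
  have m: "(\<lambda>\<omega>. obsH t \<omega> * obsRM t \<omega>) \<in> borel_measurable P"
    using integrable_H_RM[OF t] by simp
  have m': "(\<lambda>\<omega>. mweight t \<omega> * rM t (past (Suc t) (\<lambda>j. A j \<omega>)) (obs_traj t \<omega>)) \<in> borel_measurable P"
    unfolding rM_obs
    by (intro borel_measurable_times measurable_mweight n) (rule obsRM_measurable[OF t])
  have int: "integrable P (\<lambda>\<omega>. mweight t \<omega> * rM t (past (Suc t) (\<lambda>j. A j \<omega>)) (obs_traj t \<omega>))"
    using integrable_H_RM[OF t] by (subst (asm) integrable_cong_AE[OF m m' eq])
  have past: "rM t b (past_traj t z) = rM t b z" for b z
    by (simp add: RM_def)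
  show ?thesis
    unfolding integral_cong_AE[OF m m' eq] integral_mweight(2)[OF n rM_measurable[OF t] int]
    by (rule sum.cong[OF refl]) (simp only: past)
qed

text \<open>The expectation of \<open>H_star\<close> times \<open>QY_star\<close> and the target
  expectation of \<open>qm (Suc T)\<close> are the same sum over treatment sequences, so they cancel
  whatever \<open>QY_star\<close> is.\<close>

lemma weights_and_treatment_correct:
  assumes H: "\<forall>t\<le>T. AE \<omega> in P. H_star N t (obs_hist W A M (Suc t) (Suc t) \<omega>) =
      H_true g a t (obs_hist W A M (Suc t) (Suc t) \<omega>)"
    and \<pi>: "\<forall>t\<le>T. \<forall>c.
      AE \<omega> in P. \<pi>_star N t (obs_hist W A M t t \<omega>) c = \<pi> t (obs_hist W A M t t \<omega>) c"
  shows "(\<integral>\<omega>. D_star T N a \<psi> (W \<omega>) (\<lambda>j. A j \<omega>) (\<lambda>j. M j \<omega>) (Y \<omega>) \<partial>P) =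
    front_door T \<mu>W \<mu>M p \<pi> g QY a - \<psi>"
  using integral_D_star_treatment[OF \<pi>, of \<psi>] E_target_qm_last'[OF \<pi>]
    integral_H_RA(2)[OF H le_refl] integral_H_Y[OF H[rule_format, OF le_refl]] by simp

text \<open>The residual of the true outcome regression has mean zero against any weight depending
  on the history, so \<open>H_star\<close> drops out; what remains is the functional written with
  the true \<open>QY\<close>.\<close>

lemma outcome_and_treatment_correct:
  assumes Q: "AE \<omega> in P. QY_star N (obs_hist W A M (Suc T) (Suc T) \<omega>) =
      QY (obs_hist W A M (Suc T) (Suc T) \<omega>)"
    and \<pi>: "\<forall>t\<le>T. \<forall>c.
      AE \<omega> in P. \<pi>_star N t (obs_hist W A M t t \<omega>) c = \<pi> t (obs_hist W A M t t \<omega>) c"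
  shows "(\<integral>\<omega>. D_star T N a \<psi> (W \<omega>) (\<lambda>j. A j \<omega>) (\<lambda>j. M j \<omega>) (Y \<omega>) \<partial>P) =
    front_door T \<mu>W \<mu>M p \<pi> g QY a - \<psi>"
proof -
  let ?o = "obs_hist W A M (Suc T) (Suc T)"
  have HQ: "integrable P (\<lambda>\<omega>. obsH (Suc T) \<omega> * QY (?o \<omega>))"
    "(\<integral>\<omega>. obsH (Suc T) \<omega> * QY (?o \<omega>) \<partial>P) = (\<integral>\<omega>. obsH (Suc T) \<omega> * Y \<omega> \<partial>P)"
    using integral_outcome[OF H_star_measurable[OF le_refl]] integrable_HY by (simp_all add: obsH_Suc)
  have "(\<integral>\<omega>. obsH (Suc T) \<omega> * obsRA (Suc T) \<omega> \<partial>P) = (\<integral>\<omega>. obsH (Suc T) \<omega> * QY (?o \<omega>) \<partial>P)"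
  proof (rule integral_cong_AE)
    show "AE \<omega> in P. obsH (Suc T) \<omega> * obsRA (Suc T) \<omega> = obsH (Suc T) \<omega> * QY (?o \<omega>)"
      using Q by eventually_elim (simp add: obsRA_last)
  qed (use integrable_H_RA[OF le_refl] HQ(1) in auto)
  moreover have "E_target (qm (Suc T)) = front_door T \<mu>W \<mu>M p \<pi> g QY a"
    unfolding E_target_qm_last'[OF \<pi>] front_door_eq
  proof (rule sum.cong[OF refl], rule integral_cong_AE)
    fix b assume b: "b \<in> bin_seqs (Suc T)"
    show "(\<lambda>z. prod_\<pi> \<pi> (Suc T) (fst z) b (snd z) * rA (Suc T) b z) \<in> borel_measurable (target_law (Suc T))"
      by (intro target_law_measurableI borel_measurable_times prod_\<pi>_true_measurable rA_measurable) auto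
    show "(\<lambda>z. prod_\<pi> \<pi> (Suc T) (fst z) b (snd z) * QY (fst z, b, past (Suc T) (snd z))) \<in> borel_measurable (target_law (Suc T))"
      using integrable_QY_target[OF b] by simp
    have meas: "{h \<in> space (hist_space \<mu>W \<mu>M (Suc T) (Suc T)). QY_star N h = QY h}
        \<in> sets (hist_space \<mu>W \<mu>M (Suc T) (Suc T))"
      using QY_star_measurable QY_measurable by measurable
    \<comment> \<open>Correctness of \<open>QY_star\<close> is known along observed histories only.
      It carries over to those \<open>b\<close> that have positive probability given the trajectory,
      and the other terms are multiplied by zero.\<close>
    have "AE z in target_law (Suc T). 0 < prod_\<pi> \<pi> (Suc T) (fst z) b (snd z) \<longrightarrow>
        QY_star N (fst z, past (Suc T) b, past (Suc T) (snd z)) = QY (fst z, past (Suc T) b, past (Suc T) (snd z))"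
      by (rule AE_obs_to_target[OF le_refl Q meas])
    then show "AE z in target_law (Suc T). prod_\<pi> \<pi> (Suc T) (fst z) b (snd z) * rA (Suc T) b z =
        prod_\<pi> \<pi> (Suc T) (fst z) b (snd z) * QY (fst z, b, past (Suc T) (snd z))"
      using AE_space
    proof eventually_elim
      case (elim z)
      have "0 \<le> prod_\<pi> \<pi> (Suc T) (fst z) b (snd z)"
        using elim(2) by (intro prod_\<pi>_true_nonneg[of _ "Suc T"]) auto
      then show ?case
        using elim b by (cases "prod_\<pi> \<pi> (Suc T) (fst z) b (snd z) = 0") (auto simp: rA_last past_bin_seqs)
    qed
  qed
  ultimately show ?thesis
    using integral_D_star_treatment[OF \<pi>, of \<psi>] HQ(2) by simp
qed

text \<open>A wrong \<open>\<pi>_star\<close> does no harm because it is used consistently: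
  \<open>QM\<close> at the last time and all \<open>RA\<close> average over treatments with the same
  candidate probabilities, so both chains of regressions arrive at the same expectation and its
  contributions cancel.\<close>

lemma regressions_and_weights_correct:
  assumes QM: "\<And>t. t \<le> T \<Longrightarrow> QM_is_tilde P T W A M \<mu>W \<mu>M N a t"
    and RM: "\<And>t. t \<le> T \<Longrightarrow> RM_is_tilde P T W A M \<mu>W \<mu>M N a t"
    and H: "\<forall>t\<le>T. AE \<omega> in P. H_star N t (obs_hist W A M (Suc t) (Suc t) \<omega>) =
      H_true g a t (obs_hist W A M (Suc t) (Suc t) \<omega>)"
  shows "(\<integral>\<omega>. D_star T N a \<psi> (W \<omega>) (\<lambda>j. A j \<omega>) (\<lambda>j. M j \<omega>) (Y \<omega>) \<partial>P) =
    front_door T \<mu>W \<mu>M p \<pi> g QY a - \<psi>"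
proof -
  have ceQ: "cond_exp_on P (hist_sigma P W A M \<mu>W \<mu>M (Suc t) t) (treated_event P A a t)
       (\<lambda>\<omega>. qm (Suc t) (obs_traj (Suc t) \<omega>)) (\<lambda>\<omega>. qm t (obs_traj t \<omega>))" if t: "t \<le> T" for t
    using QM[OF t] t unfolding QM_is_tilde_def by (simp add: qm_obs) (simp add: QM_def)
  have ceR: "cond_exp_on P (hist_sigma P W A M \<mu>W \<mu>M (Suc t) t) (treated_event P A a t)
       (\<lambda>\<omega>. rA (Suc t) b (obs_traj (Suc t) \<omega>)) (\<lambda>\<omega>. rM t b (obs_traj t \<omega>))"
    if t: "t \<le> T" and b: "b \<in> bin_seqs (Suc t)" for t b
  proof -
    have "rA (Suc t) b (obs_traj (Suc t) \<omega>) = RA T N (Suc t) (W \<omega>) b (\<lambda>j. M j \<omega>)" for \<omega>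
      using rA_past[of "Suc t" "W \<omega>" b "\<lambda>j. M j \<omega>"] t b by (simp add: obs_traj_def past_bin_seqs)
    moreover have "rM t b (obs_traj t \<omega>) = RM_star N t (W \<omega>, b, past t (\<lambda>j. M j \<omega>))" for \<omega>
      using b by (simp add: obs_traj_def RM_def past_bin_seqs)
    ultimately show ?thesis using RM[OF t] b unfolding RM_is_tilde_def by simp
  qed
  have rM_past': "RM N t w b (past t m) = RM N t w b m" for t w b m
    by (simp add: RM_def)
  have rA_past': "RA T N t w b (past t m) = RA T N t w b m" if "b \<in> bin_seqs t" "t \<le> Suc T" for t w b m
    using rA_past[of t w b m] that by (simp add: past_bin_seqs)

  \<comment> \<open>The candidate weight is a function of the conditioning history and vanishes off
    the event of following \<open>a\<close>, on which \<open>QM\<close> at \<open>t\<close> is the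
    conditional mean of \<open>QM\<close> at \<open>Suc t\<close>.\<close>
  have W_eq: "(\<integral>\<omega>. obsW t \<omega> * obsQM (Suc t) \<omega> \<partial>P) = (\<integral>\<omega>. obsW t \<omega> * obsQM t \<omega> \<partial>P)" if t: "t \<le> T" for t
  proof -
    let ?H = "hist_space \<mu>W \<mu>M (Suc t) t" and ?E = "agree a (Suc t)"
    let ?C = "{h \<in> space ?H. \<forall>j\<in>{..<Suc t}. fst (snd h) j = a j}"
    define f where "f h = indicator ?C h / prod_star (Suc t) a (fst h, snd (snd h))" for h
    have f: "f \<in> borel_measurable ?H"
      unfolding f_def[abs_def]
      by (intro borel_measurable_divide borel_measurable_indicator treatment_pred_measurable
          measurable_compose[OF hist_traj_measurable prod_star_measurable]) (use t in auto)
    have fo: "f (obs_hist W A M (Suc t) t \<omega>) = obsW t \<omega>" if w: "\<omega> \<in> space P" for \<omega>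
    proof -
      have "obs_hist W A M (Suc t) t \<omega> \<in> space ?H"
        by (rule measurable_space[OF obs_hist_measurable w]) (use t in auto)
      then have "obs_hist W A M (Suc t) t \<omega> \<in> ?C \<longleftrightarrow> \<omega> \<in> ?E"
        using w by (auto simp: agree_def obs_hist_def past_apply)
      then have "indicator ?C (obs_hist W A M (Suc t) t \<omega>) = (indicator ?E \<omega> :: real)"
        by (simp only: indicator_def)
      then show ?thesis
        unfolding f_def obsW_eq[OF w] by (simp add: obs_hist_def)
    qed
    have Wx: "obsW t \<omega> * (indicator ?E \<omega> * x) = obsW t \<omega> * x" if "\<omega> \<in> space P" for \<omega> x
      unfolding obsW_eq[OF that] by (simp add: indicator_def)
    have mE: "?E \<in> sets P" by (rule agree_measurable) (use t in auto)
    have mq: "(\<lambda>\<omega>. indicator ?E \<omega> * obsQM s \<omega>) \<in> borel_measurable P" if s: "s \<le> Suc T" for s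
      using measurable_compose[OF obs_traj_measurable[OF s] qm_measurable[OF s]] mE
      by (simp add: qm_obs[OF s])
    have tt: "Suc t \<le> Suc T" "t \<le> Suc T" using t by auto
    have eq: "AE \<omega> in P. f (obs_hist W A M (Suc t) t \<omega>) * (indicator ?E \<omega> * obsQM t \<omega>) =
        f (obs_hist W A M (Suc t) t \<omega>) * real_cond_exp P (hist_sigma P W A M \<mu>W \<mu>M (Suc t) t)
          (\<lambda>\<omega>. indicator ?E \<omega> * obsQM (Suc t) \<omega>) \<omega>"
      using ceQ[OF t, unfolded cond_exp_on_def treated_event_eq qm_obs[OF tt(1)] qm_obs[OF tt(2)]] AE_space
      by eventually_elim (auto simp: fo obsW_eq indicator_def)
    have int: "integrable P (\<lambda>\<omega>. f (obs_hist W A M (Suc t) t \<omega>) * (indicator ?E \<omega> * obsQM (Suc t) \<omega>))"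
      using integrable_W_QM_Suc[OF t] by (simp only: fo Wx cong: Bochner_Integration.integrable_cong)
    show ?thesis
      using integral_mult_cond_exp(2)[OF tt f mq[OF tt(1)] mq[OF tt(2)] eq int]
      by (simp only: fo Wx cong: Bochner_Integration.integral_cong)
  qed

  \<comment> \<open>Backward iteration with multiplier 1. Integrability is part of the claim since
    each regression step requires it of the later function.\<close>
  have qm_const: "integrable (target_law (Suc T)) (qm t) \<and> E_target (qm t) = E_target (qm (Suc T))"
    if "t \<le> Suc T" for t
    using that
  proof (induction t rule: inc_induct)
    case base
    show ?case using integrable_qm_last by simp
  next
    case (step t)
    then have t: "t \<le> T" "t \<le> Suc T" "Suc t \<le> Suc T" by auto
    have "integrable (target_law (Suc T)) (\<lambda>z. 1 * qm (Suc t) (past_traj (Suc t) z))"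
      using step.IH t by (simp add: qm_past)
    note * = cond_exp_on_target[OF t(1) qm_measurable[OF t(3)] qm_measurable[OF t(2)]
        borel_measurable_const ceQ[OF t(1)] this]
    show ?case using * step.IH t by (simp add: qm_past)
  qed

  \<comment> \<open>Each backward step replaces \<open>rA (Suc t)\<close> by its regression
    \<open>rM t\<close> and then sums out treatment \<open>t\<close>. The multiplier must be the
    candidate product, because \<open>RA\<close> averages \<open>RM\<close> with
    \<open>\<pi>_star\<close>.\<close>
  have R_const: "(\<forall>b\<in>bin_seqs t. integrable (target_law (Suc T)) (\<lambda>z. prod_star t b z * rA t b z)) \<and>
      (\<Sum>b\<in>bin_seqs t. E_target (\<lambda>z. prod_star t b z * rA t b z)) = E_target (qm (Suc T))"
    if "t \<le> Suc T" for t
    using that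
  proof (induction t rule: inc_induct)
    case base
    show ?case using integrable_star_target E_target_qm_last by simp
  next
    case (step t)
    then have t: "t \<le> T" "t \<le> Suc T" "Suc t \<le> Suc T" by auto
    have M: "integrable (target_law (Suc T)) (\<lambda>z. prod_star (Suc t) b z * rM t b z) \<and>
        E_target (\<lambda>z. prod_star (Suc t) b z * rM t b z) = E_target (\<lambda>z. prod_star (Suc t) b z * rA (Suc t) b z)"
      if b: "b \<in> bin_seqs (Suc t)" for b
    proof -
      have c: "(\<lambda>z. prod_star (Suc t) b z) \<in> borel_measurable (traj t)"
        by (rule prod_star_measurable) (use t in auto)
      have "integrable (target_law (Suc T)) (\<lambda>z. prod_star (Suc t) b (past_traj t z) * rA (Suc t) b (past_traj (Suc t) z))"
        using step.IH b t by (simp add: rA_past')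
      note * = cond_exp_on_target[OF t(1) rA_measurable[OF t(3)] rM_measurable[OF t(1)] c ceR[OF t(1) b] this]
      show ?thesis using * b t by (simp add: rA_past' rM_past')
    qed
    have split: "prod_star t b z * rA t b z = (\<Sum>c\<in>UNIV. prod_star (Suc t) (b(t := c)) z * rM t (b(t := c)) z)"
      if "b \<in> bin_seqs t" for b z
    proof -
      have "prod_star t (b(t := c)) z = prod_star t b z" for c
        by (rule prod_\<pi>_cong) auto
      then show ?thesis
        using t unfolding RA_def by (simp add: prod_\<pi>_Suc sum_distrib_left mult_ac)
    qed
    have upd: "b(t := c) \<in> bin_seqs (Suc t)" if "b \<in> bin_seqs t" for b c
      using that by (auto simp: bin_seqs_def PiE_def extensional_def)
    have "(\<Sum>b\<in>bin_seqs t. E_target (\<lambda>z. prod_star t b z * rA t b z))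
        = (\<Sum>b\<in>bin_seqs t. \<Sum>c\<in>UNIV. E_target (\<lambda>z. prod_star (Suc t) (b(t := c)) z * rM t (b(t := c)) z))"
      by (rule sum.cong[OF refl], simp only: split, rule Bochner_Integration.integral_sum) (use M upd in blast)
    also have "\<dots> = (\<Sum>b\<in>bin_seqs (Suc t). E_target (\<lambda>z. prod_star (Suc t) b z * rM t b z))"
      by (rule sum_bin_seqs_Suc[symmetric])
    also have "\<dots> = E_target (qm (Suc T))"
      using step.IH M by simp
    finally show ?case
      using M upd by (auto simp only: split intro!: Bochner_Integration.integrable_sum)
  qed

  \<comment> \<open>Here the multiplier is the product of true probabilities, the weight that the
    density ratios leave under the target law.\<close>
  have H_step: "(\<integral>\<omega>. obsH t \<omega> * obsRM t \<omega> \<partial>P) = (\<integral>\<omega>. obsH (Suc t) \<omega> * obsRA (Suc t) \<omega> \<partial>P)" if t: "t \<le> T" for t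
  proof -
    have tt: "Suc t \<le> Suc T" using t by simp
    note HA = integral_H_RA[OF H tt]
    have "E_target (\<lambda>z. prod_\<pi> \<pi> (Suc t) (fst z) b (snd z) * rM t b z) =
        E_target (\<lambda>z. prod_\<pi> \<pi> (Suc t) (fst z) b (snd z) * rA (Suc t) b z)" if b: "b \<in> bin_seqs (Suc t)" for b
    proof -
      have c: "(\<lambda>z. prod_\<pi> \<pi> (Suc t) (fst z) b (snd z)) \<in> borel_measurable (traj t)"
        by (rule prod_\<pi>_true_measurable) (use t in auto)
      have "integrable (target_law (Suc T)) (\<lambda>z. prod_\<pi> \<pi> (Suc t) (fst (past_traj t z)) b (snd (past_traj t z)) *
          rA (Suc t) b (past_traj (Suc t) z))"
        using HA(1)[OF b] b tt by (simp add: rA_past')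
      note * = cond_exp_on_target(2)[OF t rA_measurable[OF tt] rM_measurable[OF t] c ceR[OF t b] this]
      show ?thesis using * b tt by (simp add: rA_past' rM_past')
    qed
    then show ?thesis
      unfolding integral_H_RM[OF H t] HA(2) by (intro sum.cong) auto
  qed

  have "(\<Sum>t\<le>T. (\<integral>\<omega>. obsH t \<omega> * obsRM t \<omega> \<partial>P) - (\<integral>\<omega>. obsH t \<omega> * obsRA t \<omega> \<partial>P))
      = (\<Sum>t<Suc T. (\<integral>\<omega>. obsH (Suc t) \<omega> * obsRA (Suc t) \<omega> \<partial>P) - (\<integral>\<omega>. obsH t \<omega> * obsRA t \<omega> \<partial>P))"
    by (rule sum.cong) (auto simp: H_step)
  also have "\<dots> = (\<integral>\<omega>. obsH (Suc T) \<omega> * obsRA (Suc T) \<omega> \<partial>P) - (\<integral>\<omega>. obsH 0 \<omega> * obsRA 0 \<omega> \<partial>P)"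
    by (rule sum_lessThan_telescope)
  \<comment> \<open>At time 0 the true and the candidate treatment products are both empty. This is
    where the sum weighted by true probabilities meets the one weighted by candidate
    probabilities.\<close>
  also have "(\<integral>\<omega>. obsH 0 \<omega> * obsRA 0 \<omega> \<partial>P) = E_target (qm (Suc T))"
    using integral_H_RA(2)[OF H le0] R_const[OF le0] by simp
  also have "\<dots> = (\<integral>\<omega>. obsQM 0 \<omega> \<partial>P)"
    unfolding integral_QM_0 using qm_const[OF le0] by simp
  finally show ?thesis
    unfolding integral_D_star integral_H_Y[OF H[rule_format, OF le_refl]] by (simp add: W_eq)
qed

end

theorem lemma1:
  fixes P :: "'o measure" and T :: nat
    and W :: "'o \<Rightarrow> real^'d" and A :: "nat \<Rightarrow> 'o \<Rightarrow> bool"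
    and M :: "nat \<Rightarrow> 'o \<Rightarrow> real^'p" and Y :: "'o \<Rightarrow> real"
    and MM :: "nat \<Rightarrow> (real^'p) set"
    and \<mu>W :: "(real^'d) measure" and \<mu>M :: "nat \<Rightarrow> (real^'p) measure"
    and p :: "real^'d \<Rightarrow> real"
    and \<pi> :: "nat \<Rightarrow> (real^'d, real^'p) hist \<Rightarrow> bool \<Rightarrow> real"
    and g :: "nat \<Rightarrow> (real^'d, real^'p) hist \<Rightarrow> real^'p \<Rightarrow> real"
    and QY :: "(real^'d, real^'p) hist \<Rightarrow> real"
    and a :: "nat \<Rightarrow> bool"
    and N :: "(real^'d, real^'p) nuisance"
    and \<psi>_star :: real
  assumes "true_nuisance P T W A M Y MM \<mu>W \<mu>M p \<pi> g QY"
    and "a \<in> bin_seqs (Suc T)"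
    and "positivity_treatment T \<mu>W \<mu>M p \<pi> g a"
    and "positivity_mediator T \<mu>W \<mu>M p \<pi> g a"
    and "candidate_nuisance T \<mu>W \<mu>M N"
    and "\<And>t. t \<le> T \<Longrightarrow>
           AE \<omega> in P. \<omega> \<in> treated_event P A a t \<longrightarrow> 0 < \<pi>_star N t (obs_hist W A M t t \<omega>) (a t)"
    and "products_integrable P T W A M Y N a"
    and "((\<forall>t\<le>T. AE \<omega> in P. H_star N t (obs_hist W A M (Suc t) (Suc t) \<omega>) =
                             H_true g a t (obs_hist W A M (Suc t) (Suc t) \<omega>)) \<and>
          (\<forall>t\<le>T. \<forall>b. AE \<omega> in P. \<pi>_star N t (obs_hist W A M t t \<omega>) b =
                                 \<pi> t (obs_hist W A M t t \<omega>) b))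
       \<or> ((AE \<omega> in P. QY_star N (obs_hist W A M (Suc T) (Suc T) \<omega>) =
                       QY (obs_hist W A M (Suc T) (Suc T) \<omega>)) \<and>
          (\<forall>t\<le>T. \<forall>b. AE \<omega> in P. \<pi>_star N t (obs_hist W A M t t \<omega>) b =
                                 \<pi> t (obs_hist W A M t t \<omega>) b))
       \<or> ((\<forall>t\<le>T. QM_is_tilde P T W A M \<mu>W \<mu>M N a t) \<and>
          (\<forall>t\<le>T. RM_is_tilde P T W A M \<mu>W \<mu>M N a t) \<and>
          (\<forall>t\<le>T. AE \<omega> in P. H_star N t (obs_hist W A M (Suc t) (Suc t) \<omega>) =
                             H_true g a t (obs_hist W A M (Suc t) (Suc t) \<omega>)))"
  shows "(\<integral>\<omega>. D_star T N a \<psi>_star (W \<omega>) (\<lambda>j. A j \<omega>) (\<lambda>j. M j \<omega>) (Y \<omega>) \<partial>P) =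
           front_door T \<mu>W \<mu>M p \<pi> g QY a - \<psi>_star"
proof -
  interpret true_nuisance P T W A M Y MM \<mu>W \<mu>M p \<pi> g QY by fact
  interpret candidate_setting P T W A M Y MM \<mu>W \<mu>M p \<pi> g QY a N
    by unfold_locales (use assms in auto)
  from assms(8) show ?thesis
    using weights_and_treatment_correct[of \<psi>_star] outcome_and_treatment_correct[of \<psi>_star]
      regressions_and_weights_correct[of \<psi>_star] by blast
qed

end
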